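(* Consider the Hill operator with a potential of the form $v(x)=ae^{-2ix}+be^{2ix}$, $a,b\in\mathbb{C}\setminus\{0\}$. If $|a|\ne|b|$, then there are choices, for every $n$, of square roots $\sqrt{a^n}$ of $a^n$ and $\sqrt{b^n}$ of $b^n$ such that, as $n\to\infty$, $n\in\mathbb{N}$, $$\gamma_n\sim\frac{8\sqrt{a^n}\sqrt{b^n}}{4^n[(n-1)!]^2},$$ $$\mu_n-\lambda_n^+\sim-\frac{2}{4^n[(n-1)!]^2}\left(a^n+b^n+2\sqrt{a^n}\sqrt{b^n}\right),$$ $$\mu_n-\lambda_n^-\sim-\frac{2}{4^n[(n-1)!]^2}\left(a^n+b^n-2\sqrt{a^n}\sqrt{b^n}\right).$$ Moreover, $$\mu_n-\frac12(\lambda_n^-+\lambda_n^+)\sim-\frac{2}{4^n[(n-1)!]^2}\left(a^n+b^n\right),\qquad n\in\mathbb{N}.$$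
   Context: The Hill operator is $Ly=-y''+v(x)y$ on $[0,\pi]$, considered with Dirichlet conditions $y(0)=y(\pi)=0$, periodic conditions $Per^+$ or antiperiodic conditions $Per^-$: $y(\pi)=\pm y(0)$, $y'(\pi)=\pm y'(0)$. For large enough $n\in\mathbb{N}$ the disc $|\lambda-n^2|<n/4$ contains exactly one Dirichlet eigenvalue $\mu_n$ and exactly two eigenvalues $\lambda_n^-,\lambda_n^+$ (counted with multiplicity), periodic if $n$ is even and antiperiodic if $n$ is odd. $\lambda_n^+$ denotes the one with larger real part (larger imaginary part if the real parts are equal), and $\gamma_n=\lambda_n^+-\lambda_n^-$. $f(n)\sim g(n)$ means $f(n)/g(n)\to1$. *)

theory Defs
  imports "HOL-Analysis.Analysis" "HOL-Library.Function_Algebras"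
begin

text \<open>
  A function on \<open>[0, \<pi>]\<close> is represented by a function \<open>real \<Rightarrow> complex\<close> that vanishes outside
  \<open>[0, \<pi>]\<close>, so that equality of representatives is equality on \<open>[0, \<pi>]\<close> and such functions
  form a complex vector space. Derivatives are one-sided at the end points.
\<close>

definition D :: "(real \<Rightarrow> complex) \<Rightarrow> real \<Rightarrow> complex" where
  "D y x = (if x \<in> {0..pi} then vector_derivative y (at x within {0..pi}) else 0)"

definition C2_interval :: "(real \<Rightarrow> complex) set" where
  "C2_interval = {y. (\<forall>x. x \<notin> {0..pi} \<longrightarrow> y x = 0) \<and>
     y differentiable_on {0..pi} \<and> D y differentiable_on {0..pi} \<and>
     continuous_on {0..pi} (D (D y))}"

datatype boundary_condition = Dirichlet | Periodic | Antiperiodic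

fun satisfies_bc :: "boundary_condition \<Rightarrow> (real \<Rightarrow> complex) \<Rightarrow> bool" where
  "satisfies_bc Dirichlet y \<longleftrightarrow> y 0 = 0 \<and> y pi = 0"
| "satisfies_bc Periodic y \<longleftrightarrow> y pi = y 0 \<and> D y pi = D y 0"
| "satisfies_bc Antiperiodic y \<longleftrightarrow> y pi = - y 0 \<and> D y pi = - D y 0"

text \<open>
  The classical domain. For a continuous potential every eigenfunction and every root function of
  the closed operator in \<open>L\<^sup>2\<close> is of class \<open>C\<^sup>2\<close>, so eigenvalues and root spaces are unaffected.
\<close>

definition hill_domain :: "boundary_condition \<Rightarrow> (real \<Rightarrow> complex) set" where
  "hill_domain bc = {y \<in> C2_interval. satisfies_bc bc y}"

definition hill_op :: "(real \<Rightarrow> complex) \<Rightarrow> (real \<Rightarrow> complex) \<Rightarrow> real \<Rightarrow> complex" where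
  "hill_op v y x = (if x \<in> {0..pi} then - D (D y) x + v x * y x else 0)"

definition hill_eigenvalue :: "(real \<Rightarrow> complex) \<Rightarrow> boundary_condition \<Rightarrow> complex \<Rightarrow> bool" where
  "hill_eigenvalue v bc l \<longleftrightarrow>
     (\<exists>y \<in> hill_domain bc. y \<noteq> (\<lambda>x. 0) \<and> hill_op v y = (\<lambda>x. l * y x))"

text \<open>The kernel of \<open>(L - l)\<^sup>k\<close>, with its natural domain.\<close>

primrec hill_kernel ::
  "(real \<Rightarrow> complex) \<Rightarrow> boundary_condition \<Rightarrow> complex \<Rightarrow> nat \<Rightarrow> (real \<Rightarrow> complex) set" where
  "hill_kernel v bc l 0 = {\<lambda>x. 0}"
| "hill_kernel v bc l (Suc k) =
     {y \<in> hill_domain bc. (\<lambda>x. hill_op v y x - l * y x) \<in> hill_kernel v bc l k}"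

definition root_space ::
  "(real \<Rightarrow> complex) \<Rightarrow> boundary_condition \<Rightarrow> complex \<Rightarrow> (real \<Rightarrow> complex) set" where
  "root_space v bc l = (\<Union>k. hill_kernel v bc l k)"

lemma vector_space_complex_fun:
  "vector_space (\<lambda>(c::complex) (f::real \<Rightarrow> complex) x. c * f x)"
  by standard (auto simp: fun_eq_iff algebra_simps)

definition alg_mult :: "(real \<Rightarrow> complex) \<Rightarrow> boundary_condition \<Rightarrow> complex \<Rightarrow> nat" where
  "alg_mult v bc l =
     vector_space.dim (\<lambda>(c::complex) (f::real \<Rightarrow> complex) x. c * f x) (root_space v bc l)"

definition disc :: "nat \<Rightarrow> complex set" where
  "disc n = {l. cmod (l - (of_nat n)\<^sup>2) < real n / 4}"

definition bc_of :: "nat \<Rightarrow> boundary_condition" where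
  "bc_of n = (if even n then Periodic else Antiperiodic)"

text \<open>
  The eigenvalues below are determined by their description only for all sufficiently large \<open>n\<close>;
  the values for the remaining \<open>n\<close> are irrelevant for asymptotic statements.
\<close>

definition mu :: "(real \<Rightarrow> complex) \<Rightarrow> nat \<Rightarrow> complex" where
  "mu v n = (THE m. {l \<in> disc n. hill_eigenvalue v Dirichlet l} = {m} \<and> alg_mult v Dirichlet m = 1)"

definition is_eigenvalue_pair :: "(real \<Rightarrow> complex) \<Rightarrow> nat \<Rightarrow> complex \<Rightarrow> complex \<Rightarrow> bool" where
  "is_eigenvalue_pair v n p q \<longleftrightarrow>
     {l \<in> disc n. hill_eigenvalue v (bc_of n) l} = {p, q} \<and>
     (if p = q then alg_mult v (bc_of n) p = 2
      else alg_mult v (bc_of n) p = 1 \<and> alg_mult v (bc_of n) q = 1) \<and>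
     (Re p < Re q \<or> Re p = Re q \<and> Im p \<le> Im q)"

definition lambda_minus :: "(real \<Rightarrow> complex) \<Rightarrow> nat \<Rightarrow> complex" where
  "lambda_minus v n = (THE p. \<exists>q. is_eigenvalue_pair v n p q)"

definition lambda_plus :: "(real \<Rightarrow> complex) \<Rightarrow> nat \<Rightarrow> complex" where
  "lambda_plus v n = (THE q. \<exists>p. is_eigenvalue_pair v n p q)"

definition gap :: "(real \<Rightarrow> complex) \<Rightarrow> nat \<Rightarrow> complex" where
  "gap v n = lambda_plus v n - lambda_minus v n"

definition two_exp_potential :: "complex \<Rightarrow> complex \<Rightarrow> real \<Rightarrow> complex" where
  "two_exp_potential a b x =
     a * exp (- 2 * \<i> * complex_of_real x) + b * exp (2 * \<i> * complex_of_real x)"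

definition ratio_equiv :: "(nat \<Rightarrow> complex) \<Rightarrow> (nat \<Rightarrow> complex) \<Rightarrow> bool" (infix "\<simeq>" 50) where
  "f \<simeq> g \<longleftrightarrow> (\<lambda>n. f n / g n) \<longlonglongrightarrow> 1"

end

theory Submission imports Defs begin

text \<open>
  Choose complex numbers \<open>c\<close> and \<open>t\<close> with \<open>a = c exp (- 2 i t)\<close> and \<open>b = c exp (2 i t)\<close>; then
  \<open>c\<^sup>2 = a b\<close> and \<open>v x = 2 c cos (2 (x + t))\<close>, so up to a complex translation the operator is a
  Mathieu operator. The translation is genuinely complex, \<open>Im t \<noteq> 0\<close>, exactly because
  \<open>|a| \<noteq> |b|\<close>. Periodicity and antiperiodicity survive the translation, so these spectra depend on
  \<open>c\<close> only, and near \<open>n\<^sup>2\<close> they consist of one eigenvalue \<open>lc\<close> with an even and one eigenvalue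
  \<open>ls\<close> with an odd Mathieu function.

  The gap. In Fourier coefficients the Mathieu equation is a three-term recurrence with off-diagonal
  entries \<open>c\<close> and diagonal entries \<open>\<lambda> - k\<^sup>2\<close>, which are small only at the resonant frequencies
  \<open>k = \<plusminus>n\<close>. Off resonance the recurrence is a contraction. This gives existence of the even and the odd
  solution (\<open>mathieu_seq_exists\<close>), decay of every bounded solution (\<open>bounded_solution_decay\<close>) and
  uniqueness of the parameter (\<open>mathieu_parameter_unique\<close>). The two parameters differ only through
  the coupling of \<open>n\<close> with \<open>-n\<close> across the \<open>n - 1\<close> frequencies in between, each of which contributes
  a factor \<open>c / (n\<^sup>2 - k\<^sup>2)\<close>: \<open>mathieu_gap\<close> is the exact formula, \<open>shoot_asymptotics\<close> evaluates the
  product, and \<open>lc - ls\<close> is asymptotic to \<open>8 c\<^sup>n / (4\<^sup>n ((n - 1)!)\<^sup>2)\<close>.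

  The Dirichlet eigenvalue \<open>\<mu>\<close> is not invariant under the translation. Let \<open>s\<close> be the solution at
  \<open>\<lambda> = lc\<close> with \<open>s 0 = 0\<close>. The Wronskians of \<open>s\<close> with the Dirichlet eigenfunction and with the two
  Floquet eigenfunctions express \<open>lc - \<mu>\<close> exactly as \<open>lc - ls\<close> times a product of quantities with known
  asymptotics (\<open>comparison_identity\<close>). The outcome is \<open>lc - \<mu> \<sim> (lc - ls) cos\<^sup>2 (n t)\<close> and, with the
  roles of the Floquet eigenfunctions exchanged, \<open>ls - \<mu> \<sim> - (lc - ls) sin\<^sup>2 (n t)\<close>. Having a product is
  the point: \<open>cos\<^sup>2 (n t)\<close> and \<open>- sin\<^sup>2 (n t)\<close> are exponentially large and almost equal, so
  additive errors would be fatal. One factor, the Wronskian of the two Floquet eigenfunctions at \<open>t\<close>, is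
  itself a difference of large terms, but its derivative contains the superexponentially small factor
  \<open>lc - ls\<close>, so it may be evaluated at the origin instead (\<open>wronskian_center\<close>, \<open>wronskian_at_shift\<close>). Since
  \<open>4 c\<^sup>n cos\<^sup>2 (n t) = a\<^sup>n + b\<^sup>n + 2 c\<^sup>n\<close>, this is the assertion, with the square roots chosen such that
  their product is \<open>c\<^sup>n\<close> or \<open>- c\<^sup>n\<close> according to whether the larger eigenvalue is \<open>lc\<close> or \<open>ls\<close>.

  It remains to know that the disc contains no other eigenvalues and that these are algebraically
  simple. The Fourier coefficients of an arbitrary Floquet eigenfunction form a bounded solution
  of the recurrence after the translation, and these are classified
  (\<open>bounded_solution_classification\<close>). Dirichlet eigenfunctions
  are uniformly close to multiples of \<open>sin (n x)\<close> by a Volterra integral equation, hence for large \<open>n\<close> two of them are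
  never orthogonal in the bilinear sense. Generalized eigenfunctions are excluded
  because the bilinear square of the eigenfunction does not vanish.
\<close>

section \<open>Solutions of the Hill equation on the basic interval\<close>

text \<open>
  Carrying the derivatives along as explicit functions, one-sided at the end points, avoids all
  reasoning about the choice of representatives outside the interval.
\<close>
definition twice_deriv :: "(real \<Rightarrow> complex) \<Rightarrow> (real \<Rightarrow> complex) \<Rightarrow> (real \<Rightarrow> complex) \<Rightarrow> bool" where
  "twice_deriv y y1 y2 \<longleftrightarrow> (\<forall>x\<in>{0..pi}.
     (y has_vector_derivative y1 x) (at x within {0..pi}) \<and>
     (y1 has_vector_derivative y2 x) (at x within {0..pi}))"

definition hill_sol :: "(real \<Rightarrow> complex) \<Rightarrow> complex \<Rightarrow> (real \<Rightarrow> complex) \<Rightarrow> (real \<Rightarrow> complex) \<Rightarrow> bool" where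
  "hill_sol v l y y1 \<longleftrightarrow> twice_deriv y y1 (\<lambda>x. (v x - l) * y x)"

lemma green_identity:
  assumes y: "twice_deriv y y1 y2" and u: "twice_deriv u u1 u2" and t: "t \<in> {0..pi}"
  shows "((\<lambda>x. y x * u2 x - y2 x * u x) has_integral
           ((y t * u1 t - y1 t * u t) - (y 0 * u1 0 - y1 0 * u 0))) {0..t}"
proof (rule fundamental_theorem_of_calculus)
  show "0 \<le> t" using t by simp
  fix x assume x: "x \<in> {0..t}"
  hence x': "x \<in> {0..pi}" and sub: "{0..t} \<subseteq> {0..pi}" using t by auto
  have "(y has_vector_derivative y1 x) (at x within {0..t})"
    "(y1 has_vector_derivative y2 x) (at x within {0..t})"
    "(u has_vector_derivative u1 x) (at x within {0..t})"
    "(u1 has_vector_derivative u2 x) (at x within {0..t})"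
    using y u x' sub unfolding twice_deriv_def
    by (meson has_vector_derivative_within_subset)+
  note d = this
  show "((\<lambda>x. y x * u1 x - y1 x * u x) has_vector_derivative (y x * u2 x - y2 x * u x)) (at x within {0..t})"
    using has_vector_derivative_diff[OF has_vector_derivative_mult[OF d(1,4)] has_vector_derivative_mult[OF d(2,3)]]
    by simp
qed

lemma twice_deriv_complex:
  assumes "\<And>z. (f has_field_derivative f1 z) (at z)" "\<And>z. (f1 has_field_derivative f2 z) (at z)"
  shows "twice_deriv (\<lambda>x. f (of_real x)) (\<lambda>x. f1 (of_real x)) (\<lambda>x. f2 (of_real x))"
  unfolding twice_deriv_def
  using has_vector_derivative_real_field[OF assms(1)] has_vector_derivative_real_field[OF assms(2)]
  by blast

lemma twice_deriv_sin:
  "twice_deriv (\<lambda>x. sin (w * of_real x)) (\<lambda>x. w * cos (w * of_real x)) (\<lambda>x. - w\<^sup>2 * sin (w * of_real x))"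
  by (rule twice_deriv_complex) (auto intro!: derivative_eq_intros simp: power2_eq_square)

lemma twice_deriv_cos:
  "twice_deriv (\<lambda>x. cos (w * of_real x)) (\<lambda>x. - w * sin (w * of_real x)) (\<lambda>x. - w\<^sup>2 * cos (w * of_real x))"
  by (rule twice_deriv_complex) (auto intro!: derivative_eq_intros simp: power2_eq_square)

lemma twice_deriv_add:
  "twice_deriv y y1 y2 \<Longrightarrow> twice_deriv u u1 u2 \<Longrightarrow>
    twice_deriv (\<lambda>x. y x + u x) (\<lambda>x. y1 x + u1 x) (\<lambda>x. y2 x + u2 x)"
  unfolding twice_deriv_def by (auto intro!: has_vector_derivative_add)

lemma twice_deriv_scale:
  "twice_deriv y y1 y2 \<Longrightarrow> twice_deriv (\<lambda>x. k * y x) (\<lambda>x. k * y1 x) (\<lambda>x. k * y2 x)"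
  unfolding twice_deriv_def by (auto intro!: has_vector_derivative_mult_right)

lemma twice_deriv_cong:
  "twice_deriv y y1 y2 \<Longrightarrow> (\<And>x. x \<in> {0..pi} \<Longrightarrow> y2 x = u2 x) \<Longrightarrow> twice_deriv y y1 u2"
  unfolding twice_deriv_def by simp

lemma hill_sol_scale: "hill_sol v l y y1 \<Longrightarrow> hill_sol v l (\<lambda>x. k * y x) (\<lambda>x. k * y1 x)"
  unfolding hill_sol_def by (drule twice_deriv_scale[where k=k]) (simp add: mult_ac)

lemma hill_sol_add: "hill_sol v l y y1 \<Longrightarrow> hill_sol v l u u1 \<Longrightarrow> hill_sol v l (\<lambda>x. y x + u x) (\<lambda>x. y1 x + u1 x)"
  unfolding hill_sol_def by (drule (1) twice_deriv_add) (simp add: algebra_simps)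

lemma twice_deriv_continuous:
  assumes "twice_deriv y y1 y2"
  shows "continuous_on {0..pi} y" "continuous_on {0..pi} y1"
  using assms unfolding twice_deriv_def
  by (auto simp: continuous_on_eq_continuous_within intro: has_vector_derivative_continuous)

lemma hill_sol_continuous:
  assumes "hill_sol v l y y1"
  shows "continuous_on {0..pi} y" "continuous_on {0..pi} y1"
  using assms twice_deriv_continuous unfolding hill_sol_def by blast+

lemma lagrange_identity:
  assumes "hill_sol v l y y1" "hill_sol v m u u1"
  shows "((\<lambda>x. (l - m) * (y x * u x)) has_integral
           ((y pi * u1 pi - y1 pi * u pi) - (y 0 * u1 0 - y1 0 * u 0))) {0..pi}"
  using green_identity[OF assms[unfolded hill_sol_def], of pi] by (simp add: algebra_simps)

lemma lagrange_identity_integral: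
  assumes "hill_sol v l y y1" "hill_sol v m u u1"
  shows "(l - m) * integral {0..pi} (\<lambda>x. y x * u x) =
           (y pi * u1 pi - y1 pi * u pi) - (y 0 * u1 0 - y1 0 * u 0)"
  using integral_unique[OF lagrange_identity[OF assms]] by simp

text \<open>
  Green's identity against the free solution \<open>sin (w (x - t)) / w\<close>, which vanishes at \<open>t = x\<close>. A
  complex \<open>w\<close> is allowed because the spectral parameter is complex.
\<close>
lemma variation_of_constants:
  assumes y: "twice_deriv y y1 y2" and x: "x \<in> {0..pi}" and w: "w \<noteq> (0::complex)"
  shows "((\<lambda>t. sin (w * of_real (x - t)) / w * (y2 t + w\<^sup>2 * y t)) has_integral
           (y x - y 0 * cos (w * of_real x) - y1 0 * sin (w * of_real x) / w)) {0..x}"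
proof -
  have "twice_deriv (\<lambda>t. sin (w * (of_real x - of_real t)) / w) (\<lambda>t. - cos (w * (of_real x - of_real t)))
          (\<lambda>t. - w * sin (w * (of_real x - of_real t)))"
    by (rule twice_deriv_complex) (use w in \<open>auto intro!: derivative_eq_intros\<close>)
  note g = has_integral_neg[OF green_identity[OF y this x]]
  show ?thesis
    by (rule has_integral_eq_rhs[OF has_integral_eq[OF _ g]])
      (use w in \<open>simp_all add: field_simps power2_eq_square\<close>)
qed

text \<open>
  The integral equation turns smallness of \<open>(V + |l - w\<^sup>2|) / |w|\<close> into closeness of a solution to
  the free solution with the same initial values; \<open>g\<close> is an inhomogeneity.
\<close>
lemma volterra_bound:
  assumes y: "twice_deriv y y1 y2" and x: "x \<in> {0..pi}" and w: "w \<noteq> (0::complex)"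
    and eq: "\<And>t. t \<in> {0..pi} \<Longrightarrow> y2 t = p t * y t + g t"
    and P: "\<And>t. t \<in> {0..pi} \<Longrightarrow> cmod (p t + w\<^sup>2) \<le> P"
    and G: "\<And>t. t \<in> {0..pi} \<Longrightarrow> cmod (g t) \<le> G"
    and Y: "\<And>t. t \<in> {0..pi} \<Longrightarrow> cmod (y t) \<le> Y"
    and E: "\<And>t. t \<in> {0..pi} \<Longrightarrow> cmod (sin (w * of_real t)) \<le> E"
  shows "cmod (y x - y 0 * cos (w * of_real x) - y1 0 * sin (w * of_real x) / w)
           \<le> pi * E / cmod w * (P * Y + G)"
proof -
  have 0: "0 \<in> {0..pi}" by simp
  have P0: "0 \<le> P" "0 \<le> G" "0 \<le> Y" "0 \<le> E"
    using order_trans[OF norm_ge_zero P[OF 0]] order_trans[OF norm_ge_zero G[OF 0]]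
      order_trans[OF norm_ge_zero Y[OF 0]] order_trans[OF norm_ge_zero E[OF 0]] by auto
  define B where "B = E / cmod w * (P * Y + G)"
  have B0: "0 \<le> B" unfolding B_def using P0 by auto
  have "cmod (y x - y 0 * cos (w * of_real x) - y1 0 * sin (w * of_real x) / w) \<le> B * measure lborel {0..x}"
  proof (rule has_integral_bound_real[OF B0 finite.emptyI variation_of_constants[OF y x w]])
    fix t assume "t \<in> {0..x} - {}"
    hence t: "t \<in> {0..pi}" "x - t \<in> {0..pi}" using x by auto
    have "y2 t + w\<^sup>2 * y t = (p t + w\<^sup>2) * y t + g t" using eq[OF t(1)] by (simp add: algebra_simps)
    also have "cmod \<dots> \<le> P * Y + G"
      using P[OF t(1)] G[OF t(1)] Y[OF t(1)] P0
      by (intro norm_triangle_le add_mono) (auto simp: norm_mult intro!: mult_mono)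
    finally show "cmod (sin (w * of_real (x - t)) / w * (y2 t + w\<^sup>2 * y t)) \<le> B"
      unfolding B_def norm_mult norm_divide using E[OF t(2)] P0
      by (intro mult_mono divide_right_mono) auto
  qed
  also have "\<dots> \<le> B * pi" using x B0 by (intro mult_left_mono) auto
  finally show ?thesis by (simp add: B_def mult_ac)
qed

lemma sup_attained:
  fixes y :: "real \<Rightarrow> complex"
  assumes "continuous_on {0..pi} y"
  obtains x0 where "x0 \<in> {0..pi}" "\<And>x. x \<in> {0..pi} \<Longrightarrow> cmod (y x) \<le> cmod (y x0)"
proof -
  have "continuous_on {0..pi} (\<lambda>x. cmod (y x))" using assms by (intro continuous_intros)
  from continuous_attains_sup[OF _ _ this] that show thesis by auto
qed

text \<open>
  Evaluating the integral equation where \<open>|y|\<close> is maximal makes it self-improving: for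
  \<open>q < 1\<close> the unknown maximum is absorbed into the left-hand side.
\<close>
lemma volterra_self_bound:
  assumes y: "twice_deriv y y1 y2" and w: "w \<noteq> (0::complex)"
    and eq: "\<And>t. t \<in> {0..pi} \<Longrightarrow> y2 t = p t * y t + g t"
    and P: "\<And>t. t \<in> {0..pi} \<Longrightarrow> cmod (p t + w\<^sup>2) \<le> P"
    and G: "\<And>t. t \<in> {0..pi} \<Longrightarrow> cmod (g t) \<le> G"
    and E: "\<And>t. t \<in> {0..pi} \<Longrightarrow> cmod (sin (w * of_real t)) \<le> E"
    and y0: "y 0 = 0" and q: "pi * E / cmod w * P \<le> q" and x: "x \<in> {0..pi}" and q1: "q < 1"
  shows "cmod (y x) \<le> (cmod (y1 0 / w) * E + pi * E / cmod w * G) / (1 - q)"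
proof -
  obtain x0 where x0: "x0 \<in> {0..pi}" "\<And>x. x \<in> {0..pi} \<Longrightarrow> cmod (y x) \<le> cmod (y x0)"
    using sup_attained[OF twice_deriv_continuous(1)[OF y]] by blast
  have "cmod (y x0 - y1 0 / w * sin (w * of_real x0)) \<le> pi * E / cmod w * (P * cmod (y x0) + G)"
    using volterra_bound[OF y x0(1) w eq P G x0(2) E] y0 by simp
  hence "cmod (y x0) \<le> cmod (y1 0 / w * sin (w * of_real x0)) + pi * E / cmod w * (P * cmod (y x0) + G)"
    using norm_triangle_ineq2[of "y x0" "y1 0 / w * sin (w * of_real x0)"] by linarith
  also have "\<dots> \<le> cmod (y1 0 / w) * E + (pi * E / cmod w * P) * cmod (y x0) + pi * E / cmod w * G"
    using mult_left_mono[OF E[OF x0(1)], of "cmod (y1 0 / w)"] by (simp add: norm_mult norm_divide algebra_simps)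
  also have "\<dots> \<le> cmod (y1 0 / w) * E + q * cmod (y x0) + pi * E / cmod w * G"
    using mult_right_mono[OF q, of "cmod (y x0)"] by simp
  finally have "cmod (y x0) * (1 - q) \<le> cmod (y1 0 / w) * E + pi * E / cmod w * G"
    by (simp add: algebra_simps)
  hence "cmod (y x0) \<le> (cmod (y1 0 / w) * E + pi * E / cmod w * G) / (1 - q)"
    using q1 by (simp add: pos_le_divide_eq)
  with x0(2)[OF x] show ?thesis by linarith
qed

text \<open>
  A solution of the initial value problem is a fixed point of a Volterra operator, which contracts
  the supremum norm because of the factor \<open>1 / n\<close> in its kernel.
\<close>
lemma sine_solution_exists:
  fixes v :: "real \<Rightarrow> complex" and n :: nat and del :: complex
  assumes v: "continuous_on {0..pi} v" and V: "\<And>x. x \<in> {0..pi} \<Longrightarrow> cmod (v x) \<le> V"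
    and n: "n > 0" and q: "2 * pi * (V + cmod del) / n \<le> q" "q < 1"
  obtains s s1 where "hill_sol v (of_nat n ^ 2 + del) s s1" "s 0 = 0" "s1 0 = of_nat n"
proof -
  define w :: complex where "w = of_nat n"
  have w0: "w \<noteq> 0" using n by (simp add: w_def)
  define sn where "sn = (\<lambda>x. sin (w * complex_of_real x))"
  define cn where "cn = (\<lambda>x. cos (w * complex_of_real x))"
  have [continuous_intros]: "continuous_on A sn" "continuous_on A cn" for A
    unfolding sn_def cn_def by (intro continuous_intros)+
  have trig: "cmod (sn x) \<le> 1" "cmod (cn x) \<le> 1" for x
  proof -
    have "w * complex_of_real x = complex_of_real (real n * x)" by (simp add: w_def)
    thus "cmod (sn x) \<le> 1" "cmod (cn x) \<le> 1" unfolding sn_def cn_def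
      by (simp_all only: sin_of_real cos_of_real norm_of_real abs_sin_le_one abs_cos_le_one)
  qed
  define C where "C = (\<lambda>(f::real \<Rightarrow> complex) x. integral {0..x} (\<lambda>t. cn t * ((v t - del) * f t)))"
  define S where "S = (\<lambda>(f::real \<Rightarrow> complex) x. integral {0..x} (\<lambda>t. sn t * ((v t - del) * f t)))"
  define T where "T = (\<lambda>(f::real \<Rightarrow> complex) x. sn x + (sn x * C f x - cn x * S f x) / w)"
  have int: "(\<lambda>t. cn t * ((v t - del) * f t)) integrable_on {0..x}"
       "(\<lambda>t. sn t * ((v t - del) * f t)) integrable_on {0..x}"
    if "continuous_on {0..pi} f" "x \<in> {0..pi}" for f :: "real \<Rightarrow> complex" and x
    using that by (auto intro!: integrable_continuous_interval continuous_intros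
        intro: continuous_on_subset[OF v] continuous_on_subset[OF that(1)])
  have cT: "continuous_on {0..pi} (T f)" if "continuous_on {0..pi} f" for f :: "real \<Rightarrow> complex"
    unfolding T_def C_def S_def using int[OF that, of pi] w0
    by (intro continuous_intros indefinite_integral_continuous_1) auto
  have cf: "continuous_on {0..pi} (apply_bcontfun f)" for f :: "real \<Rightarrow>\<^sub>C complex"
    using apply_bcontfun[of f] continuous_on_subset unfolding bcontfun_def by blast
  have "\<exists>g::real \<Rightarrow>\<^sub>C complex. \<forall>x. apply_bcontfun g x = T (apply_bcontfun f) (clamp 0 pi x)" for f :: "real \<Rightarrow>\<^sub>C complex"
    using continuous_on_cbox_bcontfunE[of 0 pi "T (apply_bcontfun f)"] cT[OF cf[of f]] by (metis cbox_interval)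
  then obtain F :: "(real \<Rightarrow>\<^sub>C complex) \<Rightarrow> (real \<Rightarrow>\<^sub>C complex)"
    where F2: "\<And>f x. apply_bcontfun (F f) x = T (apply_bcontfun f) (clamp 0 pi x)" by metis
  have F1: "apply_bcontfun (F f) x = T (apply_bcontfun f) x" if "x \<in> {0..pi}" for f x
    using that by (simp add: F2)
  have contr: "dist (F f) (F g) \<le> q * dist f g" for f g
  proof (rule dist_bound)
    fix x0 :: real
    let ?f = "apply_bcontfun f" and ?g = "apply_bcontfun g"
    define x where "x = clamp 0 pi x0"
    have x: "x \<in> {0..pi}" unfolding x_def using clamp_in_interval[of 0 pi x0] by (auto simp: cbox_interval)
    have d: "cmod (?f t - ?g t) \<le> dist f g" for t using dist_bounded[of f t g] by (simp add: dist_norm)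
    have V0: "0 \<le> V" using order_trans[OF norm_ge_zero V[OF x]] .
    have bnd: "cmod (integral {0..x} (\<lambda>t. h t * ((v t - del) * ?f t)) - integral {0..x} (\<lambda>t. h t * ((v t - del) * ?g t)))
        \<le> ((V + cmod del) * dist f g) * pi"
      if h: "\<And>t. cmod (h t) \<le> 1" and i: "\<And>f::real \<Rightarrow> complex. continuous_on {0..pi} f \<Longrightarrow> (\<lambda>t. h t * ((v t - del) * f t)) integrable_on {0..x}" for h
    proof -
      have "(\<lambda>t. h t * ((v t - del) * ?f t) - h t * ((v t - del) * ?g t)) integrable_on {0..x}"
        by (intro integrable_diff i cf)
      note hi = integrable_integral[OF this]
      have "cmod (integral {0..x} (\<lambda>t. h t * ((v t - del) * ?f t) - h t * ((v t - del) * ?g t))) \<le>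
         (V + cmod del) * dist f g * measure lborel {0..x}"
      proof (rule has_integral_bound_real[OF _ finite.emptyI hi])
        show "0 \<le> (V + cmod del) * dist f g" using V0 by simp
        fix t assume t: "t \<in> {0..x} - {}"
        have "h t * ((v t - del) * ?f t) - h t * ((v t - del) * ?g t) = h t * ((v t - del) * (?f t - ?g t))"
          by (simp add: algebra_simps)
        also have "cmod \<dots> \<le> 1 * ((V + cmod del) * dist f g)"
          unfolding norm_mult using h d V[of t] t x V0 norm_triangle_ineq4[of "v t" del]
          by (intro mult_mono) (auto intro: order_trans)
        finally show "cmod (h t * ((v t - del) * ?f t) - h t * ((v t - del) * ?g t)) \<le> (V + cmod del) * dist f g"
          by simp
      qed
      also have "\<dots> \<le> (V + cmod del) * dist f g * pi" using x V0 by (intro mult_left_mono) auto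
      finally show ?thesis by (simp add: integral_diff i cf)
    qed
    have "T ?f x - T ?g x = (sn x * (C ?f x - C ?g x) - cn x * (S ?f x - S ?g x)) / w"
      unfolding T_def using w0 by (simp add: field_simps)
    also have "cmod \<dots> \<le> (1 * (((V + cmod del) * dist f g) * pi) + 1 * (((V + cmod del) * dist f g) * pi)) / n"
      unfolding norm_divide C_def S_def using n int[OF _ x]
      apply (simp only: w_def norm_of_nat)
      apply (rule divide_right_mono)
       apply (rule order_trans[OF norm_triangle_ineq4])
       apply (unfold norm_mult)
       apply (rule add_mono)
        apply (rule mult_mono[OF trig(1) bnd]; use trig in auto)
       apply (rule mult_mono[OF trig(2) bnd]; use trig in auto)
      apply simp
      done
    also have "\<dots> = (2 * pi * (V + cmod del) / n) * dist f g" by simp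
    also have "\<dots> \<le> q * dist f g" using q by (intro mult_right_mono) auto
    finally show "dist (F f x0) (F g x0) \<le> q * dist f g"
      unfolding F2 x_def[symmetric] by (simp add: dist_norm)
  qed
  have "0 \<le> q" using q(1) order_trans[OF norm_ge_zero V[of 0]] by (auto intro: order_trans[rotated])
  then obtain f0 where f0: "F f0 = f0" using banach_fix_type[of q F] contr q by blast
  define f where "f = apply_bcontfun f0"
  have fT: "f x = T f x" if "x \<in> {0..pi}" for x using F1[OF that, of f0] f0 by (simp add: f_def)
  define f1 where "f1 = (\<lambda>x. w * cn x + cn x * C f x + sn x * S f x)"
  have cf: "continuous_on {0..pi} f" unfolding f_def by (rule cf)
  have dC: "(C f has_vector_derivative cn x * ((v x - del) * f x)) (at x within {0..pi})"
    "(S f has_vector_derivative sn x * ((v x - del) * f x)) (at x within {0..pi})" if "x \<in> {0..pi}" for x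
    unfolding C_def S_def
    by (rule integral_has_vector_derivative; use that v cf in \<open>auto intro!: continuous_intros\<close>)+
  have dsn: "(sn has_vector_derivative w * cn x) (at x within A)"
    "(cn has_vector_derivative - w * sn x) (at x within A)" for x A
    unfolding sn_def cn_def
    by (rule has_vector_derivative_real_field; auto intro!: derivative_eq_intros)+
  have sc: "sn x * sn x + cn x * cn x = 1" for x
    unfolding sn_def cn_def using sin_cos_squared_add[of "w * complex_of_real x"] by (simp add: power2_eq_square)
  have D1: "(T f has_vector_derivative f1 x) (at x within {0..pi})" if x: "x \<in> {0..pi}" for x
  proof -
    have "(T f has_vector_derivative (w * cn x + ((sn x * (cn x * ((v x - del) * f x)) + w * cn x * C f x)
            - (cn x * (sn x * ((v x - del) * f x)) + - w * sn x * S f x)) * inverse w)) (at x within {0..pi})"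
      unfolding T_def divide_inverse
      by (intro has_vector_derivative_add has_vector_derivative_mult_left has_vector_derivative_diff
          has_vector_derivative_mult dC[OF x] dsn)
    moreover have "w * cn x + ((sn x * (cn x * ((v x - del) * f x)) + w * cn x * C f x)
            - (cn x * (sn x * ((v x - del) * f x)) + - w * sn x * S f x)) * inverse w = f1 x"
      unfolding f1_def using w0 by (simp add: field_simps)
    ultimately show ?thesis by simp
  qed
  have D2: "(f1 has_vector_derivative (v x - (w\<^sup>2 + del)) * f x) (at x within {0..pi})" if x: "x \<in> {0..pi}" for x
  proof -
    let ?h = "(v x - del) * f x"
    have "(f1 has_vector_derivative (w * (- w * sn x) + (cn x * (cn x * ?h) + - w * sn x * C f x)
            + (sn x * (sn x * ?h) + w * cn x * S f x))) (at x within {0..pi})"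
      unfolding f1_def
      by (intro has_vector_derivative_add has_vector_derivative_mult_right
          has_vector_derivative_mult dC[OF x] dsn)
    moreover have "w * (- w * sn x) + (cn x * (cn x * ?h) + - w * sn x * C f x)
            + (sn x * (sn x * ?h) + w * cn x * S f x) =
            (sn x * sn x + cn x * cn x) * ?h - w\<^sup>2 * T f x"
      unfolding T_def using w0 by (simp add: field_simps power2_eq_square)
    moreover have "(sn x * sn x + cn x * cn x) * ?h - w\<^sup>2 * T f x = (v x - (w\<^sup>2 + del)) * f x"
      unfolding fT[OF x, symmetric] sc by (simp add: algebra_simps)
    ultimately show ?thesis by simp
  qed
  have "hill_sol v (w\<^sup>2 + del) (T f) f1"
    unfolding hill_sol_def twice_deriv_def using D1 D2 fT by simp
  moreover have "T f 0 = 0" "f1 0 = w" by (simp_all add: T_def f1_def sn_def cn_def C_def S_def)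
  ultimately show thesis using that by (simp add: w_def)
qed

section \<open>The Dirichlet condition near \<open>n\<^sup>2\<close>\<close>

lemma norm_sin_nat_le: "cmod (sin (of_nat n * complex_of_real x)) \<le> 1"
  and norm_cos_nat_le: "cmod (cos (of_nat n * complex_of_real x)) \<le> 1"
proof -
  have "of_nat n * complex_of_real x = complex_of_real (real n * x)" by simp
  thus "cmod (sin (of_nat n * complex_of_real x)) \<le> 1" "cmod (cos (of_nat n * complex_of_real x)) \<le> 1"
    by (simp_all only: sin_of_real cos_of_real norm_of_real abs_sin_le_one abs_cos_le_one)
qed

lemma sin_nat_pi: "sin (of_nat n * complex_of_real pi) = 0"
  and cos_nat_pi: "cos (of_nat n * complex_of_real pi) = (-1) ^ n"
proof -
  have *: "of_nat n * complex_of_real pi = complex_of_real (real n * pi)" by simp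
  show "sin (of_nat n * complex_of_real pi) = 0"
    unfolding * sin_of_real by (simp add: sin_npi)
  show "cos (of_nat n * complex_of_real pi) = (-1) ^ n"
    unfolding * cos_of_real by (simp add: cos_npi)
qed

lemma has_integral_perturb:
  fixes h h0 :: "real \<Rightarrow> complex"
  assumes "(h has_integral I) {0..pi}" "(h0 has_integral I0) {0..pi}"
    "\<And>x. x \<in> {0..pi} \<Longrightarrow> cmod (h x - h0 x) \<le> e"
  shows "cmod (I - I0) \<le> pi * e"
proof -
  have "0 \<le> e" using order_trans[OF norm_ge_zero assms(3)[of 0]] by simp
  from has_integral_bound_real[OF this finite.emptyI has_integral_diff[OF assms(1,2)]] assms(3)
  show ?thesis by (simp add: mult.commute)
qed

lemma integral_norm_bound_pi:
  fixes h :: "real \<Rightarrow> complex"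
  assumes "(h has_integral I) {0..pi}" "\<And>x. x \<in> {0..pi} \<Longrightarrow> cmod (h x) \<le> e"
  shows "cmod I \<le> pi * e"
  using has_integral_perturb[OF assms(1) has_integral_0, of e] assms(2) by simp

lemma sin_sin_integral:
  assumes "n > 0"
  shows "((\<lambda>x. sin (of_nat n * complex_of_real x) * sin (of_nat n * complex_of_real x)) has_integral pi / 2) {0..pi}"
    and "((\<lambda>x. sin (of_nat n * complex_of_real x) * cos (of_nat n * complex_of_real x)) has_integral 0) {0..pi}"
proof -
  define w :: complex where "w = of_nat n"
  have w: "w \<noteq> 0" using assms by (simp add: w_def)
  have p: "sin (w * complex_of_real pi) = 0" unfolding w_def by (rule sin_nat_pi)
  have sc: "cos z * cos z = 1 - sin z * sin z" for z :: complex
    using sin_cos_squared_add[of z] by (simp add: power2_eq_square algebra_simps)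
  have "((\<lambda>x. sin (w * complex_of_real x) * sin (w * complex_of_real x)) has_integral
    ((of_real pi - sin (w * of_real pi) * cos (w * of_real pi) / w) / 2 -
     (of_real 0 - sin (w * of_real 0) * cos (w * of_real 0) / w) / 2)) {0..pi}"
    by (rule fundamental_theorem_of_calculus[OF pi_ge_zero], rule has_vector_derivative_real_field)
      (use w in \<open>auto intro!: derivative_eq_intros simp: field_simps sc\<close>)
  thus "((\<lambda>x. sin (of_nat n * complex_of_real x) * sin (of_nat n * complex_of_real x)) has_integral pi / 2) {0..pi}"
    by (simp add: p flip: w_def)
  have "((\<lambda>x. sin (w * complex_of_real x) * cos (w * complex_of_real x)) has_integral
    (sin (w * of_real pi) * sin (w * of_real pi) / (2 * w) - sin (w * of_real 0) * sin (w * of_real 0) / (2 * w))) {0..pi}"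
    by (rule fundamental_theorem_of_calculus[OF pi_ge_zero], rule has_vector_derivative_real_field)
      (use w in \<open>auto intro!: derivative_eq_intros simp: field_simps\<close>)
  thus "((\<lambda>x. sin (of_nat n * complex_of_real x) * cos (of_nat n * complex_of_real x)) has_integral 0) {0..pi}"
    by (simp add: p flip: w_def)
qed

locale bounded_potential =
  fixes v :: "real \<Rightarrow> complex" and V :: real
  assumes v_cont: "continuous_on {0..pi} v"
    and v_bound: "\<And>x. x \<in> {0..pi} \<Longrightarrow> cmod (v x) \<le> V"
begin

lemma V_nonneg: "0 \<le> V"
  using order_trans[OF norm_ge_zero v_bound[of 0]] by simp

text \<open>
  In this normalization the free solution is \<open>sin (n x)\<close>, and the distance to it is of order
  \<open>1 / n\<close> as long as \<open>del\<close> stays bounded.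
\<close>
lemma sine_solution_bounds:
  fixes n :: nat
  assumes s: "hill_sol v (of_nat n ^ 2 + del) s s1" "s 0 = 0" "s1 0 = of_nat n"
    and n: "n > 0" and k: "pi * (V + cmod del) / n \<le> k" "k \<le> 1 / 2" and x: "x \<in> {0..pi}"
  shows "cmod (s x) \<le> 2" and "cmod (s x - sin (of_nat n * of_real x)) \<le> 2 * k"
proof -
  have eq: "(v t - (of_nat n ^ 2 + del)) * s t = (v t - (of_nat n ^ 2 + del)) * s t + 0" for t by simp
  have P: "cmod (v t - (of_nat n ^ 2 + del) + (of_nat n)\<^sup>2) \<le> V + cmod del" if "t \<in> {0..pi}" for t
    using norm_triangle_ineq4[of "v t" del] v_bound[OF that] by simp
  have w: "(of_nat n :: complex) \<noteq> 0" using n by simp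
  have b: "cmod (s t) \<le> 2" if t: "t \<in> {0..pi}" for t
  proof -
    have "cmod (s t) \<le> (cmod (s1 0 / of_nat n) * 1 + pi * 1 / cmod (of_nat n) * 0) / (1 - k)"
      by (rule volterra_self_bound[OF s(1)[unfolded hill_sol_def] w eq P _ norm_sin_nat_le s(2) _ t])
        (use k in auto)
    also have "\<dots> \<le> 2" using k(2) n s(3) by (simp add: field_simps)
    finally show ?thesis .
  qed
  show "cmod (s x) \<le> 2" by (rule b[OF x])
  have "cmod (s x - s 0 * cos (of_nat n * of_real x) - s1 0 * sin (of_nat n * of_real x) / of_nat n)
     \<le> pi * 1 / cmod (of_nat n) * ((V + cmod del) * 2 + 0)"
    by (rule volterra_bound[OF s(1)[unfolded hill_sol_def] x w eq P _ b norm_sin_nat_le]) auto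
  also have "\<dots> = 2 * (pi * (V + cmod del) / n)" by simp
  also have "\<dots> \<le> 2 * k" using k by simp
  finally show "cmod (s x - sin (of_nat n * of_real x)) \<le> 2 * k" using s n by simp
qed

text \<open>
  Testing against \<open>cos (n x)\<close> isolates the slope at \<open>pi\<close>.
\<close>
lemma sine_solution_endpoint_slope:
  fixes n :: nat
  assumes s: "hill_sol v (of_nat n ^ 2 + del) s s1" "s 0 = 0" "s1 0 = of_nat n"
    and n: "n > 0" and k: "pi * (V + cmod del) / n \<le> 1 / 2"
  shows "cmod (s1 pi * (-1) ^ n - of_nat n) \<le> pi * (2 * (V + cmod del))"
proof -
  note g = has_integral_neg[OF green_identity[OF s(1)[unfolded hill_sol_def] twice_deriv_cos[of "of_nat n"], of pi]]
  have "((\<lambda>x. (v x - del) * s x * cos (of_nat n * of_real x)) has_integral s1 pi * (-1) ^ n - of_nat n) {0..pi}"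
    by (rule has_integral_eq_rhs[OF has_integral_eq[OF _ g]])
      (use s in \<open>simp_all add: algebra_simps sin_nat_pi cos_nat_pi\<close>)
  thus ?thesis
  proof (rule integral_norm_bound_pi)
    fix x assume x: "x \<in> {0..pi}"
    have "cmod ((v x - del) * s x * cos (of_nat n * of_real x)) \<le> (V + cmod del) * 2 * 1"
      unfolding norm_mult
      using norm_triangle_ineq4[of "v x" del] v_bound[OF x] norm_cos_nat_le[of n x]
        sine_solution_bounds(1)[OF s n k order_refl x] V_nonneg
      by (intro mult_mono) auto
    thus "cmod ((v x - del) * s x * cos (of_nat n * of_real x)) \<le> 2 * (V + cmod del)" by simp
  qed
qed

text \<open>
  Testing the equation against \<open>sin (n x)\<close> replaces the boundary condition at \<open>pi\<close> by an equation
  for the spectral parameter.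
\<close>
lemma dirichlet_condition_as_equation:
  fixes n :: nat
  assumes s: "hill_sol v (of_nat n ^ 2 + del) s s1" "s 0 = 0" and n: "n > 0"
  shows "integral {0..pi} (\<lambda>x. v x * s x * sin (of_nat n * of_real x))
     - del * integral {0..pi} (\<lambda>x. s x * sin (of_nat n * of_real x)) = - of_nat n * (-1) ^ n * s pi"
proof -
  note g = has_integral_neg[OF green_identity[OF s(1)[unfolded hill_sol_def] twice_deriv_sin[of "of_nat n"], of pi]]
  have "((\<lambda>x. v x * s x * sin (of_nat n * of_real x) - del * (s x * sin (of_nat n * of_real x)))
     has_integral - of_nat n * (-1) ^ n * s pi) {0..pi}"
    by (rule has_integral_eq_rhs[OF has_integral_eq[OF _ g]])
      (use s in \<open>simp_all add: algebra_simps sin_nat_pi cos_nat_pi\<close>)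
  hence "integral {0..pi} (\<lambda>x. v x * s x * sin (of_nat n * of_real x) - del * (s x * sin (of_nat n * of_real x)))
     = - of_nat n * (-1) ^ n * s pi" by (rule integral_unique)
  moreover have "(\<lambda>x. v x * s x * sin (of_nat n * of_real x)) integrable_on {0..pi}"
    "(\<lambda>x. del * (s x * sin (of_nat n * of_real x))) integrable_on {0..pi}"
    by (intro integrable_continuous_interval continuous_intros v_cont hill_sol_continuous(1)[OF s(1)])+
  ultimately show ?thesis by (simp add: integral_diff)
qed

lemma sine_solution_integrals:
  fixes n :: nat
  assumes s: "hill_sol v (of_nat n ^ 2 + del) s s1" "s 0 = 0" "s1 0 = of_nat n"
    and n: "n > 0" and k: "pi * (V + cmod del) / n \<le> k" "k \<le> 1 / 2"
  shows "cmod (integral {0..pi} (\<lambda>x. s x * sin (of_nat n * of_real x)) - pi / 2) \<le> pi * (2 * k)"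
    and "cmod (integral {0..pi} (\<lambda>x. v x * s x * sin (of_nat n * of_real x))) \<le> pi * (2 * V)"
proof -
  have i: "(\<lambda>x. s x * sin (of_nat n * of_real x)) integrable_on {0..pi}"
    "(\<lambda>x. v x * s x * sin (of_nat n * of_real x)) integrable_on {0..pi}"
    by (intro integrable_continuous_interval continuous_intros v_cont hill_sol_continuous(1)[OF s(1)])+
  show "cmod (integral {0..pi} (\<lambda>x. s x * sin (of_nat n * of_real x)) - pi / 2) \<le> pi * (2 * k)"
  proof (rule has_integral_perturb[OF integrable_integral[OF i(1)] sin_sin_integral(1)[OF n]])
    fix x assume x: "x \<in> {0..pi}"
    have "s x * sin (of_nat n * of_real x) - sin (of_nat n * of_real x) * sin (of_nat n * of_real x)
       = (s x - sin (of_nat n * of_real x)) * sin (of_nat n * of_real x)" by (simp add: algebra_simps)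
    also have "cmod \<dots> \<le> 2 * k * 1" unfolding norm_mult
      using sine_solution_bounds(2)[OF s n k x] norm_sin_nat_le
        order_trans[OF norm_ge_zero sine_solution_bounds(2)[OF s n k x]]
      by (intro mult_mono) auto
    finally show "cmod (s x * sin (of_nat n * of_real x) - sin (of_nat n * of_real x) * sin (of_nat n * of_real x)) \<le> 2 * k"
      by simp
  qed
  show "cmod (integral {0..pi} (\<lambda>x. v x * s x * sin (of_nat n * of_real x))) \<le> pi * (2 * V)"
  proof (rule integral_norm_bound_pi[OF integrable_integral[OF i(2)]])
    fix x assume x: "x \<in> {0..pi}"
    have "cmod (v x * s x * sin (of_nat n * of_real x)) \<le> V * 2 * 1" unfolding norm_mult
      using sine_solution_bounds(1)[OF s n k x] norm_sin_nat_le v_bound[OF x] V_nonneg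
      by (intro mult_mono) auto
    thus "cmod (v x * s x * sin (of_nat n * of_real x)) \<le> 2 * V" by simp
  qed
qed

text \<open>
  The difference of two solutions solves the equation of the first one with an inhomogeneity
  proportional to \<open>del - eps\<close>. This yields the continuity in the spectral parameter that
  Brouwer's theorem needs below.
\<close>
lemma sine_solution_lipschitz:
  fixes n :: nat
  assumes s: "hill_sol v (of_nat n ^ 2 + del) s s1" "s 0 = 0" "s1 0 = of_nat n"
    and u: "hill_sol v (of_nat n ^ 2 + eps) u u1" "u 0 = 0" "u1 0 = of_nat n"
    and n: "n > 0" and k: "pi * (V + cmod del) / n \<le> 1 / 2" "pi * (V + cmod eps) / n \<le> 1 / 2"
    and x: "x \<in> {0..pi}"
  shows "cmod (s x - u x) \<le> 4 * pi * cmod (del - eps)"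
proof -
  define y where "y = (\<lambda>x. s x + (-1) * u x)"
  define y1 where "y1 = (\<lambda>x. s1 x + (-1) * u1 x)"
  have y: "twice_deriv y y1 (\<lambda>x. (v x - (of_nat n ^ 2 + del)) * s x + (-1) * ((v x - (of_nat n ^ 2 + eps)) * u x))"
    unfolding y_def y1_def
    by (intro twice_deriv_add twice_deriv_scale s(1)[unfolded hill_sol_def] u(1)[unfolded hill_sol_def])
  have w: "(of_nat n :: complex) \<noteq> 0" using n by simp
  have P: "cmod (v t - (of_nat n ^ 2 + del) + (of_nat n)\<^sup>2) \<le> V + cmod del" if "t \<in> {0..pi}" for t
    using norm_triangle_ineq4[of "v t" del] v_bound[OF that] by simp
  have G: "cmod ((eps - del) * u t) \<le> cmod (del - eps) * 2" if "t \<in> {0..pi}" for t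
    unfolding norm_mult using sine_solution_bounds(1)[OF u n k(2) order_refl that]
    by (intro mult_mono) (auto simp: norm_minus_commute)
  have "cmod (y x) \<le> (cmod (y1 0 / of_nat n) * 1 + pi * 1 / cmod (of_nat n) * (cmod (del - eps) * 2)) / (1 - 1/2)"
    by (rule volterra_self_bound[OF y w _ P G norm_sin_nat_le _ _ x])
      (use k(1) s u in \<open>auto simp: y_def algebra_simps\<close>)
  also have "\<dots> = 4 * pi * cmod (del - eps) / n" using s u by (simp add: y1_def)
  also have "\<dots> \<le> 4 * pi * cmod (del - eps) / 1" using n by (intro divide_left_mono) auto
  finally show ?thesis by (simp add: y_def)
qed

text \<open>
  By \<open>dirichlet_condition_as_equation\<close> the Dirichlet condition says that \<open>del\<close> is a fixed point of a quotient of two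
  integrals, which are a bounded number and a number close to \<open>pi / 2\<close>. The quotient maps a disc of fixed
  radius into itself, and Brouwer's theorem applies.
\<close>
lemma dirichlet_solution_exists:
  fixes n :: nat and R :: real
  assumes n: "n > 0" and R: "6 * V \<le> R" "0 \<le> R" and k: "pi * (V + R) / n \<le> 1 / 16"
  obtains del s s1 where "cmod del \<le> R" "hill_sol v (of_nat n ^ 2 + del) s s1" "s 0 = 0" "s1 0 = of_nat n" "s pi = 0"
proof -
  have kd: "pi * (V + cmod del) / n \<le> 1 / 16" if "cmod del \<le> R" for del :: complex
    by (rule order_trans[OF divide_right_mono[OF mult_left_mono] k]) (use that in auto)
  have "\<exists>s s1. hill_sol v (of_nat n ^ 2 + del) s s1 \<and> s 0 = 0 \<and> s1 0 = of_nat n" if "cmod del \<le> R" for del :: complex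
  proof (rule sine_solution_exists[OF v_cont v_bound n])
    have "2 * pi * (V + cmod del) / n = 2 * (pi * (V + cmod del) / n)" by simp
    thus "2 * pi * (V + cmod del) / n \<le> 1/2" using kd[OF that] by linarith
  qed auto
  then obtain s s1 where s: "\<And>del. cmod del \<le> R \<Longrightarrow> hill_sol v (of_nat n ^ 2 + del) (s del) (s1 del)"
     "\<And>del. cmod del \<le> R \<Longrightarrow> s del 0 = 0" "\<And>del. cmod del \<le> R \<Longrightarrow> s1 del 0 = of_nat n" by metis
  define I where "I = (\<lambda>del. integral {0..pi} (\<lambda>x. s del x * sin (of_nat n * complex_of_real x)))"
  define J where "J = (\<lambda>del. integral {0..pi} (\<lambda>x. v x * s del x * sin (of_nat n * complex_of_real x)))"
  have k2: "pi * (V + cmod del) / n \<le> 1/2" if "cmod del \<le> R" for del :: complex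
    by (rule order_trans[OF kd[OF that]]) simp
  have I: "3 * pi / 8 \<le> cmod (I del)" and J: "cmod (J del) \<le> pi * (2 * V)" if d: "cmod del \<le> R" for del
  proof -
    have "cmod (I del - pi / 2) \<le> pi * (2 * (1/16))" unfolding I_def
      by (rule sine_solution_integrals(1)[OF s[OF d] n kd[OF d]]) simp
    moreover have "cmod (complex_of_real (pi / 2)) \<le> cmod (I del) + cmod (I del - of_real (pi / 2))"
      by (metis add.commute norm_minus_commute norm_triangle_sub)
    ultimately show "3 * pi / 8 \<le> cmod (I del)" by simp
    show "cmod (J del) \<le> pi * (2 * V)" unfolding J_def
      by (rule sine_solution_integrals(2)[OF s[OF d] n kd[OF d]]) simp
  qed
  have i: "(\<lambda>x. s del x * sin (of_nat n * of_real x)) integrable_on {0..pi}"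
    "(\<lambda>x. v x * s del x * sin (of_nat n * of_real x)) integrable_on {0..pi}" if "cmod del \<le> R" for del
    by (intro integrable_continuous_interval continuous_intros v_cont hill_sol_continuous(1)[OF s(1)[OF that]])+
  have lipI: "dist (I d) (I e) \<le> (pi * (4 * pi)) * dist d e"
    and lipJ: "dist (J d) (J e) \<le> (pi * (V * (4 * pi))) * dist d e"
    if d: "d \<in> cball 0 R" and e: "e \<in> cball 0 R" for d e
  proof -
    have d: "cmod d \<le> R" and e: "cmod e \<le> R" using that by auto
    note L = sine_solution_lipschitz[OF s[OF d] s[OF e] n k2[OF d] k2[OF e]]
    have *: "cmod (s d x * sin (of_nat n * of_real x) - s e x * sin (of_nat n * of_real x)) \<le> 4 * pi * cmod (d - e)"
      if x: "x \<in> {0..pi}" for x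
    proof -
      have "cmod ((s d x - s e x) * sin (of_nat n * of_real x)) \<le> 4 * pi * cmod (d - e) * 1"
        unfolding norm_mult using L[OF x] norm_sin_nat_le by (intro mult_mono) auto
      thus ?thesis by (simp add: algebra_simps)
    qed
    have "cmod (I d - I e) \<le> pi * (4 * pi * cmod (d - e))"
      unfolding I_def
      by (rule has_integral_perturb[OF integrable_integral[OF i(1)[OF d]] integrable_integral[OF i(1)[OF e]] *])
    thus "dist (I d) (I e) \<le> (pi * (4 * pi)) * dist d e" by (simp add: dist_norm)
    have "cmod (J d - J e) \<le> pi * (V * (4 * pi * cmod (d - e)))"
      unfolding J_def
    proof (rule has_integral_perturb[OF integrable_integral[OF i(2)[OF d]] integrable_integral[OF i(2)[OF e]]])
      fix x assume x: "x \<in> {0..pi}"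
      have "v x * s d x * sin (of_nat n * of_real x) - v x * s e x * sin (of_nat n * of_real x)
        = v x * (s d x * sin (of_nat n * of_real x) - s e x * sin (of_nat n * of_real x))" by (simp add: algebra_simps)
      also have "cmod \<dots> \<le> V * (4 * pi * cmod (d - e))"
        unfolding norm_mult using *[OF x] v_bound[OF x] V_nonneg by (intro mult_mono) auto
      finally show "cmod (v x * s d x * sin (of_nat n * of_real x) - v x * s e x * sin (of_nat n * of_real x))
         \<le> V * (4 * pi * cmod (d - e))" .
    qed
    thus "dist (J d) (J e) \<le> (pi * (V * (4 * pi))) * dist d e" by (simp add: dist_norm)
  qed
  have "continuous_on (cball 0 R) I" "continuous_on (cball 0 R) J"
    by (rule lipschitz_on_continuous_on, rule lipschitz_onI[OF lipI], simp, simp, simp,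
        rule lipschitz_on_continuous_on, rule lipschitz_onI[OF lipJ], use V_nonneg in auto)
  moreover have I0: "I d \<noteq> 0" if "cmod d \<le> R" for d using I[OF that] pi_gt_zero by (intro notI) (simp del: pi_gt_zero)
  ultimately have "continuous_on (cball 0 R) (\<lambda>d. J d / I d)"
    by (intro continuous_on_divide) auto
  moreover have "J d / I d \<in> cball 0 R" if "d \<in> cball 0 R" for d
  proof -
    have d: "cmod d \<le> R" using that by simp
    have "cmod (J d / I d) \<le> (pi * (2 * V)) / (3 * pi / 8)"
      unfolding norm_divide using I[OF d] J[OF d] pi_gt_zero V_nonneg by (intro frac_le) auto
    also have "\<dots> \<le> R" using R V_nonneg by simp
    finally show ?thesis by simp
  qed
  ultimately obtain d where d: "d \<in> cball 0 R" "J d / I d = d"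
    using brouwer[of "cball 0 R" "\<lambda>d. J d / I d"] R by (auto simp: Pi_iff)
  hence dR: "cmod d \<le> R" by simp
  have "J d - d * I d = - of_nat n * (-1) ^ n * s d pi"
    unfolding I_def J_def by (rule dirichlet_condition_as_equation[OF s(1,2)[OF dR] n])
  moreover have "J d - d * I d = 0" using d(2) I0[OF dR] by (simp add: field_simps)
  ultimately have "s d pi = 0" using n by simp
  with that[OF dR s[OF dR]] show thesis .
qed

lemma zero_initial_values_imp_zero:
  fixes n :: nat
  assumes y: "hill_sol v l y y1" "y 0 = 0" "y1 0 = 0" and n: "n > 0"
    and k: "pi * (V + cmod (l - of_nat n ^ 2)) / n < 1" and x: "x \<in> {0..pi}"
  shows "y x = 0"
proof -
  have P: "cmod (v t - l + (of_nat n)\<^sup>2) \<le> V + cmod (l - of_nat n ^ 2)" if "t \<in> {0..pi}" for t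
    using norm_triangle_ineq4[of "v t" "l - of_nat n ^ 2"] v_bound[OF that] by (simp add: algebra_simps)
  have "cmod (y x) \<le> (cmod (y1 0 / of_nat n) * 1 + pi * 1 / cmod (of_nat n) * 0)
      / (1 - pi * (V + cmod (l - of_nat n ^ 2)) / n)"
    by (rule volterra_self_bound[OF y(1)[unfolded hill_sol_def] _ _ P _ norm_sin_nat_le _ _ x, where g = "\<lambda>_. 0"])
      (use y n k in auto)
  thus ?thesis using y by simp
qed

end

lemma norm_sin_le_exp: "cmod (sin z) \<le> exp \<bar>Im z\<bar>"
proof -
  have "cmod (sin z) = cmod (exp (\<i> * z) - exp (- (\<i> * z))) / 2"
    unfolding sin_exp_eq by (simp add: norm_divide norm_mult)
  also have "\<dots> \<le> (exp (- Im z) + exp (Im z)) / 2"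
    using norm_triangle_ineq4[of "exp (\<i> * z)" "exp (- (\<i> * z))"] by simp
  also have "\<dots> \<le> exp \<bar>Im z\<bar>"
  proof -
    have "exp (- Im z) \<le> exp \<bar>Im z\<bar>" "exp (Im z) \<le> exp \<bar>Im z\<bar>" by simp_all
    moreover have "(r + s) / 2 \<le> m" if "r \<le> m" "s \<le> m" for r s m :: real using that by simp
    ultimately show ?thesis by blast
  qed
  finally show ?thesis .
qed

lemma norm_sin_ge_half:
  assumes "cmod z \<le> 1"
  shows "cmod z / 2 \<le> cmod (sin z)"
proof -
  have "cmod (sin z - (z - z ^ 3 / 6)) \<le> exp \<bar>Im z\<bar> * cmod z ^ 5 / 24"
  proof -
    have "(\<Sum>k\<le>4. complex_of_real (sin_coeff k) * z ^ k) = z - z ^ 3 / 6"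
      by (simp add: sin_coeff_def atMost_nat_numeral fact_numeral)
    with Taylor_sin[of z 4] show ?thesis by (simp add: fact_numeral)
  qed
  also have "\<dots> \<le> 3 * cmod z / 24"
  proof -
    have "exp \<bar>Im z\<bar> \<le> exp 1" using abs_Im_le_cmod[of z] assms by simp
    hence "exp \<bar>Im z\<bar> \<le> 3" using exp_le by linarith
    moreover have "cmod z ^ 5 \<le> cmod z" using power_decreasing[of 1 5 "cmod z"] assms by simp
    ultimately show ?thesis by (intro divide_right_mono mult_mono) auto
  qed
  finally have "cmod (sin z - (z - z ^ 3 / 6)) \<le> cmod z / 8" by simp
  moreover have "cmod (z ^ 3 / 6) \<le> cmod z / 6"
    using power_decreasing[of 1 3 "cmod z"] assms by (simp add: norm_divide norm_power)
  moreover have "cmod z \<le> cmod (sin z) + cmod (sin z - (z - z ^ 3 / 6)) + cmod (z ^ 3 / 6)"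
    using norm_triangle_ineq4[of "sin z" "sin z - (z - z ^ 3 / 6)"]
      norm_triangle_ineq[of "sin z - (sin z - (z - z ^ 3 / 6))" "z ^ 3 / 6"] by simp
  ultimately show ?thesis using norm_ge_zero[of z] by linarith
qed

context bounded_potential begin

text \<open>
  A Dirichlet eigenvalue within distance \<open>n / 4\<close> of \<open>n\<^sup>2\<close> is within a fixed distance of \<open>n\<^sup>2\<close>: for
  \<open>l = w\<^sup>2\<close> the solution is \<open>sin (w x)\<close> up to \<open>O(1 / n)\<close>, so \<open>sin (w pi) = O(1 / n)\<close> and hence
  \<open>w - n = O(1 / n)\<close>.
\<close>
lemma dirichlet_localization:
  fixes n :: nat
  assumes y: "hill_sol v l y y1" "y 0 = 0" "y pi = 0" "y1 0 \<noteq> 0"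
    and n: "n \<ge> 1" "36 * pi * V \<le> n" and l: "cmod (l - of_nat n ^ 2) \<le> real n / 4"
  shows "cmod (l - of_nat n ^ 2) \<le> 216 * V"
proof -
  define w where "w = csqrt l"
  have w2: "w\<^sup>2 = l" by (simp add: w_def)
  have prod: "(w - of_nat n) * (w + of_nat n) = l - of_nat n ^ 2"
    by (simp add: algebra_simps power2_eq_square flip: w2)
  have wn: "real n \<le> cmod (w + of_nat n)"
  proof -
    have "real n \<le> Re (w + of_nat n)" using csqrt_principal[of l] by (auto simp: w_def)
    thus ?thesis using complex_Re_le_cmod[of "w + of_nat n"] by linarith
  qed
  have dw: "cmod (w - of_nat n) \<le> 1 / 4"
  proof -
    have "cmod (w - of_nat n) * real n \<le> cmod (w - of_nat n) * cmod (w + of_nat n)"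
      using wn by (intro mult_left_mono) auto
    also have "\<dots> \<le> real n / 4" using l by (simp flip: norm_mult add: prod)
    finally show ?thesis using n by (simp add: field_simps)
  qed
  have wlow: "real n / 2 \<le> cmod w" and wup: "cmod (w + of_nat n) \<le> 3 * n"
  proof -
    have "real n \<le> cmod w + 1/4"
      using norm_triangle_sub[of "of_nat n" w] dw by (simp add: norm_minus_commute)
    thus "real n / 2 \<le> cmod w" using n by simp
    have "cmod (w + of_nat n) \<le> cmod (w - of_nat n) + cmod (2 * of_nat n)"
      using norm_triangle_ineq[of "w - of_nat n" "2 * of_nat n"] by (simp add: algebra_simps)
    thus "cmod (w + of_nat n) \<le> 3 * n" using dw n by simp
  qed
  hence w0: "w \<noteq> 0" using n by auto
  have E: "cmod (sin (w * of_real t)) \<le> 3" if t: "t \<in> {0..pi}" for t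
  proof -
    have "\<bar>Im w\<bar> \<le> 1/4" using abs_Im_le_cmod[of "w - of_nat n"] dw by simp
    hence "\<bar>Im w\<bar> * \<bar>t\<bar> \<le> 1/4 * pi" using t by (intro mult_mono) auto
    hence "\<bar>Im (w * of_real t)\<bar> \<le> 1/4 * pi" by (simp add: abs_mult)
    hence "\<bar>Im (w * of_real t)\<bar> \<le> 1" using pi_less_4 by simp
    hence "exp \<bar>Im (w * of_real t)\<bar> \<le> exp 1" by simp
    moreover have "cmod (sin (w * of_real t)) \<le> exp \<bar>Im (w * of_real t)\<bar>" by (rule norm_sin_le_exp)
    ultimately show ?thesis using exp_le by linarith
  qed
  define u where "u = (\<lambda>x. w / y1 0 * y x)"
  define u1 where "u1 = (\<lambda>x. w / y1 0 * y1 x)"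
  have u: "hill_sol v l u u1" unfolding u_def u1_def by (rule hill_sol_scale[OF y(1)])
  have u0: "u 0 = 0" "u pi = 0" "u1 0 = w" using y by (auto simp: u_def u1_def)
  have P: "cmod (v t - l + w\<^sup>2) \<le> V" if "t \<in> {0..pi}" for t using v_bound[OF that] by (simp add: w2)
  have k: "pi * 3 / cmod w * V \<le> 6 * pi * V / n"
  proof -
    have "pi * 3 / cmod w \<le> pi * 3 / (real n / 2)"
      using wlow w0 n by (intro divide_left_mono) auto
    from mult_right_mono[OF this V_nonneg] show ?thesis by simp
  qed
  have k2: "6 * pi * V / n \<le> 1/2" using n by (simp add: field_simps)
  have bu: "cmod (u t) \<le> 6" if t: "t \<in> {0..pi}" for t
  proof -
    have "cmod (u t) \<le> (cmod (u1 0 / w) * 3 + pi * 3 / cmod w * 0) / (1 - 1/2)"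
      by (rule volterra_self_bound[OF u[unfolded hill_sol_def] w0 _ P _ E _ _ t, where g = "\<lambda>_. 0"])
        (use u0 k k2 in auto)
    thus ?thesis using u0 w0 by simp
  qed
  have "cmod (u pi - u 0 * cos (w * of_real pi) - u1 0 * sin (w * of_real pi) / w)
     \<le> pi * 3 / cmod w * (V * 6 + 0)"
    by (rule volterra_bound[OF u[unfolded hill_sol_def] _ w0 _ P _ bu E, where g = "\<lambda>_. 0"]) auto
  also have "\<dots> \<le> 6 * (6 * pi * V / n)" using k by simp
  finally have s1: "cmod (sin (w * of_real pi)) \<le> 36 * pi * V / n" using u0 w0 by simp
  have "sin ((w - of_nat n) * of_real pi) = sin (w * of_real pi) * (-1) ^ n"
    using sin_nat_pi[of n] cos_nat_pi[of n] by (simp add: left_diff_distrib sin_diff)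
  hence s2: "cmod (sin ((w - of_nat n) * of_real pi)) \<le> 36 * pi * V / n"
    using s1 by (simp add: norm_mult norm_power)
  have "cmod ((w - of_nat n) * of_real pi) \<le> 1/4 * pi"
    using dw by (simp add: norm_mult)
  hence "cmod ((w - of_nat n) * of_real pi) \<le> 1" using pi_less_4 by simp
  from norm_sin_ge_half[OF this] s2 have "cmod (w - of_nat n) * pi / 2 \<le> 36 * pi * V / n"
    by (simp add: norm_mult)
  hence "cmod (w - of_nat n) \<le> 72 * V / n" using n by (simp add: field_simps)
  hence "cmod (w - of_nat n) * cmod (w + of_nat n) \<le> 72 * V / n * (3 * n)"
    using wup V_nonneg by (intro mult_mono) auto
  thus ?thesis using n by (simp flip: norm_mult add: prod)
qed

text \<open>
  Eigenfunctions for different eigenvalues are orthogonal for the bilinear pairing, and so is an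
  eigenfunction to itself if it has a generalized eigenfunction. For small \<open>k\<close> both are
  impossible, since the integral is close to that of \<open>sin\<^sup>2 (n x)\<close>.
\<close>
lemma dirichlet_products_nonzero:
  fixes n :: nat
  assumes s: "hill_sol v (of_nat n ^ 2 + del) s s1" "s 0 = 0" "s1 0 = of_nat n"
    and u: "hill_sol v (of_nat n ^ 2 + eps) u u1" "u 0 = 0" "u1 0 = of_nat n"
    and n: "n > 0" and k: "pi * (V + cmod del) / n \<le> k" "pi * (V + cmod eps) / n \<le> k" "k \<le> 1 / 2"
  shows "cmod (integral {0..pi} (\<lambda>x. s x * u x) - pi / 2) \<le> pi * (6 * k)"
proof (rule has_integral_perturb[OF integrable_integral sin_sin_integral(1)[OF n]])
  show "(\<lambda>x. s x * u x) integrable_on {0..pi}"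
    by (intro integrable_continuous_interval continuous_intros hill_sol_continuous(1)[OF s(1)] hill_sol_continuous(1)[OF u(1)])
  fix x assume x: "x \<in> {0..pi}"
  let ?n = "sin (of_nat n * complex_of_real x)"
  note S = sine_solution_bounds[OF s n k(1,3) x] and U = sine_solution_bounds[OF u n k(2,3) x]
  have k0: "0 \<le> k" using order_trans[OF norm_ge_zero S(2)] by simp
  have "s x * u x - ?n * ?n = (s x - ?n) * u x + ?n * (u x - ?n)" by (simp add: algebra_simps)
  also have "cmod \<dots> \<le> cmod (s x - ?n) * cmod (u x) + cmod ?n * cmod (u x - ?n)"
    by (simp add: norm_triangle_le norm_mult)
  also have "\<dots> \<le> 2 * k * 2 + 1 * (2 * k)"
    by (intro add_mono mult_mono) (use S U norm_sin_nat_le[of n x] k0 in auto)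
  finally show "cmod (s x * u x - ?n * ?n) \<le> 6 * k" by simp
qed

end

section \<open>Sums over the integers\<close>

lemma has_sum_minus:
  fixes f g :: "'a \<Rightarrow> complex"
  assumes "(f has_sum a) S" "(g has_sum b) S"
  shows "((\<lambda>x. f x - g x) has_sum (a - b)) S"
  using has_sum_add[OF assms(1) has_sum_cmult_right[OF assms(2), of "-1"]] by simp

lemma geometric_has_sum_nat:
  fixes x :: real
  assumes "0 \<le> x" "x < 1"
  shows "((\<lambda>j::nat. x ^ j) has_sum 1 / (1 - x)) UNIV"
  using geometric_sums[of x] assms by (intro sums_nonneg_imp_has_sum) auto

lemma geometric_has_sum_int:
  fixes x :: real
  assumes x: "0 \<le> x" "x < 1"
  shows "((\<lambda>i::int. if i = a then 0 else x ^ nat \<bar>i - a\<bar>) has_sum 2 * x / (1 - x)) UNIV"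
proof -
  let ?f = "\<lambda>i::int. if i = a then 0 else x ^ nat \<bar>i - a\<bar>"
  have s: "((\<lambda>j::nat. x * x ^ j) has_sum x * (1 / (1 - x))) UNIV"
    by (intro has_sum_cmult_right geometric_has_sum_nat x)
  have "(?f has_sum x * (1 / (1 - x))) {a<..}"
    by (rule iffD1[OF has_sum_reindex_bij_betw[of "\<lambda>j::nat. a + 1 + int j" UNIV] has_sum_cong[THEN iffD1, OF _ s]])
      (auto intro!: bij_betwI[of _ _ _ "\<lambda>i. nat (i - a - 1)"] simp: nat_add_distrib power_add[symmetric] simp flip: power_Suc)
  moreover have "(?f has_sum x * (1 / (1 - x))) {..<a}"
    by (rule iffD1[OF has_sum_reindex_bij_betw[of "\<lambda>j::nat. a - 1 - int j" UNIV] has_sum_cong[THEN iffD1, OF _ s]])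
      (auto intro!: bij_betwI[of _ _ _ "\<lambda>i. nat (a - 1 - i)"] simp: nat_add_distrib power_add[symmetric] simp flip: power_Suc)
  ultimately have "(?f has_sum x * (1 / (1 - x)) + x * (1 / (1 - x))) ({a<..} \<union> {..<a})"
    by (rule has_sum_Un_disjoint) auto
  hence "(?f has_sum x * (1 / (1 - x)) + x * (1 / (1 - x))) UNIV"
    by (rule has_sum_cong_neutral[THEN iffD1, rotated -1]) auto
  thus ?thesis by (simp add: algebra_simps)
qed

text \<open>
  The index \<open>i\<close> stands for the frequency \<open>2 i - n\<close>, so that \<open>0\<close> and \<open>n\<close> are the resonant indices and both
  parities of \<open>n\<close> are treated alike.
\<close>
definition res_dist :: "nat \<Rightarrow> int \<Rightarrow> nat" where
  "res_dist n i = nat (min \<bar>i\<bar> \<bar>i - int n\<bar>)"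

lemma res_dist_0 [simp]: "res_dist n 0 = 0" and res_dist_n [simp]: "res_dist n (int n) = 0"
  by (auto simp: res_dist_def)

lemma power_res_dist_le:
  assumes "0 \<le> (x::real)"
  shows "x ^ res_dist n i \<le> x ^ nat \<bar>i\<bar> + x ^ nat \<bar>i - int n\<bar>"
  using assms by (cases "\<bar>i\<bar> \<le> \<bar>i - int n\<bar>") (auto simp: res_dist_def min_def)

text \<open>
  The tool for all series below: only the two resonant terms are not small.
\<close>
lemma res_dist_sum_bound:
  fixes f :: "int \<Rightarrow> complex"
  assumes n: "n \<ge> 1" and x: "0 \<le> x" "x < 1" and C: "0 \<le> C"
    and f: "\<And>i. i \<noteq> 0 \<Longrightarrow> i \<noteq> int n \<Longrightarrow> cmod (f i) \<le> C * x ^ res_dist n i"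
  shows "(\<lambda>i. norm (f i)) summable_on UNIV"
    and "cmod (infsum f UNIV - (f 0 + f (int n))) \<le> C * (4 * x / (1 - x))"
proof -
  define g where "g = (\<lambda>i::int. C * ((if i = 0 then 0 else x ^ nat \<bar>i - 0\<bar>) + (if i = int n then 0 else x ^ nat \<bar>i - int n\<bar>)))"
  have g: "(g has_sum C * (2 * x / (1 - x) + 2 * x / (1 - x))) UNIV"
    unfolding g_def by (intro has_sum_cmult_right has_sum_add geometric_has_sum_int x)
  define h where "h = (\<lambda>i. if i = 0 \<or> i = int n then 0 else f i)"
  have hg: "cmod (h i) \<le> g i" for i
  proof (cases "i = 0 \<or> i = int n")
    case True
    thus ?thesis using x C by (auto simp: h_def g_def)
  next
    case False
    have "cmod (f i) \<le> C * x ^ res_dist n i" using f False by auto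
    also have "\<dots> \<le> C * (x ^ nat \<bar>i\<bar> + x ^ nat \<bar>i - int n\<bar>)"
      by (intro mult_left_mono power_res_dist_le x C)
    finally show ?thesis using False by (simp add: h_def g_def)
  qed
  have g0: "0 \<le> g i" for i using hg[of i] norm_ge_zero order_trans by blast
  have "(\<lambda>i. norm (h i)) summable_on UNIV"
  proof (rule Infinite_Sum.abs_summable_on_comparison_test[where g = g])
    show "(\<lambda>i. norm (g i)) summable_on UNIV" using g g0 by (auto simp: summable_on_def)
    show "norm (h i) \<le> norm (g i)" for i using hg[of i] g0[of i] by simp
  qed
  define e where "e = (\<lambda>i. f i - h i)"
  have e0: "e i = 0" if "i \<notin> {0, int n}" for i using that by (auto simp: e_def h_def)
  have e: "(e has_sum (f 0 + f (int n))) UNIV"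
  proof (rule has_sum_cong_neutral[THEN iffD1, rotated -1])
    show "(e has_sum (f 0 + f (int n))) {0, int n}"
      using n by (intro has_sum_finiteI) (auto simp: e_def h_def)
  qed (use e0 in auto)
  have "(\<lambda>i. norm (e i)) summable_on UNIV"
    by (rule summable_on_cong_neutral[THEN iffD1, OF _ _ _ summable_on_finite[of "{0, int n}" "\<lambda>i. norm (e i)"]])
      (use e0 in auto)
  hence he: "(\<lambda>i. norm (h i) + norm (e i)) summable_on UNIV"
    using \<open>(\<lambda>i. norm (h i)) summable_on UNIV\<close> by (intro summable_on_add)
  have "(\<lambda>i. norm (h i + e i)) summable_on UNIV"
    by (rule Infinite_Sum.abs_summable_on_comparison_test[where g = "\<lambda>i. norm (h i) + norm (e i)"])
      (use he in \<open>simp_all add: norm_triangle_ineq\<close>)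
  thus fs: "(\<lambda>i. norm (f i)) summable_on UNIV" by (simp add: e_def)
  have "(h has_sum (infsum f UNIV - (f 0 + f (int n)))) UNIV"
    using has_sum_minus[OF has_sum_infsum[OF abs_summable_summable[OF fs]] e] by (simp add: e_def)
  from norm_infsum_le[OF this g] hg
  show "cmod (infsum f UNIV - (f 0 + f (int n))) \<le> C * (4 * x / (1 - x))" by simp
qed

section \<open>The three-term recurrence\<close>

text \<open>
  For \<open>\<lambda> = n\<^sup>2 + del\<close> this is \<open>\<lambda> - k\<^sup>2\<close> with \<open>k = 2 i - n\<close>.
\<close>
definition diag_coeff :: "nat \<Rightarrow> complex \<Rightarrow> int \<Rightarrow> complex" where
  "diag_coeff n del i = del + 4 * of_int (i * (int n - i))"

definition mathieu_seq :: "complex \<Rightarrow> nat \<Rightarrow> complex \<Rightarrow> (int \<Rightarrow> complex) \<Rightarrow> bool" where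
  "mathieu_seq c n del m \<longleftrightarrow> (\<forall>i. diag_coeff n del i * m i = c * (m (i - 1) + m (i + 1)))"

lemma interior_index_bound:
  assumes "i \<noteq> 0" "i \<noteq> int n"
  shows "int n - 1 \<le> \<bar>i * (int n - i)\<bar>"
proof -
  consider "i < 0" | "0 < i" "i < int n" | "int n < i" using assms by linarith
  thus ?thesis
  proof cases
    case 1
    have "0 \<le> (- i - 1) * (int n - i)" using 1 by (intro mult_nonneg_nonneg) auto
    hence "int n - i \<le> - (i * (int n - i))" by (simp add: algebra_simps)
    thus ?thesis using 1 by linarith
  next
    case 2
    have "0 \<le> (i - 1) * (int n - 1 - i)" using 2 by (intro mult_nonneg_nonneg) auto
    thus ?thesis by (simp add: algebra_simps)
  next
    case 3
    have "0 \<le> i * (i - int n - 1)" using 3 by (intro mult_nonneg_nonneg) auto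
    hence "i \<le> - (i * (int n - i))" by (simp add: algebra_simps)
    thus ?thesis using 3 by linarith
  qed
qed

lemma norm_diag_coeff_ge:
  assumes "n \<ge> 2" "cmod del \<le> real n / 4" "i \<noteq> 0" "i \<noteq> int n"
  shows "real n \<le> cmod (diag_coeff n del i)"
proof -
  have "real n - 1 \<le> real_of_int \<bar>i * (int n - i)\<bar>"
    using interior_index_bound[OF assms(3,4)] by linarith
  hence "4 * (real n - 1) \<le> cmod (4 * of_int (i * (int n - i)))"
    unfolding norm_mult norm_of_int by simp
  also have "\<dots> \<le> cmod (diag_coeff n del i) + cmod del"
    unfolding diag_coeff_def using norm_triangle_ineq2[of "4 * of_int (i * (int n - i))" "- del"]
    by (simp add: add.commute)
  finally show ?thesis using assms(1,2) by simp
qed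

text \<open>
  Away from the two resonant indices the recurrence is a contraction, so a bounded solution decays
  geometrically with the distance to them.
\<close>
lemma bounded_solution_decay:
  fixes m :: "int \<Rightarrow> complex"
  assumes contr: "\<And>i. i \<noteq> 0 \<Longrightarrow> i \<noteq> int n \<Longrightarrow> cmod (m i) \<le> q / 2 * (cmod (m (i - 1)) + cmod (m (i + 1)))"
    and q: "0 \<le> q" "q < 1" and B: "\<And>i. cmod (m i) \<le> B"
    and M: "cmod (m 0) \<le> M" "cmod (m (int n)) \<le> M"
  shows "cmod (m i) \<le> M * q ^ res_dist n i"
proof -
  have B0: "0 \<le> B" "0 \<le> M" using order_trans[OF norm_ge_zero] B M by blast+
  have step: "cmod (m i) \<le> K" if "i \<noteq> 0" "i \<noteq> int n" "cmod (m (i - 1)) \<le> L" "cmod (m (i + 1)) \<le> L" "q * L \<le> K"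
    for i K L
  proof -
    have "cmod (m i) \<le> q / 2 * (L + L)"
      using contr[OF that(1,2)] mult_left_mono[OF add_mono[OF that(3,4)], of "q/2"] q by linarith
    thus ?thesis using that(5) by simp
  qed
  have sup: "cmod (m i) \<le> max M (B * q ^ k)" for i k
  proof (induction k arbitrary: i)
    case 0
    thus ?case using B by (simp add: le_max_iff_disj)
  next
    case (Suc k)
    show ?case
    proof (cases "i = 0 \<or> i = int n")
      case True
      thus ?thesis using M by (auto simp: le_max_iff_disj)
    next
      case False
      have "q * max M (B * q ^ k) \<le> max M (B * q ^ Suc k)"
      proof (cases "M \<le> B * q ^ k")
        case False
        have "q * M \<le> 1 * M" using q B0 by (intro mult_right_mono) auto
        thus ?thesis using False by (simp add: max_def)
      qed (simp add: max_def mult_ac)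
      thus ?thesis using step Suc False by blast
    qed
  qed
  have M': "cmod (m i) \<le> M" for i
  proof (rule LIMSEQ_le_const)
    have "(\<lambda>k. B * q ^ k) \<longlonglongrightarrow> B * 0"
      using q by (intro tendsto_mult tendsto_const LIMSEQ_power_zero) auto
    hence "(\<lambda>k. max M (B * q ^ k)) \<longlonglongrightarrow> max M (B * 0)" by (intro tendsto_max tendsto_const)
    thus "(\<lambda>k. max M (B * q ^ k)) \<longlonglongrightarrow> M" using B0 by simp
    show "\<exists>N. \<forall>k\<ge>N. cmod (m i) \<le> max M (B * q ^ k)" using sup by blast
  qed
  have "cmod (m i) \<le> M * q ^ j" if "j \<le> res_dist n i" for i j
    using that
  proof (induction j arbitrary: i)
    case 0
    thus ?case using M' by simp
  next
    case (Suc j)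
    hence "j \<le> res_dist n (i - 1)" "j \<le> res_dist n (i + 1)" "i \<noteq> 0" "i \<noteq> int n"
      by (auto simp: res_dist_def)
    thus ?case using Suc.IH step[of i "M * q ^ j" "M * q ^ Suc j"] by simp
  qed
  thus ?thesis by blast
qed

text \<open>
  Two coefficients are allowed because the recurrence before the translation has the
  coefficients \<open>a\<close> and \<open>b\<close>.
\<close>
lemma mathieu_seq_contr:
  assumes m: "diag_coeff n del i * m i = c1 * m (i - 1) + c2 * m (i + 1)" and i: "i \<noteq> 0" "i \<noteq> int n"
    and n: "n \<ge> 2" "cmod del \<le> real n / 4" and c: "cmod c1 \<le> c" "cmod c2 \<le> c"
  shows "cmod (m i) \<le> (2 * c / n) / 2 * (cmod (m (i - 1)) + cmod (m (i + 1)))"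
proof -
  have "real n * cmod (m i) \<le> cmod (diag_coeff n del i * m i)"
    unfolding norm_mult using norm_diag_coeff_ge[OF n i] by (intro mult_right_mono) auto
  also have "\<dots> \<le> cmod c1 * cmod (m (i - 1)) + cmod c2 * cmod (m (i + 1))"
    unfolding m by (intro norm_triangle_le) (simp add: norm_mult)
  also have "\<dots> \<le> c * cmod (m (i - 1)) + c * cmod (m (i + 1))"
    using c by (intro add_mono mult_right_mono) auto
  finally show ?thesis using n by (simp add: field_simps)
qed

lemma mathieu_seq_decay:
  assumes m: "mathieu_seq c n del m" and n: "n \<ge> 2" "cmod del \<le> real n / 4"
    and q: "2 * cmod c / n < 1" and B: "\<And>i. cmod (m i) \<le> B"
    and M: "cmod (m 0) \<le> M" "cmod (m (int n)) \<le> M"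
  shows "cmod (m i) \<le> M * (2 * cmod c / n) ^ res_dist n i"
proof (rule bounded_solution_decay[OF _ _ q B M])
  fix i assume i: "i \<noteq> 0" "i \<noteq> int n"
  have "diag_coeff n del i * m i = c * m (i - 1) + c * m (i + 1)"
    using m by (simp add: mathieu_seq_def algebra_simps)
  from mathieu_seq_contr[OF this i n order_refl order_refl]
  show "cmod (m i) \<le> 2 * cmod c / real n / 2 * (cmod (m (i - 1)) + cmod (m (i + 1)))" .
qed auto

text \<open>The recurrence operator is symmetric for the bilinear pairing \<open>\<Sum>i. A i * U i\<close>.\<close>
lemma pairing:
  assumes A: "mathieu_seq c n del A"
    and U: "\<And>i. diag_coeff n eps i * U i = c * (U (i - 1) + U (i + 1)) + G i"
    and s: "(\<lambda>i. A i * U i) summable_on UNIV" "(\<lambda>i. A i * U (i + 1)) summable_on UNIV"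
      "(\<lambda>i. A (i + 1) * U i) summable_on UNIV"
  shows "((\<lambda>i. A i * G i) has_sum (eps - del) * infsum (\<lambda>i. A i * U i) UNIV) UNIV"
proof -
  have bij: "bij_betw (\<lambda>i::int. i - 1) UNIV UNIV"
    by (rule bij_betwI[of _ _ _ "\<lambda>i. i + 1"]) auto
  have 1: "((\<lambda>i. A (i - 1) * U i) has_sum infsum (\<lambda>i. A i * U (i + 1)) UNIV) UNIV"
    using has_sum_reindex_bij_betw[OF bij, of "\<lambda>i. A i * U (i + 1)"] has_sum_infsum[OF s(2)] by simp
  have 2: "((\<lambda>i. A i * U (i - 1)) has_sum infsum (\<lambda>i. A (i + 1) * U i) UNIV) UNIV"
    using has_sum_reindex_bij_betw[OF bij, of "\<lambda>i. A (i + 1) * U i"] has_sum_infsum[OF s(3)] by simp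
  let ?p = "infsum (\<lambda>i. A i * U i) UNIV" and ?r = "infsum (\<lambda>i. A i * U (i + 1)) UNIV"
    and ?t = "infsum (\<lambda>i. A (i + 1) * U i) UNIV"
  have "((\<lambda>i. (eps - del) * (A i * U i) + c * (A (i - 1) * U i + A (i + 1) * U i)
       - c * (A i * U (i - 1) + A i * U (i + 1))) has_sum
       (eps - del) * ?p + c * (?r + ?t) - c * (?t + ?r)) UNIV"
    by (intro has_sum_minus has_sum_add has_sum_cmult_right 1 2 has_sum_infsum s)
  moreover have "(eps - del) * (A i * U i) + c * (A (i - 1) * U i + A (i + 1) * U i)
       - c * (A i * U (i - 1) + A i * U (i + 1)) = A i * G i" for i
  proof -
    have G: "G i = diag_coeff n eps i * U i - c * (U (i - 1) + U (i + 1))" using U[of i] by simp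
    have A': "diag_coeff n del i * A i = c * (A (i - 1) + A (i + 1))" using A by (simp add: mathieu_seq_def)
    have d: "diag_coeff n eps i = (eps - del) + diag_coeff n del i" by (simp add: diag_coeff_def)
    have "A i * G i = (eps - del) * (A i * U i) + (diag_coeff n del i * A i) * U i - A i * (c * (U (i - 1) + U (i + 1)))"
      unfolding G d by (simp only: algebra_simps)
    thus ?thesis unfolding A' by (simp only: algebra_simps)
  qed
  moreover have "(eps - del) * ?p + c * (?r + ?t) - c * (?t + ?r) = (eps - del) * ?p"
    by (simp add: add.commute)
  ultimately show ?thesis by (simp only:)
qed

text \<open>
  The second factor may grow: coefficients of a function that is not known to solve the equation
  may grow geometrically after the complex translation.
\<close>
lemma res_dist_summable_product:
  assumes n: "n \<ge> 1" and q: "0 \<le> q" "q * r < 1" and r: "1 \<le> r"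
    and A: "\<And>i. cmod (A i) \<le> M * q ^ res_dist n i" and U: "\<And>i. cmod (U i) \<le> K * r ^ res_dist n i"
  shows "(\<lambda>i. A i * U i) summable_on UNIV" "(\<lambda>i. A i * U (i + 1)) summable_on UNIV"
    "(\<lambda>i. A (i + 1) * U i) summable_on UNIV"
proof -
  have K: "0 \<le> K" using order_trans[OF norm_ge_zero U[of 0]] by simp
  have M: "0 \<le> M" using order_trans[OF norm_ge_zero A[of 0]] by simp
  have *: "(\<lambda>i. A i * W i) summable_on UNIV" if W: "\<And>i. cmod (W i) \<le> (K * r) * r ^ res_dist n i" for W
  proof (rule abs_summable_summable, rule res_dist_sum_bound(1)[OF n _ q(2), of "M * (K * r)"])
    fix i
    have "cmod (A i * W i) \<le> (M * q ^ res_dist n i) * ((K * r) * r ^ res_dist n i)"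
      unfolding norm_mult using A W q M by (intro mult_mono) auto
    thus "cmod (A i * W i) \<le> M * (K * r) * (q * r) ^ res_dist n i" by (simp add: mult_ac power_mult_distrib)
  qed (use M K q r in auto)
  have shift: "cmod (U j) \<le> (K * r) * r ^ res_dist n i" if "res_dist n j \<le> Suc (res_dist n i)" for i j
  proof -
    have "cmod (U j) \<le> K * r ^ res_dist n j" by (rule U)
    also have "\<dots> \<le> K * r ^ Suc (res_dist n i)" using that r K by (intro mult_left_mono power_increasing) auto
    finally show ?thesis by simp
  qed
  show "(\<lambda>i. A i * U i) summable_on UNIV" "(\<lambda>i. A i * U (i + 1)) summable_on UNIV"
    by (auto intro!: * shift simp: res_dist_def)
  have "(\<lambda>i. A i * U (i - 1)) summable_on UNIV" by (auto intro!: * shift simp: res_dist_def)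
  moreover have "bij_betw (\<lambda>i::int. i - 1) UNIV UNIV"
    by (rule bij_betwI[of _ _ _ "\<lambda>i. i + 1"]) auto
  from summable_on_reindex_bij_betw[OF this, of "\<lambda>i. A (i + 1) * U i"]
  have "(\<lambda>i. A i * U (i - 1)) summable_on UNIV \<longleftrightarrow> (\<lambda>i. A (i + 1) * U i) summable_on UNIV" by simp
  ultimately show "(\<lambda>i. A (i + 1) * U i) summable_on UNIV" by blast
qed

text \<open>The parameter is determined by the symmetry type, because eigenvectors of one type overlap.\<close>
lemma mathieu_parameter_unique:
  assumes A: "mathieu_seq c n del A" "A (int n) = 1" "A 0 = sg" "\<And>i. cmod (A i) \<le> q ^ res_dist n i"
    and U: "mathieu_seq c n eps U" "U (int n) = 1" "U 0 = sg" "\<And>i. cmod (U i) \<le> q ^ res_dist n i"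
    and sg: "sg * sg = 1" and n: "n \<ge> 1" and q: "0 \<le> q" "q \<le> 1/4"
  shows "del = eps" and "infsum (\<lambda>i. A i * U i) UNIV \<noteq> 0"
proof -
  have U1: "cmod (U i) \<le> 1" for i
    using U(4)[of i] power_le_one[of q "res_dist n i"] q by simp
  have q1: "q < 1" using q by simp
  have A': "cmod (A i) \<le> 1 * q ^ res_dist n i" for i using A(4) by simp
  have U1': "cmod (U i) \<le> 1 * 1 ^ res_dist n i" for i using U1 by simp
  note s = res_dist_summable_product[OF n q(1) _ order_refl A' U1']
  have b: "cmod (A i * U i) \<le> 1 * q ^ res_dist n i" for i
    unfolding norm_mult using mult_mono[OF A(4)[of i] U1[of i]] q by simp
  have "cmod (infsum (\<lambda>i. A i * U i) UNIV - (A 0 * U 0 + A (int n) * U (int n))) \<le> 1 * (4 * q / (1 - q))"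
    by (rule res_dist_sum_bound(2)[OF n q(1) q1 _ b]) auto
  also have "\<dots> < 2" using q by (simp add: field_simps)
  finally have "cmod (infsum (\<lambda>i. A i * U i) UNIV - 2) < 2" using A U sg by simp
  thus nz: "infsum (\<lambda>i. A i * U i) UNIV \<noteq> 0" by auto
  have "((\<lambda>i. A i * 0) has_sum (eps - del) * infsum (\<lambda>i. A i * U i) UNIV) UNIV"
    by (rule pairing[OF A(1) _ s]) (use U(1) q1 in \<open>auto simp: mathieu_seq_def\<close>)
  hence "(eps - del) * infsum (\<lambda>i. A i * U i) UNIV = 0"
    using has_sum_0[of UNIV "\<lambda>i. 0"] has_sum_unique by fastforce
  thus "del = eps" using nz by simp
qed

section \<open>Existence of symmetric solutions\<close>

text \<open>The contraction principle for bounded families of complex numbers.\<close>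
lemma bounded_function_fixpoint:
  fixes F :: "('a \<Rightarrow> complex) \<Rightarrow> 'a \<Rightarrow> complex"
  assumes k: "0 \<le> k" "k < 1" and x0: "x0 \<in> S" and F: "\<And>u. u \<in> S \<Longrightarrow> F u \<in> S"
    and S1: "\<And>u i. u \<in> S \<Longrightarrow> cmod (u i) \<le> 1"
    and contr: "\<And>u w i r. u \<in> S \<Longrightarrow> w \<in> S \<Longrightarrow> (\<And>j. cmod (u j - w j) \<le> r) \<Longrightarrow> cmod (F u i - F w i) \<le> k * r"
    and closed: "\<And>X u. (\<And>k. X k \<in> S) \<Longrightarrow> (\<And>i. (\<lambda>k. X k i) \<longlonglongrightarrow> u i) \<Longrightarrow> u \<in> S"
  shows "\<exists>u\<in>S. F u = u"
proof -
  define X where "X = (\<lambda>j. (F ^^ j) x0)"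
  have XS: "X j \<in> S" for j by (induction j) (auto simp: X_def x0 F)
  have XF: "X (Suc j) = F (X j)" for j by (simp add: X_def)
  have d: "cmod (X (j + p) i - X j i) \<le> k ^ j * 2" for j p i
  proof (induction j arbitrary: i)
    case 0
    show ?case using norm_triangle_ineq4[of "X p i" "X 0 i"] S1[OF XS[of p], of i] S1[OF XS[of 0], of i] by simp
  next
    case (Suc j)
    have "cmod (F (X (j + p)) i - F (X j) i) \<le> k * (k ^ j * 2)" by (rule contr[OF XS XS Suc])
    thus ?case by (simp add: XF mult_ac)
  qed
  have k0: "(\<lambda>j. k ^ j * 2) \<longlonglongrightarrow> 0"
    using tendsto_mult_right[OF LIMSEQ_power_zero[of k], of 2] k by simp
  have "Cauchy (\<lambda>j. X j i)" for i
  proof (rule metric_CauchyI)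
    fix e :: real assume e: "e > 0"
    then obtain N where N: "k ^ N * 2 < e / 2"
      using order_tendstoD(2)[OF k0, of "e / 2"] by (auto simp: eventually_sequentially)
    have "dist (X j i) (X N i) < e / 2" if "j \<ge> N" for j
      using d[of N "j - N" i] N that by (simp add: dist_norm)
    thus "\<exists>M. \<forall>m\<ge>M. \<forall>p\<ge>M. dist (X m i) (X p i) < e" by (meson dist_triangle_half_l dist_commute_lessI)
  qed
  then obtain x where x: "\<And>i. (\<lambda>j. X j i) \<longlonglongrightarrow> x i"
    unfolding convergent_eq_Cauchy[symmetric] by metis
  have xS: "x \<in> S" by (rule closed[OF XS x])
  have xd: "cmod (x i - X j i) \<le> k ^ j * 2" for i j
  proof (rule LIMSEQ_le_const2)
    show "(\<lambda>p. cmod (X (p + j) i - X j i)) \<longlonglongrightarrow> cmod (x i - X j i)"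
      by (intro tendsto_intros LIMSEQ_ignore_initial_segment x)
    show "\<exists>N. \<forall>p\<ge>N. cmod (X (p + j) i - X j i) \<le> k ^ j * 2" using d by (metis add.commute)
  qed
  have "F x i = x i" for i
  proof (rule LIMSEQ_unique[OF _ LIMSEQ_Suc[OF x]])
    have "cmod (X (Suc j) i - F x i) \<le> k * (k ^ j * 2)" for j
      unfolding XF using contr[OF xS XS[of j] xd[of _ j], of i] by (simp add: norm_minus_commute)
    moreover have "(\<lambda>j. k * (k ^ j * 2)) \<longlonglongrightarrow> 0" using tendsto_mult_left[OF k0, of k] by simp
    ultimately have "(\<lambda>j. X (Suc j) i - F x i) \<longlonglongrightarrow> 0"
      using Lim_null_comparison[of "\<lambda>j. X (Suc j) i - F x i" "\<lambda>j. k * (k ^ j * 2)" sequentially] by simp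
    thus "(\<lambda>j. X (Suc j) i) \<longlonglongrightarrow> F x i" by (rule LIM_zero_cancel)
  qed
  thus ?thesis using xS by auto
qed

text \<open>
  The parameter and the coefficients off the resonant indices are found together as one fixed point:
  the coordinate \<open>n\<close> of the unknown sequence stores the parameter, scaled so that the
  unit ball is mapped to itself.
\<close>
lemma mathieu_seq_exists:
  fixes c sg :: complex and n :: nat
  assumes n: "n \<ge> 2" and q: "2 * cmod c / n \<le> q" "q \<le> 1 / 8" and sg: "sg * sg = 1" "cmod sg = 1"
  obtains del m where "mathieu_seq c n del m" "m (int n) = 1" "m 0 = sg"
    "\<And>i. m (int n - i) = sg * m i" "\<And>i. cmod (m i) \<le> q ^ res_dist n i" "cmod del \<le> 2 * cmod c * q"
proof -
  define hat where "hat = (\<lambda>u i. if i = int n then 1 else if i = 0 then sg else u i)"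
  define par where "par = (\<lambda>u :: int \<Rightarrow> complex. of_nat n / 4 * u (int n))"
  define top where "top = (\<lambda>u. 4 / of_nat n * c * (hat u (int n - 1) + hat u (int n + 1)))"
  \<comment> \<open>Entry \<open>0\<close> is slaved to entry \<open>n\<close> to keep the symmetry; its own value is never read, since \<open>hat\<close> replaces it.\<close>
  define F where "F = (\<lambda>u i. if i = int n then top u else if i = 0 then sg * top u
     else c * (hat u (i - 1) + hat u (i + 1)) / diag_coeff n (par u) i)"
  define S where "S = {u :: int \<Rightarrow> complex. \<forall>i. cmod (u i) \<le> 1 \<and>
     u (int n - i) = sg * u i}"
  have n0: "real n > 0" using n by simp
  have q0: "0 \<le> q" using q(1) by (rule order_trans[rotated]) simp
  have cn: "2 * cmod c \<le> q * n" using q(1) n0 by (simp add: field_simps)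
  have hat1: "cmod (hat u i) \<le> 1" if "u \<in> S" for u i using that sg by (auto simp: hat_def S_def)
  have hsym: "hat u (int n - i) = sg * hat u i" if "u \<in> S" for u i
    using that sg n by (auto simp: hat_def S_def)
  have hdist: "cmod (hat u i - hat w i) \<le> r" if "\<And>j. cmod (u j - w j) \<le> r" for u w i r
    using that[of i] order_trans[OF norm_ge_zero that] by (auto simp: hat_def)
  have parb: "cmod (par u) \<le> real n / 4" if "u \<in> S" for u
    using that n0 by (auto simp: S_def par_def norm_mult norm_divide)
  have two: "cmod (c * (x + y)) \<le> q * n * r" if "cmod x \<le> r" "cmod y \<le> r" for x y r
  proof -
    have "cmod (c * (x + y)) \<le> cmod c * (r + r)" unfolding norm_mult
      using that norm_triangle_ineq[of x y] by (intro mult_left_mono) auto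
    also have "\<dots> = 2 * cmod c * r" by simp
    also have "\<dots> \<le> q * n * r" using cn order_trans[OF norm_ge_zero that(1)] by (intro mult_right_mono) auto
    finally show ?thesis .
  qed
  have top1: "cmod (top u) \<le> 4 * q" if "u \<in> S" for u
  proof -
    have "cmod (top u) = 4 / n * cmod (c * (hat u (int n - 1) + hat u (int n + 1)))"
      by (simp add: top_def norm_mult norm_divide)
    also have "\<dots> \<le> 4 / n * (q * n * 1)" using hat1[OF that] by (intro mult_left_mono two) auto
    finally show ?thesis using n0 by simp
  qed
  have topd: "cmod (top u - top w) \<le> 4 * q * r" if r: "\<And>j. cmod (u j - w j) \<le> r" for u w r
  proof -
    have "top u - top w = 4 / of_nat n * (c * ((hat u (int n - 1) - hat w (int n - 1)) + (hat u (int n + 1) - hat w (int n + 1))))"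
      by (simp add: top_def algebra_simps)
    hence "cmod (top u - top w) = 4 / n * cmod (c * ((hat u (int n - 1) - hat w (int n - 1)) + (hat u (int n + 1) - hat w (int n + 1))))"
      by (simp only: norm_mult norm_divide) simp
    also have "\<dots> \<le> 4 / n * (q * n * r)" using r by (intro mult_left_mono two hdist) auto
    finally show ?thesis using n0 by simp
  qed
  have F1: "cmod (F u i) \<le> 1" if u: "u \<in> S" for u i
  proof -
    have "cmod (c * (hat u (i - 1) + hat u (i + 1)) / diag_coeff n (par u) i) \<le> q * n * 1 / n" if "i \<noteq> 0" "i \<noteq> int n"
      unfolding norm_divide
      using norm_diag_coeff_ge[OF n parb[OF u] that] n0 two[OF hat1[OF u] hat1[OF u]] q0
      by (intro frac_le) auto
    hence "i \<noteq> 0 \<Longrightarrow> i \<noteq> int n \<Longrightarrow> cmod (F u i) \<le> q" using n0 by (simp add: F_def)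
    moreover have "i = 0 \<or> i = int n \<Longrightarrow> cmod (F u i) \<le> 4 * q"
      using top1[OF u] sg(2) by (auto simp: F_def norm_mult)
    ultimately show ?thesis using q(2) q0 by force
  qed
  have Fsym: "F u (int n - i) = sg * F u i" if u: "u \<in> S" for u i
  proof -
    consider "i = 0" | "i = int n" | "i \<noteq> 0" "i \<noteq> int n" by blast
    thus ?thesis
    proof cases
      case 3
      have "hat u (int n - i - 1) = sg * hat u (i + 1)" "hat u (int n - i + 1) = sg * hat u (i - 1)"
        using hsym[OF u, of "i + 1"] hsym[OF u, of "i - 1"] by (simp_all add: algebra_simps)
      moreover have "diag_coeff n d (int n - i) = diag_coeff n d i" for d
        unfolding diag_coeff_def by (simp add: mult.commute)
      moreover have "c * (sg * hat u (i + 1) + sg * hat u (i - 1)) = sg * (c * (hat u (i - 1) + hat u (i + 1)))"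
        by (simp add: algebra_simps)
      ultimately show ?thesis using 3 by (simp add: F_def)
    next
      case 1
      thus ?thesis using n by (simp add: F_def sg(1) flip: mult.assoc)
    next
      case 2
      thus ?thesis using n by (simp add: F_def)
    qed
  qed
  have Fd: "cmod (F u i - F w i) \<le> 4 * q * r" if u: "u \<in> S" and w: "w \<in> S"
    and r: "\<And>j. cmod (u j - w j) \<le> r" for u w i r
  proof -
    have main: "cmod (c * (hat u (i - 1) + hat u (i + 1)) / diag_coeff n (par u) i
        - c * (hat w (i - 1) + hat w (i + 1)) / diag_coeff n (par w) i) \<le> 4 * q * r"
      if i: "i \<noteq> 0" "i \<noteq> int n"
    proof -
      let ?N = "c * (hat u (i - 1) + hat u (i + 1))" and ?N' = "c * (hat w (i - 1) + hat w (i + 1))"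
      let ?D = "diag_coeff n (par u) i" and ?D' = "diag_coeff n (par w) i"
      have D: "real n \<le> cmod ?D" "real n \<le> cmod ?D'" using norm_diag_coeff_ge[OF n parb i] u w by blast+
      hence D0: "?D \<noteq> 0" "?D' \<noteq> 0" using n0 by auto
      have "?N / ?D - ?N' / ?D' = (?N - ?N') / ?D + ?N' * (?D' - ?D) / (?D * ?D')"
        using D0 by (simp add: field_simps)
      also have "cmod \<dots> \<le> q * n * r / n + (q * n * 1) * (n / 4 * r) / (real n * real n)"
      proof (intro norm_triangle_le add_mono)
        have "?N - ?N' = c * ((hat u (i - 1) - hat w (i - 1)) + (hat u (i + 1) - hat w (i + 1)))"
          by (simp add: algebra_simps)
        hence "cmod (?N - ?N') \<le> q * n * r" using two[OF hdist[of u w r "i - 1", OF r] hdist[of u w r "i + 1", OF r]] by simp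
        thus "cmod ((?N - ?N') / ?D) \<le> q * n * r / n" unfolding norm_divide
          using D(1) n0 q0 order_trans[OF norm_ge_zero r] by (intro frac_le) auto
        have "?D' - ?D = of_nat n / 4 * (w (int n) - u (int n))"
          by (simp add: diag_coeff_def par_def algebra_simps)
        hence "cmod (?D' - ?D) = n / 4 * cmod (w (int n) - u (int n))"
          by (simp only: norm_mult norm_divide norm_of_nat norm_numeral)
        hence "cmod (?D' - ?D) \<le> n / 4 * r"
          using r[of "int n"] by (simp add: norm_minus_commute mult_left_mono)
        thus "cmod (?N' * (?D' - ?D) / (?D * ?D')) \<le> (q * n * 1) * (n / 4 * r) / (real n * real n)"
          unfolding norm_divide norm_mult[of ?N'] norm_mult[of ?D]
          using D n0 q0 two[OF hat1[OF w] hat1[OF w]] order_trans[OF norm_ge_zero r] by (intro frac_le mult_mono) auto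
      qed
      also have "\<dots> = (5 / 4) * (q * r)" using n0 by (simp add: field_simps)
      also have "\<dots> \<le> 4 * (q * r)" using q0 order_trans[OF norm_ge_zero r] by (intro mult_right_mono) auto
      finally show ?thesis by simp
    qed
    have "cmod (sg * top u - sg * top w) = cmod (top u - top w)"
      using sg(2) by (simp add: norm_mult flip: right_diff_distrib)
    with main topd[OF r] show ?thesis by (simp add: F_def)
  qed
  have "\<exists>u\<in>S. F u = u"
  proof (rule bounded_function_fixpoint[where k = "4 * q" and S = S])
    show "(\<lambda>_. 0) \<in> S" by (simp add: S_def)
    show "F u \<in> S" if "u \<in> S" for u using F1[OF that] Fsym[OF that] by (simp add: S_def)
    show "cmod (u i) \<le> 1" if "u \<in> S" for u i using that by (simp add: S_def)
    show "cmod (F u i - F w i) \<le> 4 * q * r" if "u \<in> S" "w \<in> S" "\<And>j. cmod (u j - w j) \<le> r" for u w i r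
      using Fd that by blast
    fix X u assume X: "\<And>k. X k \<in> S" "\<And>i. (\<lambda>k. X k i) \<longlonglongrightarrow> u i"
    have "cmod (u i) \<le> 1" for i
      by (rule LIMSEQ_le_const2[OF tendsto_norm[OF X(2)]]) (use X(1) in \<open>auto simp: S_def\<close>)
    moreover have "u (int n - i) = sg * u i" for i
    proof (rule LIMSEQ_unique[OF X(2)])
      have "X k (int n - i) = sg * X k i" for k using X(1)[of k] by (simp add: S_def)
      thus "(\<lambda>k. X k (int n - i)) \<longlonglongrightarrow> sg * u i" using tendsto_mult_left[OF X(2)[of i], of sg] by simp
    qed
    ultimately show "u \<in> S" by (simp add: S_def)
  qed (use q q0 in auto)
  then obtain u where u: "u \<in> S" "F u = u" by blast
  hence uF: "u i = F u i" for i by simp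
  define m where "m = hat u"
  define del where "del = par u"
  have mn: "m (int n) = 1" and m0: "m 0 = sg" using n by (auto simp: m_def hat_def)
  have moff: "m i = F u i" if "i \<noteq> 0" "i \<noteq> int n" for i using that uF[of i] by (simp add: m_def hat_def)
  have dn: "del = c * (m (int n - 1) + m (int n + 1))"
    using uF[of "int n"] n0 by (simp add: del_def par_def F_def top_def m_def)
  have rec: "diag_coeff n del i * m i = c * (m (i - 1) + m (i + 1))" for i
  proof -
    consider "i = 0" | "i = int n" | "i \<noteq> 0" "i \<noteq> int n" by blast
    thus ?thesis
    proof cases
      case 3
      have "diag_coeff n del i \<noteq> 0" using norm_diag_coeff_ge[OF n parb[OF u(1)] 3] n0 by (auto simp: del_def)
      thus ?thesis unfolding moff[OF 3] using 3 by (simp add: F_def del_def m_def)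
    next
      case 2
      have "diag_coeff n del i * m i = del" unfolding 2 mn diag_coeff_def by simp
      thus ?thesis unfolding 2 dn[symmetric] .
    next
      case 1
      have "m (-1) = sg * m (int n + 1)" "m 1 = sg * m (int n - 1)"
        unfolding m_def using hsym[OF u(1), of "int n + 1"] hsym[OF u(1), of "int n - 1"] by simp_all
      hence "c * (m (0 - 1) + m (0 + 1)) = sg * (c * (m (int n - 1) + m (int n + 1)))"
        by (simp add: algebra_simps)
      thus ?thesis unfolding 1 dn[symmetric] m0 by (simp add: diag_coeff_def)
    qed
  qed
  hence ms: "mathieu_seq c n del m" by (simp add: mathieu_seq_def)
  have dec: "cmod (m i) \<le> q ^ res_dist n i" for i
  proof -
    have "cmod (m i) \<le> 1 * (2 * cmod c / n) ^ res_dist n i"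
      by (rule mathieu_seq_decay[OF ms n _ _ _]) (use parb[OF u(1)] q hat1[OF u(1)] mn m0 sg in \<open>auto simp: del_def m_def\<close>)
    also have "\<dots> \<le> 1 * q ^ res_dist n i" using q by (intro mult_left_mono power_mono) auto
    finally show ?thesis by simp
  qed
  have "res_dist n (int n - 1) = 1" "res_dist n (int n + 1) = 1" using n by (auto simp: res_dist_def)
  hence "cmod (m (int n - 1)) \<le> q" "cmod (m (int n + 1)) \<le> q" using dec[of "int n - 1"] dec[of "int n + 1"] by simp_all
  hence "cmod (m (int n - 1) + m (int n + 1)) \<le> 2 * q" using norm_triangle_ineq[of "m (int n - 1)" "m (int n + 1)"] by linarith
  moreover have "del = c * (m (int n - 1) + m (int n + 1))" using rec[of "int n"] mn by (simp add: diag_coeff_def)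
  ultimately have "cmod del \<le> cmod c * (2 * q)" by (simp add: norm_mult mult_left_mono)
  moreover have "m (int n - i) = sg * m i" for i using hsym[OF u(1)] by (simp add: m_def)
  ultimately show thesis using that[OF ms mn m0 _ dec] by (simp add: mult_ac)
qed

section \<open>The distance of the even and the odd parameter\<close>

text \<open>
  The solution of the recurrence that vanishes at one resonant index; the reciprocal of its value at the other
  one, \<open>n\<close>, measures the coupling of the two resonant frequencies.
\<close>
fun shoot :: "complex \<Rightarrow> nat \<Rightarrow> complex \<Rightarrow> nat \<Rightarrow> complex" where
  "shoot c n del 0 = 0"
| "shoot c n del (Suc 0) = 1"
| "shoot c n del (Suc (Suc i)) = diag_coeff n del (int (Suc i)) * shoot c n del (Suc i) / c - shoot c n del i"

text \<open>
  The diagonal dominates, so each step multiplies the modulus by at least \<open>1 / q\<close>.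
\<close>
lemma shoot_growth:
  assumes n: "n \<ge> 2" "cmod del \<le> real n / 4" and c: "c \<noteq> 0" and q: "2 * cmod c / n \<le> q" "q \<le> 1"
    and i: "i < n"
  shows "cmod (shoot c n del i) \<le> q * cmod (shoot c n del (Suc i)) \<and> shoot c n del (Suc i) \<noteq> 0"
  using i
proof (induction i)
  case 0
  have "0 \<le> q" using q(1) by (rule order_trans[rotated]) simp
  thus ?case by simp
next
  case (Suc i)
  let ?u = "cmod (shoot c n del (Suc i))" and ?w = "cmod (shoot c n del (Suc (Suc i)))"
  have n0: "real n > 0" using n by simp
  have q0: "0 \<le> q" using q(1) by (rule order_trans[rotated]) simp
  have u0: "0 < ?u" and iu: "cmod (shoot c n del i) \<le> q * ?u" using Suc by auto
  have d: "real n \<le> cmod (diag_coeff n del (int (Suc i)))" using norm_diag_coeff_ge[OF n] Suc.prems by simp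
  have "real n / cmod c * ?u \<le> cmod (diag_coeff n del (int (Suc i)) * shoot c n del (Suc i) / c)"
    unfolding norm_mult norm_divide using d by (simp add: divide_right_mono mult_right_mono)
  also have "\<dots> \<le> ?w + cmod (shoot c n del i)"
    using norm_triangle_sub[of "diag_coeff n del (int (Suc i)) * shoot c n del (Suc i) / c" "shoot c n del i"]
    by (simp add: add.commute)
  also have "\<dots> \<le> ?w + q * ?u" using iu by simp
  finally have 1: "real n / cmod c * ?u \<le> ?w + q * ?u" .
  have "2 \<le> q * (real n / cmod c)" using q(1) c n0 by (simp add: field_simps)
  from mult_right_mono[OF this, of ?u] have "2 * ?u \<le> q * (real n / cmod c * ?u)" by (simp add: mult_ac)
  also have "\<dots> \<le> q * (?w + q * ?u)" using 1 q0 by (rule mult_left_mono)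
  also have "\<dots> \<le> q * ?w + 1 * ?u"
  proof -
    have "q * q \<le> 1 * 1" using q q0 by (intro mult_mono) auto
    thus ?thesis using mult_right_mono[of "q * q" 1 ?u] by (simp add: algebra_simps)
  qed
  finally have "?u \<le> q * ?w" by simp
  moreover from this have "?w \<noteq> 0" using u0 by auto
  ultimately show ?case by auto
qed

text \<open>
  The discrete Wronskian of two solutions of the recurrence is constant.
\<close>
lemma shoot_wronskian:
  assumes m: "mathieu_seq c n del m" and c: "c \<noteq> 0"
  shows "m (int i) * shoot c n del (Suc i) - m (int i + 1) * shoot c n del i = m 0"
proof (induction i)
  case (Suc i)
  have "diag_coeff n del (int (Suc i)) * m (int (Suc i)) = c * (m (int i) + m (int (Suc i) + 1))"
    using m unfolding mathieu_seq_def by (metis add_diff_cancel_right' of_nat_Suc add.commute)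
  hence "m (int (Suc i) + 1) = diag_coeff n del (int (Suc i)) * m (int (Suc i)) / c - m (int i)"
    using c by (simp add: field_simps)
  moreover have "m (int i + 1) = m (int (Suc i))" by (simp add: add.commute)
  ultimately have "m (int (Suc i)) * shoot c n del (Suc (Suc i)) - m (int (Suc i) + 1) * shoot c n del (Suc i)
      = m (int i) * shoot c n del (Suc i) - m (int i + 1) * shoot c n del i"
    by (simp only: shoot.simps) (simp add: algebra_simps)
  with Suc show ?case by (simp only:)
qed simp

lemma prod_interior:
  assumes "n \<ge> 1"
  shows "(\<Prod>i\<in>{1..<n}. 4 * of_int (int i * (int n - int i)) :: complex) = 4 ^ (n - 1) * (fact (n - 1))\<^sup>2"
proof -
  have "(\<Prod>i\<in>{1..<n}. of_nat (n - i) :: complex) = (\<Prod>i\<in>{1..<n}. of_nat i)"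
    by (rule prod.reindex_bij_witness[of _ "\<lambda>i. n - i" "\<lambda>i. n - i"]) auto
  moreover have "(\<Prod>i\<in>{1..<n}. of_nat i :: complex) = fact (n - 1)"
    using assms by (simp add: fact_prod atLeastLessThanSuc_atLeastAtMost[symmetric])
  moreover have "(\<Prod>i\<in>{1..<n}. 4 * of_int (int i * (int n - int i)) :: complex)
     = (\<Prod>i\<in>{1..<n}. 4 * (of_nat i * of_nat (n - i)))"
    by (intro prod.cong) (auto simp: of_nat_diff)
  ultimately show ?thesis by (simp add: prod.distrib power2_eq_square)
qed

text \<open>
  Each step of the shooting solution multiplies by \<open>4 i (n - i) / c\<close> up to a relative error
  \<open>O(1 / n\<^sup>2)\<close>, and there are \<open>n - 1\<close> steps.
\<close>
lemma shoot_asymptotics: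
  assumes n: "n \<ge> 2" and c: "c \<noteq> 0" and q: "q = 2 * cmod c / n" "q \<le> 1 / 8" and del: "cmod del \<le> 2 * cmod c * q"
  obtains P where "shoot c n del n * c ^ (n - 1) = 4 ^ (n - 1) * (fact (n - 1))\<^sup>2 * P"
    "cmod (P - 1) \<le> exp (8 * (cmod c)\<^sup>2 / n) - 1"
proof -
  have n0: "real n > 0" using n by simp
  have q0: "0 < q" using q c n0 by simp
  have cq: "2 * cmod c = q * n" using q n0 by simp
  have qq: "q * q \<le> 1 / 8 * q" using q q0 by (intro mult_right_mono) auto
  have del4: "cmod del \<le> real n / 4"
  proof -
    have "cmod del \<le> (q * q) * n" using del cq by (simp add: mult_ac)
    also have "\<dots> \<le> (1 / 4) * n"
    proof (rule mult_right_mono)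
      show "q * q \<le> 1 / 4" using qq q(2) by linarith
    qed simp
    finally show ?thesis by simp
  qed
  define b where "b = (\<lambda>i::nat. 4 * of_int (int i * (int n - int i)) :: complex)"
  define g where "g = (\<lambda>i. shoot c n del (Suc i) * c / (shoot c n del i * b i) - 1)"
  have bn: "2 * real n \<le> cmod (b i)" if "1 \<le> i" "i < n" for i
  proof -
    have "real n - 1 \<le> real_of_int \<bar>int i * (int n - int i)\<bar>"
      using interior_index_bound[of "int i" n] that by linarith
    hence "4 * (real n - 1) \<le> cmod (b i)" unfolding b_def norm_mult norm_of_int by simp
    thus ?thesis using n by simp
  qed
  have s0: "shoot c n del i \<noteq> 0" if "1 \<le> i" "i \<le> n" for i
    using shoot_growth[OF n del4 c eq_refl[OF q(1)[symmetric]], of "i - 1"] q that by auto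
  have gb: "cmod (g i) \<le> 2 * q\<^sup>2" if i: "1 \<le> i" "i < n" for i
  proof -
    obtain j where j: "i = Suc j" using i by (cases i) auto
    have b0: "b i \<noteq> 0" using bn[OF i] n0 by auto
    have rec: "shoot c n del (Suc i) * c = (b i + del) * shoot c n del i - c * shoot c n del j"
      using c by (simp add: j b_def diag_coeff_def field_simps)
    have "g i = ((shoot c n del (Suc i)) * c - shoot c n del i * b i) / (shoot c n del i * b i)"
      using s0[of i] i b0 by (simp add: g_def field_simps)
    also have "\<dots> = (del - c * (shoot c n del j / shoot c n del i)) / b i"
      unfolding rec using s0[of i] i b0 by (simp add: field_simps)
    finally have g: "g i = (del - c * (shoot c n del j / shoot c n del i)) / b i" .
    have "cmod (shoot c n del j) \<le> q * cmod (shoot c n del (Suc j)) \<and> shoot c n del (Suc j) \<noteq> 0"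
      by (rule shoot_growth[OF n del4 c eq_refl[OF q(1)[symmetric]]]) (use q(2) i j in auto)
    hence "cmod (shoot c n del j / shoot c n del i) \<le> q"
      by (simp add: norm_divide j pos_divide_le_eq)
    hence "cmod (c * (shoot c n del j / shoot c n del i)) \<le> cmod c * q"
      unfolding norm_mult by (intro mult_left_mono) auto
    hence "cmod (del - c * (shoot c n del j / shoot c n del i)) \<le> 4 * cmod c * q"
      using del norm_triangle_ineq4[of del "c * (shoot c n del j / shoot c n del i)"]
        mult_nonneg_nonneg[OF norm_ge_zero[of c] less_imp_le[OF q0]] by linarith
    hence "cmod (g i) \<le> (4 * cmod c * q) / (2 * n)"
      unfolding g norm_divide using bn[OF i] n0 q0 by (intro frac_le) auto
    also have "\<dots> = (2 * cmod c) * q / n" by simp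
    also have "\<dots> = q\<^sup>2" unfolding cq using n0 by (simp add: power2_eq_square)
    finally show ?thesis using zero_le_power2[of q] by linarith
  qed
  define P where "P = (\<Prod>i\<in>{1..<n}. 1 + g i)"
  have "shoot c n del k * c ^ (k - 1) = (\<Prod>i\<in>{1..<k}. b i) * (\<Prod>i\<in>{1..<k}. 1 + g i)" if "1 \<le> k" "k \<le> n" for k
    using that
  proof (induction k rule: dec_induct)
    case (step k)
    have b0: "b k \<noteq> 0" using bn[of k] step n0 by auto
    have "shoot c n del (Suc k) * c = shoot c n del k * (b k * (1 + g k))"
      using s0[of k] step b0 by (simp add: g_def)
    moreover have "c ^ (Suc k - 1) = c * c ^ (k - 1)" using step by (cases k) auto
    ultimately have "shoot c n del (Suc k) * c ^ (Suc k - 1) = (shoot c n del k * c ^ (k - 1)) * (b k * (1 + g k))"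
      by (metis mult.assoc mult.commute)
    also have "\<dots> = ((\<Prod>i\<in>{1..<k}. b i) * (\<Prod>i\<in>{1..<k}. 1 + g i)) * (b k * (1 + g k))" using step by simp
    also have "\<dots> = (\<Prod>i\<in>{1..<Suc k}. b i) * (\<Prod>i\<in>{1..<Suc k}. 1 + g i)"
      using step by (simp add: prod.atLeastLessThan_Suc mult_ac)
    finally show ?case .
  qed simp
  from this[of n] have 1: "shoot c n del n * c ^ (n - 1) = 4 ^ (n - 1) * (fact (n - 1))\<^sup>2 * P"
    using prod_interior[of n] n by (simp add: b_def P_def)
  have "cmod (P - 1) \<le> (\<Prod>i\<in>{1..<n}. 1 + cmod (g i)) - 1"
    unfolding P_def by (rule norm_prod_minus1_le_prod_minus1)
  also have "(\<Prod>i\<in>{1..<n}. 1 + cmod (g i)) \<le> (\<Prod>i\<in>{1..<n}. exp (2 * q\<^sup>2))"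
  proof (intro prod_mono conjI)
    fix i assume "i \<in> {1..<n}"
    hence "cmod (g i) \<le> 2 * q\<^sup>2" using gb by auto
    thus "1 + cmod (g i) \<le> exp (2 * q\<^sup>2)" using exp_ge_add_one_self[of "2 * q\<^sup>2"] by linarith
  qed auto
  also have "(\<Prod>i\<in>{1..<n}. exp (2 * q\<^sup>2)) = exp (real (n - 1) * (2 * q\<^sup>2))"
    by (simp add: exp_of_nat_mult)
  also have "\<dots> \<le> exp (8 * (cmod c)\<^sup>2 / n)"
  proof -
    have "real (n - 1) * (2 * q\<^sup>2) \<le> real n * (2 * q\<^sup>2)" by (intro mult_right_mono) auto
    also have "\<dots> = 8 * (cmod c)\<^sup>2 / n" unfolding q(1) using n0 by (simp add: field_simps power2_eq_square)
    finally show ?thesis by simp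
  qed
  finally show thesis using that[OF 1] by simp
qed

text \<open>
  Adding to the odd solution a multiple of the reflected shooting solution gives a symmetric
  sequence \<open>Z\<close> that satisfies the recurrence except at the two resonant indices, where it fails by
  \<open>2 c / shoot n\<close>. Pairing \<open>Z\<close> with the even solution isolates the distance of the two parameters.
\<close>
lemma mathieu_gap:
  assumes A: "mathieu_seq c n del A" "A (int n) = 1" "A 0 = 1" "\<And>i. cmod (A i) \<le> q ^ res_dist n i"
    and B: "mathieu_seq c n eps B" "B (int n) = 1" "B 0 = -1" "\<And>i. B (int n - i) = - B i"
      "\<And>i. cmod (B i) \<le> q ^ res_dist n i" "cmod eps \<le> 2 * cmod c * q"
    and n: "n \<ge> 2" and c: "c \<noteq> 0" and q: "q = 2 * cmod c / n" "q \<le> 1 / 8"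
  obtains S where "(del - eps) * S * shoot c n eps n = 4 * c" "cmod (S - 2) \<le> 24 * q"
proof -
  have n0: "real n > 0" using n by simp
  have q0: "0 < q" using q c n0 by simp
  have cq: "2 * cmod c = q * n" using q n0 by simp
  have eps4: "cmod eps \<le> real n / 4"
  proof -
    have "cmod eps \<le> (q * q) * n" using B(6) cq by (simp add: mult_ac)
    also have "\<dots> \<le> (1 / 8 * 1) * n" using q q0 n0 by (intro mult_right_mono mult_mono) auto
    finally show ?thesis using n0 by simp
  qed
  define u where "u = shoot c n eps"
  have ug: "cmod (u i) \<le> q * cmod (u (Suc i))" "u (Suc i) \<noteq> 0" if "i < n" for i
    using shoot_growth[OF n eps4 c eq_refl[OF q(1)[symmetric]] _ that] q by (auto simp: u_def)
  have un0: "u n \<noteq> 0" using ug(2)[of "n - 1"] n by simp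
  have uu: "cmod (u i) \<le> cmod (u n)" if "i \<le> n" for i
    using that
  proof (induction i rule: inc_induct)
    case (step i)
    have "cmod (u i) \<le> q * cmod (u (Suc i))" using ug step by auto
    also have "\<dots> \<le> 1 * cmod (u (Suc i))" using q by (intro mult_right_mono) auto
    finally show ?case using step by simp
  qed simp
  \<comment> \<open>The sign change on the negative indices and the value \<open>-1 + 2 = 1\<close> at index \<open>0\<close> make \<open>Z\<close> symmetric.\<close>
  define Z where "Z = (\<lambda>i. if i < 0 then - B i else if i \<le> int n then B i + 2 * u (n - nat i) / u n else B i)"
  define G where "G = (\<lambda>i. if i = 0 \<or> i = int n then - 2 * c / u n else 0)"
  have Brec: "diag_coeff n eps i * B i = c * (B (i - 1) + B (i + 1))" for i
    using B(1) by (simp add: mathieu_seq_def)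
  have Z0: "Z 0 = 1" and Zn: "Z (int n) = 1" using B un0 n by (auto simp: Z_def u_def)
  have Zin: "Z (int k) = B (int k) + 2 * u (n - k) / u n" if "k \<le> n" for k using that by (simp add: Z_def)
  have Zout: "Z i = B i" if "i \<ge> int n" for i using that B by (auto simp: Z_def u_def)
  have Zneg: "Z i = - B i" if "i \<le> 0" for i
    using that B un0 by (cases "i = 0") (auto simp: Z_def)
  have Bw: "B (int n - 1) * u n = u (n - 1) - 1"
  proof -
    have "B (int (n - 1)) * u (Suc (n - 1)) - B (int (n - 1) + 1) * u (n - 1) = B 0"
      unfolding u_def by (rule shoot_wronskian[OF B(1) c])
    moreover have "int (n - 1) = int n - 1" "Suc (n - 1) = n" using n by auto
    ultimately show ?thesis using B by (simp add: algebra_simps)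
  qed
  have rec: "diag_coeff n eps i * Z i = c * (Z (i - 1) + Z (i + 1)) + G i" for i
  proof -
    consider "i < 0" | "i = 0" | "0 < i" "i < int n" | "i = int n" | "int n < i" by linarith
    thus ?thesis
    proof cases
      case 1
      thus ?thesis using Brec[of i] by (simp add: Zneg G_def algebra_simps)
    next
      case 5
      thus ?thesis using Brec[of i] by (simp add: Zout G_def algebra_simps)
    next
      case 3
      define k where "k = nat i"
      have k: "i = int k" "0 < k" "k < n" using 3 by (auto simp: k_def)
      obtain j where j: "n - k = Suc j" using k by (metis Suc_diff_Suc)
      have idx: "n - (k - 1) = Suc (Suc j)" "n - (k + 1) = j" using j k by auto
      have d: "diag_coeff n eps (int (Suc j)) = diag_coeff n eps (int k)"
      proof -
        have "int (Suc j) = int n - int k" using j k by linarith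
        thus ?thesis unfolding diag_coeff_def by (simp add: mult.commute)
      qed
      have ur: "diag_coeff n eps (int k) * u (n - k) = c * (u (n - (k - 1)) + u (n - (k + 1)))"
        unfolding j idx u_def using c d by (simp add: field_simps)
      have "Z (i - 1) = B (i - 1) + 2 * u (n - (k - 1)) / u n" "Z (i + 1) = B (i + 1) + 2 * u (n - (k + 1)) / u n"
        using Zin[of "k - 1"] Zin[of "k + 1"] k by (simp_all add: of_nat_diff add.commute)
      hence "c * (Z (i - 1) + Z (i + 1)) = c * (B (i - 1) + B (i + 1)) + 2 * (c * (u (n - (k - 1)) + u (n - (k + 1)))) / u n"
        using un0 by (simp add: field_simps)
      also have "\<dots> = diag_coeff n eps i * B i + 2 * (diag_coeff n eps (int k) * u (n - k)) / u n"
        unfolding ur Brec ..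
      also have "\<dots> = diag_coeff n eps i * Z i" using Zin[of k] k by (simp add: algebra_simps)
      finally show ?thesis using 3 by (simp add: G_def)
    next
      case 4
      have "u (n - (n - 1)) = 1" using n by (simp add: u_def numeral_2_eq_2 Suc_diff_Suc)
      hence "Z (int n - 1) = B (int n - 1) + 2 / u n"
        using Zin[of "n - 1"] n by (simp add: of_nat_diff)
      moreover have "Z (int n + 1) = B (int n + 1)" by (rule Zout) simp
      moreover have "diag_coeff n eps (int n) * Z (int n) = c * (B (int n - 1) + B (int n + 1))"
        using Brec[of "int n"] B(2) Zn by simp
      ultimately show ?thesis using 4 un0 by (simp add: G_def algebra_simps)
    next
      case 2
      have e1: "Z (-1) = - B (-1)" by (rule Zneg) simp
      have e2: "Z 1 = B 1 + 2 * (u (n - 1) / u n)" using Zin[of 1] n by simp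
      have e3: "B 1 = - B (int n - 1)" using B(4)[of 1] by simp
      have e4: "diag_coeff n eps 0 * Z 0 = - c * (B (-1) + B 1)"
      proof -
        have "- diag_coeff n eps 0 = c * (B (-1) + B 1)" using Brec[of 0] B(3) by simp
        thus ?thesis unfolding Z0 by (metis minus_minus mult.right_neutral mult_minus_left)
      qed
      have e5: "B (int n - 1) = (u (n - 1) - 1) / u n" using Bw un0 by (simp add: field_simps)
      have gen: "- c * (b + - y) - c * (- b + (- y + 2 * p)) = - 2 * c * (- y + p)" for b y p
        by (simp add: algebra_simps)
      have "diag_coeff n eps 0 * Z 0 - c * (Z (-1) + Z 1) = - 2 * c * (- ((u (n - 1) - 1) / u n) + u (n - 1) / u n)"
        unfolding e4 e1 e2 e3 e5 by (rule gen)
      also have "\<dots> = G 0" using un0 by (simp add: G_def field_simps)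
      finally show ?thesis using 2 by (simp add: algebra_simps)
    qed
  qed
  have Zb: "cmod (Z i) \<le> 3" for i
  proof -
    have "cmod (B i) \<le> 1" using B(5)[of i] power_le_one[of q "res_dist n i"] q q0 by simp
    moreover have "cmod (2 * u (n - nat i) / u n) \<le> 2"
      using uu[of "n - nat i"] un0 by (simp add: norm_mult norm_divide pos_divide_le_eq)
    ultimately show ?thesis
      using norm_triangle_ineq[of "B i" "2 * u (n - nat i) / u n"] unfolding Z_def by auto
  qed
  have Zb': "cmod (Z i) \<le> 3 * 1 ^ res_dist n i" for i using Zb by simp
  define S where "S = infsum (\<lambda>i. A i * Z i) UNIV"
  have A': "cmod (A i) \<le> 1 * q ^ res_dist n i" for i using A(4) by simp
  have n1: "n \<ge> 1" "0 \<le> q" "q < 1" using n q q0 by auto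
  have "((\<lambda>i. A i * G i) has_sum (eps - del) * S) UNIV"
    unfolding S_def
    by (rule pairing[OF A(1) rec res_dist_summable_product[OF n1(1,2) _ order_refl A' Zb']]) (use n1 in auto)
  moreover have "((\<lambda>i. A i * G i) has_sum (A 0 * G 0 + A (int n) * G (int n))) UNIV"
  proof (rule has_sum_cong_neutral[THEN iffD1, rotated -1])
    show "((\<lambda>i. A i * G i) has_sum (A 0 * G 0 + A (int n) * G (int n))) {0, int n}"
      using n by (intro has_sum_finiteI) auto
  qed (auto simp: G_def)
  ultimately have "(eps - del) * S = - 4 * c / u n"
    using A has_sum_unique by (fastforce simp: G_def)
  hence 1: "(del - eps) * S * u n = 4 * c" using un0 by (simp add: field_simps)
  have "cmod (S - (A 0 * Z 0 + A (int n) * Z (int n))) \<le> 3 * (4 * q / (1 - q))"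
    unfolding S_def
  proof (rule res_dist_sum_bound(2)[OF n1])
    fix i
    have "cmod (A i * Z i) \<le> q ^ res_dist n i * 3" unfolding norm_mult
      using A(4) Zb q0 by (intro mult_mono) auto
    thus "cmod (A i * Z i) \<le> 3 * q ^ res_dist n i" by simp
  qed auto
  also have "\<dots> \<le> 24 * q"
  proof -
    have "q * q \<le> 1 / 8 * q" using q(2) q0 by (intro mult_right_mono) auto
    hence "4 * q \<le> (8 * q) * (1 - q)" using q0 by (simp add: algebra_simps)
    hence "4 * q / (1 - q) \<le> 8 * q" using n1(3) by (subst pos_divide_le_eq) auto
    thus ?thesis by simp
  qed
  finally have "cmod (S - 2) \<le> 24 * q" using A Z0 Zn by simp
  with 1 show thesis using that by (simp add: u_def)
qed

section \<open>Trigonometric series with geometrically decaying coefficients\<close>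

text \<open>
  An enumeration of the integers reduces this to the termwise differentiation of an ordinary series.
\<close>
lemma termwise_derivative_int:
  fixes f f' :: "int \<Rightarrow> complex \<Rightarrow> complex"
  assumes S: "open S" "convex S" and z: "z \<in> S"
    and d: "\<And>i z. z \<in> S \<Longrightarrow> (f i has_field_derivative f' i z) (at z)"
    and g: "\<And>i z. z \<in> S \<Longrightarrow> cmod (f i z) \<le> g i" "g summable_on UNIV"
    and g': "\<And>i z. z \<in> S \<Longrightarrow> cmod (f' i z) \<le> g' i" "g' summable_on UNIV"
  shows "((\<lambda>z. infsum (\<lambda>i. f i z) UNIV) has_field_derivative infsum (\<lambda>i. f' i z) UNIV) (at z)"
proof -
  have nat_sum: "infsum (\<lambda>i. h i) UNIV = (\<Sum>j. h (int_decode j)) \<and> summable (\<lambda>j. h (int_decode j))"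
    if h: "\<And>i. cmod (h i) \<le> G i" "G summable_on UNIV" for h :: "int \<Rightarrow> complex" and G
  proof -
    have "h summable_on UNIV"
    proof (rule abs_summable_summable, rule Infinite_Sum.abs_summable_on_comparison_test[where g = G])
      have "0 \<le> G i" for i using h(1) order_trans norm_ge_zero by blast
      thus "(\<lambda>i. norm (G i)) summable_on UNIV" using h(2) by simp
    qed (use h(1) in \<open>auto intro: order_trans[OF _ abs_ge_self]\<close>)
    hence "(h has_sum infsum h UNIV) UNIV" by (rule has_sum_infsum)
    hence "((\<lambda>j. h (int_decode j)) has_sum infsum h UNIV) UNIV"
      using has_sum_reindex_bij_betw[OF bij_int_decode, of h] by blast
    from has_sum_imp_sums[OF this] show ?thesis by (simp add: sums_iff)
  qed
  have summ: "summable (\<lambda>j. g' (int_decode j))"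
  proof -
    have "(\<lambda>j. g' (int_decode j)) summable_on UNIV"
      using summable_on_reindex_bij_betw[OF bij_int_decode, of g'] g'(2) by blast
    thus ?thesis by (rule summable_on_imp_summable)
  qed
  have "((\<lambda>z. \<Sum>j. f (int_decode j) z) has_field_derivative (\<Sum>j. f' (int_decode j) z)) (at z)"
  proof (rule has_field_derivative_series'(2)[OF S(2)])
    show "uniformly_convergent_on S (\<lambda>n x. \<Sum>i<n. f' (int_decode i) x)"
      by (rule Weierstrass_m_test'[OF g'(1) summ])
    show "summable (\<lambda>j. f (int_decode j) z)" using nat_sum[OF g(1)[OF z] g(2)] by blast
    show "z \<in> interior S" using z S by (simp add: interior_open)
  qed (use d z in \<open>auto intro: has_field_derivative_at_within\<close>)
  moreover have "infsum (\<lambda>i. f' i z) UNIV = (\<Sum>j. f' (int_decode j) z)" using nat_sum[OF g'(1)[OF z] g'(2)] by blast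
  moreover have "(\<Sum>j. f (int_decode j) w) = infsum (\<lambda>i. f i w) UNIV" if "w \<in> S" for w
    using nat_sum[OF g(1)[OF that] g(2)] by simp
  ultimately show ?thesis
    using has_field_derivative_transform_within_open[OF _ S(1) z] by simp
qed

definition freq :: "nat \<Rightarrow> int \<Rightarrow> complex" where
  "freq n i = of_int (2 * i - int n)"

definition trig_series :: "nat \<Rightarrow> (int \<Rightarrow> complex) \<Rightarrow> complex \<Rightarrow> complex" where
  "trig_series n m z = infsum (\<lambda>i. m i * exp (\<i> * freq n i * z)) UNIV"

lemma freq_res_dist: "\<bar>2 * i - int n\<bar> \<le> int n + 2 * int (res_dist n i)"
  by (auto simp: res_dist_def min_def abs_if)

text \<open>
  The bound is geometric in the distance so that differentiation only worsens the ratio of the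
  geometric decay by a factor \<open>4\<close>.
\<close>
lemma norm_freq_le:
  assumes "n \<ge> 1"
  shows "cmod (freq n i) \<le> real n * 4 ^ res_dist n i"
proof -
  let ?d = "res_dist n i"
  have p: "1 + 2 * real k \<le> 4 ^ k" for k by (induction k) auto
  have "cmod (freq n i) \<le> real n + 2 * real ?d"
    using freq_res_dist[of i n] unfolding freq_def norm_of_int by linarith
  also have "\<dots> \<le> real n * (1 + 2 * real ?d)" using assms mult_right_mono[of 1 "real n" "2 * real ?d"] by (simp add: algebra_simps)
  also have "\<dots> \<le> real n * 4 ^ ?d" using p by (intro mult_left_mono) auto
  finally show ?thesis .
qed

text \<open>
  In the strip \<open>|Im z| \<le> rho\<close> every mode is at most \<open>exp (n rho)\<close>, the size of the resonant modes, up to a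
  factor geometric in the distance to resonance.
\<close>
lemma norm_exp_freq_le:
  assumes "\<bar>Im z\<bar> \<le> rho"
  shows "cmod (exp (\<i> * freq n i * z)) \<le> exp (n * rho) * exp (2 * rho) ^ res_dist n i"
proof -
  have "Re (\<i> * freq n i * z) \<le> real_of_int \<bar>2 * i - int n\<bar> * \<bar>Im z\<bar>"
    using abs_ge_self[of "- (real_of_int (2 * i - int n) * Im z)"] by (simp add: freq_def abs_mult)
  also have "\<dots> \<le> (real n + 2 * real (res_dist n i)) * rho"
    using freq_res_dist[of i n] assms by (intro mult_mono) linarith+
  finally have "cmod (exp (\<i> * freq n i * z)) \<le> exp ((real n + 2 * real (res_dist n i)) * rho)"
    by (simp only: norm_exp_eq_Re exp_le_cancel_iff)
  also have "\<dots> = exp (n * rho) * exp (2 * rho) ^ res_dist n i"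
    by (simp add: algebra_simps flip: exp_add exp_of_nat_mult)
  finally show ?thesis .
qed

lemma trig_series_term_bound:
  assumes "\<bar>Im z\<bar> \<le> rho" "cmod (m i) \<le> K * x ^ res_dist n i"
  shows "cmod (m i * exp (\<i> * freq n i * z)) \<le> (K * exp (n * rho)) * (x * exp (2 * rho)) ^ res_dist n i"
proof -
  have "cmod (m i * exp (\<i> * freq n i * z)) \<le> (K * x ^ res_dist n i) * (exp (n * rho) * exp (2 * rho) ^ res_dist n i)"
    unfolding norm_mult using assms norm_exp_freq_le[OF assms(1)] order_trans[OF norm_ge_zero assms(2)]
    by (intro mult_mono) auto
  thus ?thesis by (simp add: power_mult_distrib mult_ac)
qed

text \<open>Only the two resonant terms of the series matter.\<close>
lemma trig_series_approx:
  assumes n: "n \<ge> 1" and x: "0 \<le> x" "x * exp (2 * rho) \<le> 1 / 2" and K: "0 \<le> K" and z: "\<bar>Im z\<bar> \<le> rho"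
    and m: "\<And>i. i \<noteq> 0 \<Longrightarrow> i \<noteq> int n \<Longrightarrow> cmod (m i) \<le> K * x ^ res_dist n i"
  shows "(\<lambda>i. m i * exp (\<i> * freq n i * z)) summable_on UNIV"
    and "cmod (trig_series n m z - (m 0 * exp (- (\<i> * of_nat n * z)) + m (int n) * exp (\<i> * of_nat n * z)))
       \<le> K * exp (n * rho) * (8 * (x * exp (2 * rho)))"
proof -
  let ?y = "x * exp (2 * rho)"
  have y: "0 \<le> ?y" "?y < 1" using x by auto
  have K': "0 \<le> K * exp (n * rho)" using K by simp
  note b = res_dist_sum_bound[OF n y K', of "\<lambda>i. m i * exp (\<i> * freq n i * z)"]
  have t: "cmod (m i * exp (\<i> * freq n i * z)) \<le> (K * exp (n * rho)) * ?y ^ res_dist n i" if "i \<noteq> 0" "i \<noteq> int n" for i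
    by (rule trig_series_term_bound[of z rho "m" i K x, OF z m[OF that]])
  show "(\<lambda>i. m i * exp (\<i> * freq n i * z)) summable_on UNIV"
    by (rule abs_summable_summable[OF b(1)[OF t]])
  have "cmod (trig_series n m z - (m 0 * exp (- (\<i> * of_nat n * z)) + m (int n) * exp (\<i> * of_nat n * z)))
      \<le> K * exp (n * rho) * (4 * ?y / (1 - ?y))"
    using b(2)[OF t] by (simp add: trig_series_def freq_def)
  also have "\<dots> \<le> K * exp (n * rho) * (8 * ?y)"
  proof (rule mult_left_mono[OF _ K'])
    have "?y * ?y \<le> 1 / 2 * ?y" using x y by (intro mult_right_mono) auto
    hence "4 * ?y \<le> (8 * ?y) * (1 - ?y)" by (simp add: algebra_simps)
    thus "4 * ?y / (1 - ?y) \<le> 8 * ?y" using y by (subst pos_divide_le_eq) auto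
  qed
  finally show "cmod (trig_series n m z - (m 0 * exp (- (\<i> * of_nat n * z)) + m (int n) * exp (\<i> * of_nat n * z)))
       \<le> K * exp (n * rho) * (8 * ?y)" .
qed

lemma trig_series_derivative:
  assumes n: "n \<ge> 1" and x: "0 \<le> x" "4 * x * exp (2 * rho) \<le> 1 / 2" and K: "0 \<le> K" and z: "\<bar>Im z\<bar> < rho"
    and m: "\<And>i. cmod (m i) \<le> K * x ^ res_dist n i"
  shows "(trig_series n m has_field_derivative trig_series n (\<lambda>i. \<i> * freq n i * m i) z) (at z)"
proof -
  define S where "S = {z. \<bar>Im z\<bar> < rho}"
  have S: "open S" "convex S"
  proof -
    have "S = {z. Im z < rho} \<inter> {z. Im z > - rho}" by (auto simp: S_def abs_less_iff)
    thus "open S" "convex S"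
      by (auto simp: open_halfspace_Im_lt open_halfspace_Im_gt convex_halfspace_Im_lt convex_halfspace_Im_gt
          intro!: convex_Int)
  qed
  have er: "1 \<le> exp (2 * rho)" using z by simp
  have y: "0 \<le> x * exp (2 * rho)" "x * exp (2 * rho) < 1" "0 \<le> 4 * x * exp (2 * rho)" "4 * x * exp (2 * rho) < 1"
    using x er by auto
  have gs: "(\<lambda>i. C * w ^ res_dist n i) summable_on UNIV" if "0 \<le> w" "w < 1" "0 \<le> C" for w C :: real
  proof -
    have "(\<lambda>i. cmod (of_real (C * w ^ res_dist n i))) summable_on UNIV"
      by (rule res_dist_sum_bound(1)[OF n that(1,2,3)]) (use that in \<open>auto simp: norm_mult norm_power\<close>)
    thus ?thesis using that by (simp add: norm_mult norm_power)
  qed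
  have m': "cmod (\<i> * freq n i * m i) \<le> (n * K) * (4 * x) ^ res_dist n i" for i
  proof -
    have "cmod (\<i> * freq n i * m i) \<le> (real n * 4 ^ res_dist n i) * (K * x ^ res_dist n i)"
      unfolding norm_mult using norm_freq_le[OF n, of i] m[of i] by (auto intro!: mult_mono)
    thus ?thesis by (simp add: power_mult_distrib mult_ac)
  qed
  have "((\<lambda>z. infsum (\<lambda>i. m i * exp (\<i> * freq n i * z)) UNIV) has_field_derivative
      infsum (\<lambda>i. (\<i> * freq n i * m i) * exp (\<i> * freq n i * z)) UNIV) (at z)"
  proof (rule termwise_derivative_int[OF S])
    show "z \<in> S" using z by (simp add: S_def)
    show "((\<lambda>z. m i * exp (\<i> * freq n i * z)) has_field_derivative \<i> * freq n i * m i * exp (\<i> * freq n i * z)) (at z)" for i z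
      by (auto intro!: derivative_eq_intros)
    show "cmod (m i * exp (\<i> * freq n i * z)) \<le> (K * exp (n * rho)) * (x * exp (2 * rho)) ^ res_dist n i" if "z \<in> S" for i z
      by (rule trig_series_term_bound) (use that m in \<open>auto simp: S_def\<close>)
    show "cmod (\<i> * freq n i * m i * exp (\<i> * freq n i * z)) \<le> ((n * K) * exp (n * rho)) * ((4 * x) * exp (2 * rho)) ^ res_dist n i"
      if "z \<in> S" for i z
      by (rule trig_series_term_bound[of z rho "\<lambda>i. \<i> * freq n i * m i" i "real n * K" "4 * x", OF _ m']) (use that in \<open>auto simp: S_def\<close>)
  qed (use y K in \<open>auto intro!: gs\<close>)
  thus ?thesis by (simp add: trig_series_def[abs_def])
qed

text \<open>
  Multiplication by \<open>2 cos (2 z) = exp (2 i z) + exp (- 2 i z)\<close> shifts the index by one in both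
  directions, so the recurrence is the differential equation.
\<close>
lemma trig_series_mathieu_equation:
  assumes m: "mathieu_seq c n del m" and n: "n \<ge> 1" and q: "0 \<le> q" "16 * q * exp (2 * rho) \<le> 1 / 2"
    and dec: "\<And>i. cmod (m i) \<le> q ^ res_dist n i" and z: "\<bar>Im z\<bar> < rho"
  shows "(trig_series n m has_field_derivative trig_series n (\<lambda>i. \<i> * freq n i * m i) z) (at z)"
    and "(trig_series n (\<lambda>i. \<i> * freq n i * m i) has_field_derivative
            (2 * c * cos (2 * z) - (of_nat n ^ 2 + del)) * trig_series n m z) (at z)"
proof -
  have q4: "4 * q * exp (2 * rho) \<le> 1 / 2"
    using q mult_right_mono[of "4 * q" "16 * q" "exp (2 * rho)"] by auto
  have q1: "q * exp (2 * rho) \<le> 1 / 2"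
    using q mult_right_mono[of q "16 * q" "exp (2 * rho)"] by auto
  show "(trig_series n m has_field_derivative trig_series n (\<lambda>i. \<i> * freq n i * m i) z) (at z)"
    by (rule trig_series_derivative[OF n q(1) q4 _ z, of 1]) (use dec in auto)
  have m1: "cmod (\<i> * freq n i * m i) \<le> n * (4 * q) ^ res_dist n i" for i
  proof -
    have "cmod (\<i> * freq n i * m i) \<le> (real n * 4 ^ res_dist n i) * q ^ res_dist n i"
      unfolding norm_mult using norm_freq_le[OF n, of i] dec[of i] by (auto intro!: mult_mono)
    thus ?thesis by (simp add: power_mult_distrib mult_ac)
  qed
  have "(trig_series n (\<lambda>i. \<i> * freq n i * m i) has_field_derivative
      trig_series n (\<lambda>i. \<i> * freq n i * (\<i> * freq n i * m i)) z) (at z)"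
    by (rule trig_series_derivative[OF n _ _ _ z m1]) (use q in auto)
  moreover have "trig_series n (\<lambda>i. \<i> * freq n i * (\<i> * freq n i * m i)) z =
      (2 * c * cos (2 * z) - (of_nat n ^ 2 + del)) * trig_series n m z"
  proof -
    define e where "e = (\<lambda>i. exp (\<i> * freq n i * z))"
    have S: "((\<lambda>i. m i * e i) has_sum trig_series n m z) UNIV"
      unfolding trig_series_def e_def
      by (rule has_sum_infsum, rule trig_series_approx(1)[OF n q(1) q1, of 1]) (use z dec in auto)
    have bij: "bij_betw (\<lambda>i::int. i + k) UNIV UNIV" for k by (rule bij_betwI[of _ _ _ "\<lambda>i. i - k"]) auto
    have e: "e (i + 1) = exp (2 * \<i> * z) * e i" "e (i + (-1)) = exp (- (2 * \<i> * z)) * e i" for i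
      unfolding e_def freq_def exp_add[symmetric] by (simp_all add: algebra_simps)
    have S1: "((\<lambda>i. m (i + k) * e (i + k)) has_sum trig_series n m z) UNIV" for k
      using has_sum_reindex_bij_betw[OF bij[of k], of "\<lambda>i. m i * e i"] S by blast
    have "((\<lambda>i. c * (exp (2 * \<i> * z) * (m (i + (-1)) * e (i + (-1)))) +
        c * (exp (- (2 * \<i> * z)) * (m (i + 1) * e (i + 1))) - (of_nat n ^ 2 + del) * (m i * e i)) has_sum
       (c * (exp (2 * \<i> * z) * trig_series n m z) + c * (exp (- (2 * \<i> * z)) * trig_series n m z)
         - (of_nat n ^ 2 + del) * trig_series n m z)) UNIV"
      by (intro has_sum_minus has_sum_add has_sum_cmult_right S S1)
    moreover have "c * (exp (2 * \<i> * z) * (m (i + (-1)) * e (i + (-1)))) +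
        c * (exp (- (2 * \<i> * z)) * (m (i + 1) * e (i + 1))) - (of_nat n ^ 2 + del) * (m i * e i)
        = \<i> * freq n i * (\<i> * freq n i * m i) * e i" for i
    proof -
      have ee: "exp (2 * \<i> * z) * e (i + (-1)) = e i" "exp (- (2 * \<i> * z)) * e (i + 1) = e i"
        unfolding e by (simp_all flip: exp_add mult.assoc)
      have "c * (exp (2 * \<i> * z) * (m (i + (-1)) * e (i + (-1)))) +
        c * (exp (- (2 * \<i> * z)) * (m (i + 1) * e (i + 1))) - (of_nat n ^ 2 + del) * (m i * e i)
        = c * m (i - 1) * (exp (2 * \<i> * z) * e (i + (-1))) + c * m (i + 1) * (exp (- (2 * \<i> * z)) * e (i + 1))
         - (of_nat n ^ 2 + del) * (m i * e i)" by (simp add: algebra_simps)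
      also have "\<dots> = (c * (m (i - 1) + m (i + 1)) - (of_nat n ^ 2 + del) * m i) * e i"
        unfolding ee by (simp add: algebra_simps)
      also have "c * (m (i - 1) + m (i + 1)) = diag_coeff n del i * m i" using m by (simp add: mathieu_seq_def)
      also have "diag_coeff n del i * m i - (of_nat n ^ 2 + del) * m i = \<i> * freq n i * (\<i> * freq n i * m i)"
        by (simp add: diag_coeff_def freq_def algebra_simps power2_eq_square)
      finally show ?thesis .
    qed
    ultimately have "((\<lambda>i. \<i> * freq n i * (\<i> * freq n i * m i) * e i) has_sum
       (c * (exp (2 * \<i> * z) * trig_series n m z) + c * (exp (- (2 * \<i> * z)) * trig_series n m z)
         - (of_nat n ^ 2 + del) * trig_series n m z)) UNIV" by simp
    hence "trig_series n (\<lambda>i. \<i> * freq n i * (\<i> * freq n i * m i)) z =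
       c * (exp (2 * \<i> * z) * trig_series n m z) + c * (exp (- (2 * \<i> * z)) * trig_series n m z)
         - (of_nat n ^ 2 + del) * trig_series n m z"
      unfolding trig_series_def e_def by (rule infsumI)
    also have "\<dots> = (2 * c * cos (2 * z) - (of_nat n ^ 2 + del)) * trig_series n m z"
      unfolding cos_exp_eq by (simp add: algebra_simps)
    finally show ?thesis .
  qed
  ultimately show "(trig_series n (\<lambda>i. \<i> * freq n i * m i) has_field_derivative
            (2 * c * cos (2 * z) - (of_nat n ^ 2 + del)) * trig_series n m z) (at z)" by simp
qed

lemma trig_series_shift_pi: "trig_series n m (z + of_real pi) = (-1) ^ n * trig_series n m z"
proof -
  have "exp (\<i> * freq n i * (z + of_real pi)) = (-1) ^ n * exp (\<i> * freq n i * z)" for i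
  proof -
    have "\<i> * freq n i * (z + of_real pi) = \<i> * freq n i * z + (2 * of_int i * of_real pi * \<i> - of_nat n * (of_real pi * \<i>))"
      by (simp add: freq_def algebra_simps)
    hence "exp (\<i> * freq n i * (z + of_real pi)) = exp (\<i> * freq n i * z) * (exp (2 * of_int i * of_real pi * \<i>) / exp (of_nat n * (of_real pi * \<i>)))"
      by (simp only: exp_add exp_diff)
    also have "exp (2 * of_int i * of_real pi * \<i>) = 1"
      unfolding exp_eq_1 by simp
    also have "exp (of_nat n * (of_real pi * \<i>)) = (-1) ^ n" by (simp add: exp_of_nat_mult exp_pi_i)
    finally show ?thesis by (cases "even n") simp_all
  qed
  thus ?thesis
    unfolding trig_series_def by (subst infsum_cmult_right'[symmetric]) (simp add: mult_ac)
qed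

section \<open>Uniqueness of Fourier coefficients\<close>

definition exp_mode :: "int \<Rightarrow> real \<Rightarrow> complex" where
  "exp_mode j x = exp (2 * \<i> * of_int j * of_real x)"

lemma exp_mode_continuous [continuous_intros]: "continuous_on A (exp_mode j)"
  unfolding exp_mode_def by (intro continuous_intros)

lemma exp_mode_add: "exp_mode (j + k) x = exp_mode j x * exp_mode k x"
  by (simp add: exp_mode_def algebra_simps flip: exp_add)

lemma exp_mode_0 [simp]: "exp_mode 0 x = 1" by (simp add: exp_mode_def)

lemma cnj_exp_mode: "cnj (exp_mode j x) = exp_mode (- j) x"
  by (simp add: exp_mode_def exp_cnj)

lemma exp_mode_zero_arg [simp]: "exp_mode j 0 = 1" by (simp add: exp_mode_def)

lemma exp_mode_pi [simp]: "exp_mode j pi = 1"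
  unfolding exp_mode_def exp_eq_1 by simp

lemma exp_mode_integral: "(exp_mode j has_integral (if j = 0 then of_real pi else 0)) {0..pi}"
proof (cases "j = 0")
  case True
  have "((\<lambda>x::real. 1 :: complex) has_integral pi *\<^sub>R 1) {0..pi}"
    using has_integral_const_real[of "1::complex" 0 pi] by simp
  moreover have "exp_mode 0 = (\<lambda>x. 1)" by (rule ext) simp
  ultimately show ?thesis using True by (simp add: scaleR_conv_of_real)
next
  case False
  have "(exp_mode j has_integral (exp (2 * \<i> * of_int j * of_real pi) / (2 * \<i> * of_int j) - exp (2 * \<i> * of_int j * of_real 0) / (2 * \<i> * of_int j))) {0..pi}"
    unfolding exp_mode_def
    by (rule fundamental_theorem_of_calculus[OF pi_ge_zero], rule has_vector_derivative_real_field)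
      (use False in \<open>auto intro!: derivative_eq_intros simp: field_simps\<close>)
  thus ?thesis using False exp_mode_pi[of j] by (simp add: exp_mode_def)
qed

text \<open>By Bessel's inequality infinitely many Fourier coefficients cannot share a nonzero value.\<close>
lemma constant_fourier_coefficients_zero:
  fixes g :: "real \<Rightarrow> complex" and p :: "nat \<Rightarrow> int"
  assumes g: "continuous_on {0..pi} g" and p: "inj p"
    and A: "\<And>j. integral {0..pi} (\<lambda>x. g x * exp_mode (- p j) x) = A"
  shows "A = 0"
proof (rule ccontr)
  assume A0: "A \<noteq> 0"
  define G where "G = integral {0..pi} (\<lambda>x. g x * cnj (g x))"
  have gi: "((\<lambda>x. g x * exp_mode (- p j) x) has_integral A) {0..pi}" for j
    unfolding A[of j, symmetric]
    by (intro integrable_integral integrable_continuous_interval continuous_intros g)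
  have cg: "((\<lambda>x. cnj (g x) * exp_mode (p j) x) has_integral cnj A) {0..pi}" for j
  proof -
    have "((\<lambda>x. cnj (g x * exp_mode (- p j) x)) has_integral cnj A) {0..pi}"
      using has_integral_linear[OF gi[of j] bounded_linear_cnj] by (simp add: o_def)
    thus ?thesis by (simp add: cnj_exp_mode)
  qed
  have bound: "real N * (cmod A)\<^sup>2 \<le> pi * Re G" for N
  proof -
    \<comment> \<open>\<open>T\<close> is the orthogonal projection of \<open>g\<close> to the first \<open>N\<close> modes.\<close>
    define k where "k = A / of_real pi"
    define T where "T = (\<lambda>x. \<Sum>j<N. k * exp_mode (p j) x)"
    have gT: "((\<lambda>x. g x * cnj (T x)) has_integral (\<Sum>j<N. cnj k * A)) {0..pi}"
    proof -
      have "((\<lambda>x. \<Sum>j<N. cnj k * (g x * exp_mode (- p j) x)) has_integral (\<Sum>j<N. cnj k * A)) {0..pi}"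
        by (intro has_integral_sum has_integral_mult_right gi) auto
      thus ?thesis by (simp add: T_def cnj_exp_mode sum_distrib_left mult_ac)
    qed
    have Tg: "((\<lambda>x. cnj (g x) * T x) has_integral (\<Sum>j<N. k * cnj A)) {0..pi}"
    proof -
      have "((\<lambda>x. \<Sum>j<N. k * (cnj (g x) * exp_mode (p j) x)) has_integral (\<Sum>j<N. k * cnj A)) {0..pi}"
        by (intro has_integral_sum has_integral_mult_right cg) auto
      thus ?thesis by (simp add: T_def sum_distrib_left mult_ac)
    qed
    have TT: "((\<lambda>x. T x * cnj (T x)) has_integral (\<Sum>j<N. k * cnj k * of_real pi)) {0..pi}"
    proof -
      have "((\<lambda>x. \<Sum>i<N. \<Sum>j<N. k * cnj k * exp_mode (p i - p j) x) has_integral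
          (\<Sum>i<N. \<Sum>j<N. k * cnj k * (if p i - p j = 0 then of_real pi else 0))) {0..pi}"
        by (intro has_integral_sum has_integral_mult_right exp_mode_integral) auto
      moreover have "(\<Sum>i<N. \<Sum>j<N. k * cnj k * (if p i - p j = 0 then of_real pi else 0)) = (\<Sum>j<N. k * cnj k * of_real pi)"
      proof (rule sum.cong[OF refl])
        fix i assume i: "i \<in> {..<N}"
        have "(\<Sum>j<N. k * cnj k * (if p i - p j = 0 then of_real pi else 0)) = (\<Sum>j<N. if j = i then k * cnj k * of_real pi else 0)"
          using p by (intro sum.cong) (auto dest: injD)
        thus "(\<Sum>j<N. k * cnj k * (if p i - p j = 0 then of_real pi else 0)) = k * cnj k * of_real pi" using i by simp
      qed
      moreover have "(\<Sum>i<N. \<Sum>j<N. k * cnj k * exp_mode (p i - p j) x) = T x * cnj (T x)" for x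
      proof -
        have "exp_mode (p i - p j) x = exp_mode (p i) x * exp_mode (- p j) x" for i j
          using exp_mode_add[of "p i" "- p j" x] by simp
        thus ?thesis by (simp add: T_def cnj_exp_mode sum_product mult_ac)
      qed
      ultimately show ?thesis by simp
    qed
    have gg: "((\<lambda>x. g x * cnj (g x)) has_integral G) {0..pi}"
      unfolding G_def by (intro integrable_integral integrable_continuous_interval continuous_intros g)
    have "((\<lambda>x. g x * cnj (g x) - g x * cnj (T x) - cnj (g x) * T x + T x * cnj (T x)) has_integral
       (G - (\<Sum>j<N. cnj k * A) - (\<Sum>j<N. k * cnj A) + (\<Sum>j<N. k * cnj k * of_real pi))) {0..pi}"
      by (intro has_integral_add has_integral_diff gg gT Tg TT)
    hence "((\<lambda>x. Re (g x * cnj (g x) - g x * cnj (T x) - cnj (g x) * T x + T x * cnj (T x))) has_integral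
       Re (G - (\<Sum>j<N. cnj k * A) - (\<Sum>j<N. k * cnj A) + (\<Sum>j<N. k * cnj k * of_real pi))) {0..pi}"
      by (rule has_integral_linear[OF _ bounded_linear_Re, unfolded o_def])
    moreover have "Re (g x * cnj (g x) - g x * cnj (T x) - cnj (g x) * T x + T x * cnj (T x)) \<ge> 0" for x
    proof -
      have "g x * cnj (g x) - g x * cnj (T x) - cnj (g x) * T x + T x * cnj (T x) = (g x - T x) * cnj (g x - T x)"
        by (simp add: algebra_simps)
      thus ?thesis by (simp add: complex_norm_square[symmetric] del: complex_cnj_diff)
    qed
    ultimately have "0 \<le> Re (G - (\<Sum>j<N. cnj k * A) - (\<Sum>j<N. k * cnj A) + (\<Sum>j<N. k * cnj k * of_real pi))"
      by (rule has_integral_nonneg) 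
    also have "(\<Sum>j<N. cnj k * A) = of_real (N * (cmod A)\<^sup>2 / pi)"
      by (simp add: k_def complex_norm_square mult_ac del: of_real_power)
    also have "(\<Sum>j<N. k * cnj A) = of_real (N * (cmod A)\<^sup>2 / pi)"
      by (simp add: k_def complex_norm_square mult_ac del: of_real_power)
    also have "(\<Sum>j<N. k * cnj k * of_real pi) = of_real (N * (cmod A)\<^sup>2 / pi)"
      by (simp add: k_def complex_norm_square mult_ac del: of_real_power)
    finally have "N * (cmod A)\<^sup>2 / pi \<le> Re G" by simp
    thus ?thesis by (simp add: field_simps)
  qed
  obtain N :: nat where "pi * Re G / (cmod A)\<^sup>2 < real N" using reals_Archimedean2 by blast
  hence "pi * Re G < real N * (cmod A)\<^sup>2" using A0 by (simp add: field_simps)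
  with bound[of N] show False by simp
qed

lemma has_vector_derivative_quotient:
  fixes f :: "real \<Rightarrow> complex"
  assumes "(f has_vector_derivative d) (at s within S)"
  shows "((\<lambda>x. (f x - f s) / of_real (x - s)) \<longlongrightarrow> d) (at s within S)"
proof -
  have 1: "((\<lambda>x. norm ((f x - f s) - (x - s) *\<^sub>R d) / norm (x - s)) \<longlongrightarrow> 0) (at s within S)"
    using assms unfolding has_vector_derivative_def has_derivative_iff_norm by blast
  have "norm ((f x - f s) - (x - s) *\<^sub>R d) / norm (x - s) = norm ((f x - f s) / of_real (x - s) - d)" if "x \<noteq> s" for x
  proof -
    define h where "h = complex_of_real (x - s)"
    have h: "h \<noteq> 0" "norm (x - s) = norm h" "(x - s) *\<^sub>R d = h * d"
      using that unfolding h_def by (simp_all add: scaleR_conv_of_real del: of_real_diff)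
    have "(f x - f s) / h - d = ((f x - f s) - h * d) / h" using h(1) by (simp add: diff_divide_distrib)
    thus ?thesis unfolding h_def[symmetric] h(2,3) by (simp only: norm_divide)
  qed
  hence "\<forall>\<^sub>F x in at s within S.
      norm ((f x - f s) - (x - s) *\<^sub>R d) / norm (x - s) = norm ((f x - f s) / of_real (x - s) - d)"
    unfolding eventually_at_filter by (intro always_eventually) blast
  from tendsto_norm_zero_cancel[OF Lim_transform_eventually[OF 1 this]]
  show ?thesis by (rule LIM_zero_cancel)
qed

text \<open>
  If all coefficients of \<open>f\<close> vanish, then the coefficients of \<open>(f - f 0) / (exp (2 i x) - 1)\<close> are
  constant on the nonnegative and on the negative indices, with a jump proportional to \<open>f 0\<close>.
\<close>
lemma zero_fourier_coefficients_imp_zero_at_0: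
  fixes f :: "real \<Rightarrow> complex"
  assumes f: "continuous_on {0..pi} f" and fpi: "f pi = f 0"
    and d0: "(f has_vector_derivative a) (at 0 within {0..pi})"
    and dpi: "(f has_vector_derivative b) (at pi within {0..pi})"
    and z: "\<And>j. integral {0..pi} (\<lambda>x. f x * exp_mode j x) = 0"
  shows "f 0 = 0"
proof -
  \<comment> \<open>The one-sided derivatives at the end points extend the quotient continuously to the closed interval.\<close>
  define g where "g = (\<lambda>x. if x = 0 then a / (2 * \<i>) else if x = pi then b / (2 * \<i>) else (f x - f 0) / (exp_mode 1 x - 1))"
  have e1: "exp_mode 1 x \<noteq> 1" if "0 < x" "x < pi" for x
  proof
    assume "exp_mode 1 x = 1"
    then obtain k :: int where k: "2 * x = of_int (2 * k) * pi" unfolding exp_mode_def exp_eq_1 by auto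
    hence "x = of_int k * pi" by simp
    with that have "0 < k" "k < 1" by (auto simp: zero_less_mult_iff)
    thus False by linarith
  qed
  have endpoint: "((\<lambda>x. (f x - f 0) / (exp_mode 1 x - 1)) \<longlongrightarrow> d / (2 * \<i>)) (at s within {0..pi})"
    if d: "(f has_vector_derivative d) (at s within {0..pi})" and s: "s = 0 \<or> s = pi" for d s
  proof -
    have fs: "f s = f 0" "exp_mode 1 s = 1" using s fpi by auto
    have ed: "(exp_mode 1 has_vector_derivative 2 * \<i>) (at s within {0..pi})"
    proof -
      have "((\<lambda>x. exp (2 * \<i> * complex_of_real x)) has_vector_derivative exp (2 * \<i> * of_real s) * (2 * \<i>)) (at s within {0..pi})"
        by (rule has_vector_derivative_real_field) (auto intro!: derivative_eq_intros)
      thus ?thesis using fs(2) by (simp add: exp_mode_def[abs_def])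
    qed
    have e: "((\<lambda>x. (exp_mode 1 x - 1) / of_real (x - s)) \<longlongrightarrow> 2 * \<i>) (at s within {0..pi})"
      using has_vector_derivative_quotient[OF ed] unfolding fs(2) .
    have f': "((\<lambda>x. (f x - f 0) / of_real (x - s)) \<longlongrightarrow> d) (at s within {0..pi})"
      using has_vector_derivative_quotient[OF d] unfolding fs(1) .
    have "((\<lambda>x. ((f x - f 0) / of_real (x - s)) / ((exp_mode 1 x - 1) / of_real (x - s))) \<longlongrightarrow> d / (2 * \<i>)) (at s within {0..pi})"
      by (intro tendsto_divide e f') auto
    moreover have "\<forall>\<^sub>F x in at s within {0..pi}. ((f x - f 0) / of_real (x - s)) / ((exp_mode 1 x - 1) / of_real (x - s)) = (f x - f 0) / (exp_mode 1 x - 1)"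
    proof -
      have "((f x - f 0) / h) / ((exp_mode 1 x - 1) / h) = (f x - f 0) / (exp_mode 1 x - 1)" if "h \<noteq> 0" for x and h :: complex
        using that by simp
      moreover have "x \<noteq> s \<Longrightarrow> complex_of_real (x - s) \<noteq> 0" for x by simp
      ultimately show ?thesis unfolding eventually_at_filter by (intro always_eventually) blast
    qed
    ultimately show ?thesis by (rule Lim_transform_eventually)
  qed
  have gc: "continuous_on {0..pi} g"
    unfolding continuous_on_def
  proof
    fix s assume s: "s \<in> {0..pi}"
    let ?h = "\<lambda>x. (f x - f 0) / (exp_mode 1 x - 1)"
    have ev: "\<forall>\<^sub>F x in at s within {0..pi}. ?h x = g x"
    proof -
      have "\<forall>\<^sub>F x in at s within {0..pi}. x \<notin> {0, pi}"
      proof -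
        have "\<forall>\<^sub>F x in at s within {0..pi}. x \<noteq> 0" "\<forall>\<^sub>F x in at s within {0..pi}. x \<noteq> pi"
          by (rule eventually_neq_at_within)+
        thus ?thesis by eventually_elim auto
      qed
      thus ?thesis by eventually_elim (auto simp: g_def)
    qed
    have "(?h \<longlongrightarrow> g s) (at s within {0..pi})"
    proof (cases "s = 0 \<or> s = pi")
      case True
      thus ?thesis using endpoint[OF d0] endpoint[OF dpi] by (auto simp: g_def)
    next
      case False
      hence "exp_mode 1 s - 1 \<noteq> 0" using e1[of s] s by auto
      moreover have "(f \<longlongrightarrow> f s) (at s within {0..pi})" "(exp_mode 1 \<longlongrightarrow> exp_mode 1 s) (at s within {0..pi})"
        using f exp_mode_continuous[of "{0..pi}" 1] s by (auto simp: continuous_on_def)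
      ultimately show ?thesis using False by (auto simp: g_def intro!: tendsto_intros)
    qed
    thus "(g \<longlongrightarrow> g s) (at s within {0..pi})" by (rule Lim_transform_eventually[OF _ ev])
  qed
  define c where "c = (\<lambda>j. integral {0..pi} (\<lambda>x. g x * exp_mode (- j) x))"
  have ci: "((\<lambda>x. g x * exp_mode (- j) x) has_integral c j) {0..pi}" for j
    unfolding c_def by (intro integrable_integral integrable_continuous_interval continuous_intros gc)
  have rel: "c (j - 1) - c j = (if j = 0 then - f 0 * of_real pi else 0)" for j
  proof -
    have fI: "((\<lambda>x. f x * exp_mode (- j) x - f 0 * exp_mode (- j) x) has_integral (0 - f 0 * (if - j = 0 then of_real pi else 0))) {0..pi}"
    proof (intro has_integral_diff has_integral_mult_right exp_mode_integral)
      have "(\<lambda>x. f x * exp_mode (- j) x) integrable_on {0..pi}"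
        by (intro integrable_continuous_interval continuous_intros f)
      from integrable_integral[OF this]
      show "((\<lambda>x. f x * exp_mode (- j) x) has_integral 0) {0..pi}" unfolding z[of "- j"] .
    qed
    have gI: "((\<lambda>x. g x * exp_mode (- (j - 1)) x - g x * exp_mode (- j) x) has_integral (c (j - 1) - c j)) {0..pi}"
      by (intro has_integral_diff ci)
    have eq: "g x * exp_mode (- (j - 1)) x - g x * exp_mode (- j) x = f x * exp_mode (- j) x - f 0 * exp_mode (- j) x"
      if x: "x \<in> {0..pi}" for x
    proof -
      have "exp_mode (- (j - 1)) x = exp_mode 1 x * exp_mode (- j) x" using exp_mode_add[of 1 "- j" x] by simp
      hence "g x * exp_mode (- (j - 1)) x - g x * exp_mode (- j) x = (g x * (exp_mode 1 x - 1)) * exp_mode (- j) x"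
        by (simp add: algebra_simps)
      also have "g x * (exp_mode 1 x - 1) = f x - f 0"
        using e1[of x] x fpi by (auto simp: g_def)
      finally show ?thesis by (simp add: algebra_simps)
    qed
    have "((\<lambda>x. f x * exp_mode (- j) x - f 0 * exp_mode (- j) x) has_integral (c (j - 1) - c j)) {0..pi}"
      by (rule has_integral_eq[OF eq gI])
    hence "c (j - 1) - c j = 0 - f 0 * (if - j = 0 then of_real pi else 0)"
      by (rule has_integral_unique[OF _ fI])
    thus ?thesis by simp
  qed
  have c1: "c (int k) = c 0" for k
  proof (induction k)
    case (Suc k)
    thus ?case using rel[of "int (Suc k)"] by simp
  qed simp
  have c2: "c (- 1 - int k) = c (- 1)" for k
  proof (induction k)
    case (Suc k)
    have "- 1 - int (Suc k) = (- 1 - int k) - 1" by simp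
    thus ?case using Suc rel[of "- 1 - int k"] by simp
  qed simp
  have "c 0 = 0"
    by (rule constant_fourier_coefficients_zero[OF gc, of int]) (use c1 in \<open>auto simp: c_def\<close>)
  moreover have "c (- 1) = 0"
    by (rule constant_fourier_coefficients_zero[OF gc, of "\<lambda>k. - 1 - int k"])
      (use c2 in \<open>auto simp: c_def inj_def\<close>)
  ultimately show ?thesis using rel[of 0] by simp
qed

section \<open>Fourier coefficients of periodic and antiperiodic solutions\<close>

definition fourier_coeff :: "nat \<Rightarrow> (real \<Rightarrow> complex) \<Rightarrow> int \<Rightarrow> complex" where
  "fourier_coeff n y i = integral {0..pi} (\<lambda>x. y x * exp (- (\<i> * freq n i * of_real x)))"

text \<open>
  Periodic conditions for even \<open>n\<close> and antiperiodic conditions for odd \<open>n\<close>.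
\<close>
definition floquet :: "nat \<Rightarrow> (real \<Rightarrow> complex) \<Rightarrow> (real \<Rightarrow> complex) \<Rightarrow> bool" where
  "floquet n y y1 \<longleftrightarrow> y pi = (-1) ^ n * y 0 \<and> y1 pi = (-1) ^ n * y1 0"

lemma exp_freq_pi: "exp (- (\<i> * freq n i * of_real pi)) = (-1) ^ n"
proof -
  have "- (\<i> * freq n i * of_real pi) = of_nat n * (of_real pi * \<i>) - 2 * of_int i * of_real pi * \<i>"
    by (simp add: freq_def algebra_simps)
  hence "exp (- (\<i> * freq n i * of_real pi)) = exp (of_nat n * (of_real pi * \<i>)) / exp (2 * of_int i * of_real pi * \<i>)"
    by (simp only: exp_diff)
  also have "exp (2 * of_int i * of_real pi * \<i>) = 1" unfolding exp_eq_1 by simp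
  also have "exp (of_nat n * (of_real pi * \<i>)) = (-1) ^ n" by (simp add: exp_of_nat_mult exp_pi_i)
  finally show ?thesis by simp
qed

lemma twice_deriv_exp_freq:
  "twice_deriv (\<lambda>x. exp (- (\<i> * freq n i * of_real x))) (\<lambda>x. - (\<i> * freq n i) * exp (- (\<i> * freq n i * of_real x)))
     (\<lambda>x. - (freq n i)\<^sup>2 * exp (- (\<i> * freq n i * of_real x)))"
  by (rule twice_deriv_complex) (auto intro!: derivative_eq_intros simp: power2_eq_square algebra_simps)

lemma fourier_coeff_has_integral:
  assumes "continuous_on {0..pi} y"
  shows "((\<lambda>x. y x * exp (- (\<i> * freq n i * of_real x))) has_integral fourier_coeff n y i) {0..pi}"
  unfolding fourier_coeff_def
  by (intro integrable_integral integrable_continuous_interval continuous_intros assms)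

lemma norm_fourier_coeff_le:
  assumes "continuous_on {0..pi} y" "\<And>x. x \<in> {0..pi} \<Longrightarrow> cmod (y x) \<le> Y"
  shows "cmod (fourier_coeff n y i) \<le> pi * Y"
proof (rule integral_norm_bound_pi[OF fourier_coeff_has_integral[OF assms(1)]])
  fix x assume x: "x \<in> {0..pi}"
  have e: "cmod (exp (- (\<i> * freq n i * of_real x))) = 1" by (simp add: norm_exp_eq_Re freq_def)
  show "cmod (y x * exp (- (\<i> * freq n i * of_real x))) \<le> Y" unfolding norm_mult e using assms(2)[OF x] by simp
qed

text \<open>
  Green's identity against an exponential satisfying the same boundary conditions has no boundary
  terms. The inhomogeneity \<open>g\<close> serves the analysis of generalized eigenfunctions.
\<close>
lemma fourier_coeff_recurrence:
  assumes y: "twice_deriv y y1 y2" and g: "continuous_on {0..pi} g"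
    and eq: "\<And>x. x \<in> {0..pi} \<Longrightarrow> y2 x = (two_exp_potential a b x - (of_nat n ^ 2 + del)) * y x - g x"
    and bc: "floquet n y y1"
  shows "diag_coeff n del i * fourier_coeff n y i = a * fourier_coeff n y (i + 1) + b * fourier_coeff n y (i - 1) - fourier_coeff n g i"
proof -
  define e where "e = (\<lambda>i x. exp (- (\<i> * freq n i * complex_of_real x)))"
  have yc: "continuous_on {0..pi} y" by (rule twice_deriv_continuous(1)[OF y])
  note G = green_identity[OF y twice_deriv_exp_freq[of n i], of pi]
  have e0: "e i 0 = 1" and epi: "e i pi = (-1) ^ n" by (simp_all add: e_def exp_freq_pi)
  have "((\<lambda>x. y x * (- (freq n i)\<^sup>2 * e i x) - y2 x * e i x) has_integral
      ((y pi * (- (\<i> * freq n i) * e i pi) - y1 pi * e i pi) - (y 0 * (- (\<i> * freq n i) * e i 0) - y1 0 * e i 0))) {0..pi}"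
    using G unfolding e_def by simp
  moreover have "(y pi * (- (\<i> * freq n i) * e i pi) - y1 pi * e i pi) - (y 0 * (- (\<i> * freq n i) * e i 0) - y1 0 * e i 0) = 0"
    using bc unfolding floquet_def e0 epi by (cases "even n") simp_all
  ultimately have 1: "((\<lambda>x. y x * (- (freq n i)\<^sup>2 * e i x) - y2 x * e i x) has_integral 0) {0..pi}" by simp
  have 2: "((\<lambda>x. diag_coeff n del i * (y x * e i x) - a * (y x * e (i + 1) x) - b * (y x * e (i - 1) x) + g x * e i x) has_integral
      (diag_coeff n del i * fourier_coeff n y i - a * fourier_coeff n y (i + 1) - b * fourier_coeff n y (i - 1) + fourier_coeff n g i)) {0..pi}"
    unfolding e_def by (intro has_integral_add has_integral_diff has_integral_mult_right fourier_coeff_has_integral yc g)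
  have fe: "y x * (- (freq n i)\<^sup>2 * e i x) - y2 x * e i x =
      diag_coeff n del i * (y x * e i x) - a * (y x * e (i + 1) x) - b * (y x * e (i - 1) x) + g x * e i x"
    if x: "x \<in> {0..pi}" for x
  proof -
    have e1: "e (i + 1) x = exp (- 2 * \<i> * of_real x) * e i x" "e (i - 1) x = exp (2 * \<i> * of_real x) * e i x"
      unfolding e_def freq_def exp_add[symmetric] by (simp_all add: algebra_simps)
    have d: "diag_coeff n del i = (of_nat n ^ 2 + del) - (freq n i)\<^sup>2"
      by (simp add: diag_coeff_def freq_def algebra_simps power2_eq_square)
    show ?thesis unfolding eq[OF x] e1 d two_exp_potential_def by (simp add: algebra_simps)
  qed
  have "diag_coeff n del i * fourier_coeff n y i - a * fourier_coeff n y (i + 1) - b * fourier_coeff n y (i - 1) + fourier_coeff n g i = 0"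
    by (rule has_integral_unique[OF 2 has_integral_eq[OF fe 1]])
  thus ?thesis by (simp add: algebra_simps)
qed

text \<open>
  Multiplication by \<open>exp (i n x)\<close> turns both kinds of boundary conditions into periodicity.
\<close>
lemma zero_coefficients_imp_zero_value:
  assumes y: "continuous_on {0..pi} y" "\<And>x. x \<in> {0..pi} \<Longrightarrow> (y has_vector_derivative y1 x) (at x within {0..pi})"
    and bc: "y pi = (-1) ^ n * y 0" and z: "\<And>i. fourier_coeff n y i = 0"
  shows "y 0 = 0"
proof -
  define f where "f = (\<lambda>x. y x * exp (\<i> * of_nat n * complex_of_real x))"
  have ed: "((\<lambda>x. exp (\<i> * of_nat n * complex_of_real x)) has_vector_derivative (exp (\<i> * of_nat n * of_real s) * (\<i> * of_nat n))) (at s within {0..pi})" for s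
    by (rule has_vector_derivative_real_field) (auto intro!: derivative_eq_intros)
  note fd = has_vector_derivative_mult[OF y(2) ed]
  have "exp (\<i> * of_nat n * of_real pi) = (-1) ^ n"
    by (metis exp_of_nat_mult exp_pi_i mult.assoc mult.commute)
  hence fpi: "f pi = f 0" using bc by (cases "even n") (auto simp: f_def)
  have "f 0 = 0"
  proof (rule zero_fourier_coefficients_imp_zero_at_0[OF _ fpi])
    show "continuous_on {0..pi} f" unfolding f_def by (intro continuous_intros y)
    show "(f has_vector_derivative (y 0 * (exp (\<i> * of_nat n * of_real 0) * (\<i> * of_nat n)) + y1 0 * exp (\<i> * of_nat n * of_real 0))) (at 0 within {0..pi})"
      unfolding f_def by (rule fd) simp
    show "(f has_vector_derivative (y pi * (exp (\<i> * of_nat n * of_real pi) * (\<i> * of_nat n)) + y1 pi * exp (\<i> * of_nat n * of_real pi))) (at pi within {0..pi})"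
      unfolding f_def by (rule fd) simp
    fix j
    have "f x * exp_mode j x = y x * exp (- (\<i> * freq n (- j) * of_real x))" for x
      unfolding f_def exp_mode_def freq_def mult.assoc exp_add[symmetric] by (simp add: algebra_simps)
    thus "integral {0..pi} (\<lambda>x. f x * exp_mode j x) = 0" using z[of "- j"] by (simp add: fourier_coeff_def)
  qed
  thus ?thesis by (simp add: f_def)
qed

text \<open>
  The coefficients of the derivative are multiples of those of the function, so both initial values vanish.
  For solutions of the Hill equation this amounts to completeness of the exponentials.
\<close>
lemma zero_coefficients_imp_zero_initial:
  assumes y: "twice_deriv y y1 y2" and bc: "floquet n y y1" and z: "\<And>i. fourier_coeff n y i = 0"
  shows "y 0 = 0" "y1 0 = 0"
proof -
  note c = twice_deriv_continuous[OF y]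
  have d: "(y has_vector_derivative y1 x) (at x within {0..pi})"
    "(y1 has_vector_derivative y2 x) (at x within {0..pi})" if "x \<in> {0..pi}" for x
    using y that by (auto simp: twice_deriv_def)
  show "y 0 = 0" by (rule zero_coefficients_imp_zero_value[OF c(1) d(1) _ z]) (use bc in \<open>auto simp: floquet_def\<close>)
  have z1: "fourier_coeff n y1 i = 0" for i
  proof -
    let ?e = "\<lambda>x. exp (- (\<i> * freq n i * complex_of_real x))"
    have ed: "(?e has_vector_derivative - (\<i> * freq n i) * ?e x) (at x within {0..pi})" if "x \<in> {0..pi}" for x
      using twice_deriv_exp_freq[of n i] that by (simp add: twice_deriv_def)
    have 1: "((\<lambda>x. y x * (- (\<i> * freq n i) * ?e x) + y1 x * ?e x) has_integral (y pi * ?e pi - y 0 * ?e 0)) {0..pi}"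
      by (rule fundamental_theorem_of_calculus[OF pi_ge_zero has_vector_derivative_mult[OF d(1) ed]]) auto
    have "y pi * ?e pi - y 0 * ?e 0 = 0" using bc unfolding floquet_def exp_freq_pi by (cases "even n") simp_all
    with 1 have "((\<lambda>x. y x * (- (\<i> * freq n i) * ?e x) + y1 x * ?e x) has_integral 0) {0..pi}" by simp
    hence 0: "((\<lambda>x. - (\<i> * freq n i) * (y x * ?e x) + y1 x * ?e x) has_integral 0) {0..pi}"
      by (simp only: mult.left_commute[of "y _"])
    have "((\<lambda>x. - (\<i> * freq n i) * (y x * ?e x) + y1 x * ?e x) has_integral (- (\<i> * freq n i) * fourier_coeff n y i + fourier_coeff n y1 i)) {0..pi}"
      by (intro has_integral_add has_integral_mult_right fourier_coeff_has_integral c)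
    from has_integral_unique[OF this 0] have "- (\<i> * freq n i) * fourier_coeff n y i + fourier_coeff n y1 i = 0" .
    thus ?thesis using z by simp
  qed
  show "y1 0 = 0" by (rule zero_coefficients_imp_zero_value[OF c(2) d(2) _ z1]) (use bc in \<open>auto simp: floquet_def\<close>)
qed

section \<open>Bounded solutions of the recurrence\<close>

text \<open>
  A bounded solution vanishes if its resonant entries do, and its symmetry leaves only one of them free.
\<close>
lemma symmetric_bounded_solution:
  assumes A: "mathieu_seq c n dA A" "A (int n) = 1" "A 0 = sg" "\<And>i. cmod (A i) \<le> q ^ res_dist n i"
    and W: "mathieu_seq c n del W" "W 0 = sg * W (int n)" "\<And>i. cmod (W i) \<le> K"
    and sg: "sg * sg = 1" "cmod sg = 1" and n: "n \<ge> 2" "cmod del \<le> real n / 4"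
    and q: "q = 2 * cmod c / n" "q \<le> 1 / 4"
  shows "(\<forall>i. W i = 0) \<or> del = dA \<and> (\<forall>i. W i = W (int n) * A i)"
proof (cases "W (int n) = 0")
  case True
  have "cmod (W i) \<le> 0 * (2 * cmod c / n) ^ res_dist n i" for i
    by (rule mathieu_seq_decay[OF W(1) n _ W(3)]) (use True W q in auto)
  thus ?thesis by simp
next
  case False
  define k where "k = W (int n)"
  define X where "X = (\<lambda>i. W i / k)"
  have k: "k \<noteq> 0" using False by (simp add: k_def)
  have q0: "0 \<le> q" using q by simp
  have X: "mathieu_seq c n del X"
    unfolding mathieu_seq_def
  proof
    fix i
    have 1: "diag_coeff n del i * W i = c * (W (i - 1) + W (i + 1))" using W(1) by (simp add: mathieu_seq_def)
    have "c * (X (i - 1) + X (i + 1)) = (c * (W (i - 1) + W (i + 1))) / k"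
      by (simp add: X_def add_divide_distrib distrib_left)
    also have "\<dots> = diag_coeff n del i * X i" unfolding 1[symmetric] by (simp add: X_def)
    finally show "diag_coeff n del i * X i = c * (X (i - 1) + X (i + 1))" by simp
  qed
  have X1: "X (int n) = 1" "X 0 = sg" using W(2) k by (auto simp: X_def k_def)
  have Xb: "cmod (X i) \<le> K / cmod k" for i
    unfolding X_def norm_divide by (rule divide_right_mono[OF W(3)]) simp
  have Xd: "cmod (X i) \<le> q ^ res_dist n i" for i
  proof -
    have "cmod (X i) \<le> 1 * (2 * cmod c / n) ^ res_dist n i"
      by (rule mathieu_seq_decay[OF X n _ Xb]) (use X1 sg(2) q in simp_all)
    thus ?thesis unfolding q(1) by simp
  qed
  have eq: "dA = del"
    by (rule mathieu_parameter_unique(1)[OF A X X1 Xd sg(1) _ q0 q(2)]) (use n in auto)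
  have XA: "X i = A i" for i
  proof -
    have D: "mathieu_seq c n del (\<lambda>i. X i - A i)"
      using X A(1) unfolding eq mathieu_seq_def by (simp add: algebra_simps)
    have b: "q ^ res_dist n j \<le> 1" for j using q0 q(2) by (intro power_le_one) auto
    have "cmod (X i - A i) \<le> 0 * (2 * cmod c / n) ^ res_dist n i"
    proof (rule mathieu_seq_decay[OF D n, of 2])
      show "cmod (X j - A j) \<le> 2" for j
        using norm_triangle_ineq4[of "X j" "A j"] Xd[of j] A(4)[of j] b[of j] by linarith
    qed (use q X1 A(2,3) in simp_all)
    thus ?thesis by simp
  qed
  have "W i = W (int n) * A i" for i
    unfolding k_def[symmetric] XA[of i, symmetric] using k by (simp add: X_def)
  thus ?thesis using eq by blast
qed

text \<open>
  Reflection \<open>i \<mapsto> n - i\<close> preserves the recurrence, so the symmetric and the antisymmetric part of a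
  solution can be treated separately.
\<close>
lemma bounded_solution_classification:
  assumes A: "mathieu_seq c n dA A" "A (int n) = 1" "A 0 = sg" "\<And>i. cmod (A i) \<le> q ^ res_dist n i"
    and B: "mathieu_seq c n dB B" "B (int n) = 1" "B 0 = - sg" "\<And>i. cmod (B i) \<le> q ^ res_dist n i"
    and U: "mathieu_seq c n del U" "\<And>i. cmod (U i) \<le> K"
    and sg: "sg * sg = 1" "cmod sg = 1" and n: "n \<ge> 2" "cmod del \<le> real n / 4"
    and q: "q = 2 * cmod c / n" "q \<le> 1 / 4"
  shows "(\<forall>i. U i = 0) \<or> del = dA \<or> del = dB" and "del = dA \<Longrightarrow> dA \<noteq> dB \<Longrightarrow> \<exists>k. \<forall>i. U i = k * A i"
proof -
  define E where "E = (\<lambda>s i. U i + s * U (int n - i))"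
  have Em: "mathieu_seq c n del (E s)" for s
    unfolding mathieu_seq_def
  proof
    fix i
    have d: "diag_coeff n del (int n - i) = diag_coeff n del i" unfolding diag_coeff_def by (simp add: mult.commute)
    have "diag_coeff n del i * U i = c * (U (i - 1) + U (i + 1))" using U(1) by (simp add: mathieu_seq_def)
    moreover have "diag_coeff n del i * U (int n - i) = c * (U (int n - (i + 1)) + U (int n - (i - 1)))"
    proof -
      have "diag_coeff n del (int n - i) * U (int n - i) = c * (U (int n - i - 1) + U (int n - i + 1))"
        using U(1) by (simp add: mathieu_seq_def)
      moreover have "int n - i - 1 = int n - (i + 1)" "int n - i + 1 = int n - (i - 1)" by simp_all
      ultimately show ?thesis unfolding d by simp
    qed
    moreover have "diag_coeff n del i * E s i = diag_coeff n del i * U i + s * (diag_coeff n del i * U (int n - i))"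
      by (simp add: E_def algebra_simps)
    ultimately show "diag_coeff n del i * E s i = c * (E s (i - 1) + E s (i + 1))"
      by (simp add: E_def algebra_simps)
  qed
  have Eb: "cmod (E s i) \<le> K + K" if "cmod s = 1" for s i
    unfolding E_def using norm_triangle_ineq[of "U i" "s * U (int n - i)"] U(2)[of i] U(2)[of "int n - i"] that
    by (simp add: norm_mult)
  have E0: "E s 0 = s * E s (int n)" if "s * s = 1" for s
  proof -
    have "s * E s (int n) = s * U (int n) + (s * s) * U 0" by (simp add: E_def algebra_simps)
    thus ?thesis using that by (simp add: E_def)
  qed
  have msg: "- sg * - sg = 1" "cmod (- sg) = 1" using sg by auto
  note 1 = symmetric_bounded_solution[OF A Em E0[OF sg(1)] Eb[OF sg(2)] sg n q]
  note 2 = symmetric_bounded_solution[OF B Em E0[OF msg(1)] Eb[OF msg(2)] msg n q]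
  have U2: "U i = (E sg i + E (- sg) i) / 2" for i by (simp add: E_def)
  show "(\<forall>i. U i = 0) \<or> del = dA \<or> del = dB"
  proof (cases "del = dA \<or> del = dB")
    case False
    hence "\<forall>i. E sg i = 0" "\<forall>i. E (- sg) i = 0" using 1 2 by blast+
    thus ?thesis using U2 by simp
  qed blast
  show "\<exists>k. \<forall>i. U i = k * A i" if "del = dA" "dA \<noteq> dB"
  proof -
    have z: "E (- sg) i = 0" for i using 2 that by blast
    have "\<exists>k. \<forall>i. E sg i = k * A i"
    proof (cases "\<forall>i. E sg i = 0")
      case True
      thus ?thesis by (intro exI[of _ 0]) simp
    next
      case False
      thus ?thesis using 1 by blast
    qed
    then obtain k where "\<And>i. E sg i = k * A i" by blast
    hence "U i = (k / 2) * A i" for i using U2[of i] z by simp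
    thus ?thesis by blast
  qed
qed

section \<open>The complex translation to a Mathieu equation\<close>

text \<open>
  A Mathieu function on the complex segment from \<open>t\<close> to \<open>t + pi\<close>.
\<close>
definition mathieu_fun :: "nat \<Rightarrow> complex \<Rightarrow> (int \<Rightarrow> complex) \<Rightarrow> real \<Rightarrow> complex" where
  "mathieu_fun n t m x = trig_series n m (of_real x + t)"

definition mathieu_fun_deriv :: "nat \<Rightarrow> complex \<Rightarrow> (int \<Rightarrow> complex) \<Rightarrow> real \<Rightarrow> complex" where
  "mathieu_fun_deriv n t m x = trig_series n (\<lambda>i. \<i> * freq n i * m i) (of_real x + t)"

text \<open>
  The Fourier coefficients of the function \<open>z \<mapsto> y (z - t)\<close>, without presupposing that \<open>y\<close>
  extends to complex arguments.
\<close>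
definition shifted_coeff :: "nat \<Rightarrow> complex \<Rightarrow> (real \<Rightarrow> complex) \<Rightarrow> int \<Rightarrow> complex" where
  "shifted_coeff n t y i = exp (- (\<i> * freq n i * t)) * fourier_coeff n y i"

lemma shifted_coeff_growth:
  assumes y: "continuous_on {0..pi} y" "\<And>x. x \<in> {0..pi} \<Longrightarrow> cmod (y x) \<le> Y" and t: "\<bar>Im t\<bar> \<le> rho"
  shows "cmod (shifted_coeff n t y i) \<le> (exp (n * rho) * (pi * Y)) * exp (2 * rho) ^ res_dist n i"
proof -
  have "cmod (shifted_coeff n t y i) \<le> (exp (n * rho) * exp (2 * rho) ^ res_dist n i) * (pi * Y)"
    unfolding shifted_coeff_def norm_mult
    using norm_exp_freq_le[of "- t" rho n i] t norm_fourier_coeff_le[OF y, of n i]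
    by (intro mult_mono) auto
  thus ?thesis by (simp add: mult_ac)
qed

locale shifted_mathieu =
  fixes a b c t :: complex
  assumes c0: "c \<noteq> 0" and a: "a = c * exp (- (2 * \<i> * t))" and b: "b = c * exp (2 * \<i> * t)"
begin

abbreviation "v \<equiv> two_exp_potential a b"

lemma potential_shift: "v x = 2 * c * cos (2 * (of_real x + t))"
proof -
  have "v x = c * (exp (- (2 * \<i> * t)) * exp (- 2 * \<i> * of_real x) + exp (2 * \<i> * t) * exp (2 * \<i> * of_real x))"
    unfolding two_exp_potential_def a b by (simp add: algebra_simps)
  also have "exp (- (2 * \<i> * t)) * exp (- 2 * \<i> * of_real x) = exp (- (\<i> * (2 * (of_real x + t))))"
    unfolding exp_add[symmetric] by (simp add: algebra_simps)
  also have "exp (2 * \<i> * t) * exp (2 * \<i> * of_real x) = exp (\<i> * (2 * (of_real x + t)))"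
    unfolding exp_add[symmetric] by (simp add: algebra_simps)
  finally show ?thesis unfolding cos_exp_eq by (simp add: algebra_simps)
qed

sublocale bounded_potential v "cmod a + cmod b"
proof
  show "continuous_on {0..pi} v" unfolding two_exp_potential_def[abs_def] by (intro continuous_intros)
  show "cmod (v x) \<le> cmod a + cmod b" for x
    unfolding two_exp_potential_def
    by (rule norm_triangle_le) (simp add: norm_mult norm_exp_eq_Re)
qed

lemma shifted_coeff_recurrence:
  assumes y: "twice_deriv y y1 y2" and g: "continuous_on {0..pi} g"
    and eq: "\<And>x. x \<in> {0..pi} \<Longrightarrow> y2 x = (v x - (of_nat n ^ 2 + del)) * y x - g x"
    and bc: "floquet n y y1"
  shows "diag_coeff n del i * shifted_coeff n t y i = c * (shifted_coeff n t y (i - 1) + shifted_coeff n t y (i + 1)) - shifted_coeff n t g i"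
proof -
  have e: "exp (- (\<i> * freq n i * t)) * a = c * exp (- (\<i> * freq n (i + 1) * t))"
    "exp (- (\<i> * freq n i * t)) * b = c * exp (- (\<i> * freq n (i - 1) * t))"
  proof -
    have "exp (- (\<i> * freq n (i + 1) * t)) = exp (- (\<i> * freq n i * t)) * exp (- (2 * \<i> * t))"
      "exp (- (\<i> * freq n (i - 1) * t)) = exp (- (\<i> * freq n i * t)) * exp (2 * \<i> * t)"
      unfolding exp_add[symmetric] freq_def by (simp_all add: algebra_simps)
    thus "exp (- (\<i> * freq n i * t)) * a = c * exp (- (\<i> * freq n (i + 1) * t))"
      "exp (- (\<i> * freq n i * t)) * b = c * exp (- (\<i> * freq n (i - 1) * t))"
      unfolding a b by simp_all
  qed
  have "diag_coeff n del i * shifted_coeff n t y i = exp (- (\<i> * freq n i * t)) * (diag_coeff n del i * fourier_coeff n y i)"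
    by (simp add: shifted_coeff_def)
  also have "\<dots> = exp (- (\<i> * freq n i * t)) * (a * fourier_coeff n y (i + 1) + b * fourier_coeff n y (i - 1) - fourier_coeff n g i)"
    using fourier_coeff_recurrence[OF y g eq bc] by simp
  also have "\<dots> = (exp (- (\<i> * freq n i * t)) * a) * fourier_coeff n y (i + 1) + (exp (- (\<i> * freq n i * t)) * b) * fourier_coeff n y (i - 1) - shifted_coeff n t g i"
    by (simp add: shifted_coeff_def algebra_simps)
  also have "\<dots> = c * (shifted_coeff n t y (i - 1) + shifted_coeff n t y (i + 1)) - shifted_coeff n t g i"
    unfolding e by (simp add: shifted_coeff_def algebra_simps)
  finally show ?thesis .
qed

text \<open>
  The shift multiplies the coefficients by a geometrically growing factor. Boundedness survives since the
  coefficients of a solution decay by the unshifted recurrence with coefficients \<open>a\<close> and \<open>b\<close>.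
\<close>
lemma shifted_coeff_solution:
  assumes y: "hill_sol v (of_nat n ^ 2 + del) y y1" and bc: "floquet n y y1"
    and n: "n \<ge> 2" "cmod del \<le> real n / 4" and t: "\<bar>Im t\<bar> \<le> rho" "0 \<le> rho"
    and K: "cmod a \<le> K" "cmod b \<le> K" "(2 * K / n) * exp (2 * rho) \<le> 1 / 2"
  shows "mathieu_seq c n del (shifted_coeff n t y)" and "\<exists>M. \<forall>i. cmod (shifted_coeff n t y i) \<le> M"
proof -
  have yt: "twice_deriv y y1 (\<lambda>x. (v x - (of_nat n ^ 2 + del)) * y x)" using y by (simp add: hill_sol_def)
  have yc: "continuous_on {0..pi} y" by (rule hill_sol_continuous(1)[OF y])
  have z: "fourier_coeff n (\<lambda>x. 0) i = 0" for i by (simp add: fourier_coeff_def)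
  have "diag_coeff n del i * shifted_coeff n t y i = c * (shifted_coeff n t y (i - 1) + shifted_coeff n t y (i + 1)) - shifted_coeff n t (\<lambda>x. 0) i" for i
    by (rule shifted_coeff_recurrence[OF yt _ _ bc]) auto
  thus "mathieu_seq c n del (shifted_coeff n t y)" by (simp add: mathieu_seq_def shifted_coeff_def z)
  have f: "diag_coeff n del i * fourier_coeff n y i = b * fourier_coeff n y (i - 1) + a * fourier_coeff n y (i + 1)" for i
    using fourier_coeff_recurrence[OF yt _ _ bc, of "\<lambda>x. 0" a b del i] by (simp add: z add.commute)
  obtain x0 where x0: "\<And>x. x \<in> {0..pi} \<Longrightarrow> cmod (y x) \<le> cmod (y x0)" using sup_attained[OF yc] by metis
  define Q where "Q = 2 * K / n"
  have n0: "real n > 0" using n by simp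
  have K0: "0 \<le> K" using K(1) norm_ge_zero order_trans by blast
  have Q: "0 \<le> Q" "Q < 1"
  proof -
    show "0 \<le> Q" using K0 by (simp add: Q_def)
    have "Q * 1 \<le> Q * exp (2 * rho)" using \<open>0 \<le> Q\<close> t by (intro mult_left_mono) auto
    thus "Q < 1" using K(3) by (simp add: Q_def)
  qed
  have dec: "cmod (fourier_coeff n y i) \<le> (pi * cmod (y x0)) * Q ^ res_dist n i" for i
  proof (rule bounded_solution_decay[OF _ Q norm_fourier_coeff_le[OF yc x0] norm_fourier_coeff_le[OF yc x0] norm_fourier_coeff_le[OF yc x0]])
    show "cmod (fourier_coeff n y i) \<le> Q / 2 * (cmod (fourier_coeff n y (i - 1)) + cmod (fourier_coeff n y (i + 1)))"
      if "i \<noteq> 0" "i \<noteq> int n" for i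
      unfolding Q_def by (rule mathieu_seq_contr[OF f that n K(2,1)])
  qed
  have "cmod (shifted_coeff n t y i) \<le> exp (n * rho) * (pi * cmod (y x0))" for i
  proof -
    have "cmod (shifted_coeff n t y i) \<le> (exp (n * rho) * exp (2 * rho) ^ res_dist n i) * ((pi * cmod (y x0)) * Q ^ res_dist n i)"
      unfolding shifted_coeff_def norm_mult using norm_exp_freq_le[of "- t" rho n i] t dec[of i]
      by (intro mult_mono) auto
    also have "\<dots> = exp (n * rho) * (pi * cmod (y x0)) * (Q * exp (2 * rho)) ^ res_dist n i"
      by (simp add: power_mult_distrib mult_ac)
    also have "\<dots> \<le> exp (n * rho) * (pi * cmod (y x0)) * 1"
    proof (intro mult_left_mono power_le_one)
      show "0 \<le> Q * exp (2 * rho)" using Q by simp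
      show "Q * exp (2 * rho) \<le> 1" using K(3) unfolding Q_def[symmetric] by linarith
    qed auto
    finally show ?thesis by simp
  qed
  thus "\<exists>M. \<forall>i. cmod (shifted_coeff n t y i) \<le> M" by blast
qed

lemma mathieu_fun_solution:
  assumes m: "mathieu_seq c n del m" and n: "n \<ge> 1" and q: "0 \<le> q" "16 * q * exp (2 * rho) \<le> 1 / 2"
    and dec: "\<And>i. cmod (m i) \<le> q ^ res_dist n i" and t: "\<bar>Im t\<bar> < rho"
  shows "hill_sol v (of_nat n ^ 2 + del) (mathieu_fun n t m) (mathieu_fun_deriv n t m)" "floquet n (mathieu_fun n t m) (mathieu_fun_deriv n t m)"
proof -
  have tz: "\<bar>Im (of_real x + t)\<bar> < rho" for x using t by simp
  note E = trig_series_mathieu_equation[OF m n q dec tz]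
  show "hill_sol v (of_nat n ^ 2 + del) (mathieu_fun n t m) (mathieu_fun_deriv n t m)"
    unfolding hill_sol_def twice_deriv_def
  proof (intro ballI conjI)
    fix x :: real assume "x \<in> {0..pi}"
    have "((\<lambda>z. trig_series n m (z + t)) has_field_derivative trig_series n (\<lambda>i. \<i> * freq n i * m i) (of_real x + t)) (at (of_real x))"
      by (rule iffD1[OF DERIV_shift E(1)])
    from has_vector_derivative_real_field[OF this]
    show "(mathieu_fun n t m has_vector_derivative mathieu_fun_deriv n t m x) (at x within {0..pi})"
      by (simp only: mathieu_fun_def[abs_def] mathieu_fun_deriv_def)
    have "((\<lambda>z. trig_series n (\<lambda>i. \<i> * freq n i * m i) (z + t)) has_field_derivative
       (2 * c * cos (2 * (of_real x + t)) - (of_nat n ^ 2 + del)) * trig_series n m (of_real x + t)) (at (of_real x))"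
      by (rule iffD1[OF DERIV_shift E(2)])
    from has_vector_derivative_real_field[OF this]
    show "(mathieu_fun_deriv n t m has_vector_derivative (v x - (of_nat n ^ 2 + del)) * mathieu_fun n t m x) (at x within {0..pi})"
      by (simp only: mathieu_fun_def mathieu_fun_deriv_def[abs_def] potential_shift)
  qed
  show "floquet n (mathieu_fun n t m) (mathieu_fun_deriv n t m)"
    unfolding floquet_def mathieu_fun_def mathieu_fun_deriv_def
    using trig_series_shift_pi[of n m t] trig_series_shift_pi[of n "\<lambda>i. \<i> * freq n i * m i" t]
    by (simp only: add.commute[of "of_real pi" t]) simp
qed

end

section \<open>The periodic or antiperiodic spectrum near \<open>n\<^sup>2\<close>\<close>

text \<open>
  Two solutions of opposite symmetry for one large \<open>n\<close>. The sign \<open>sg\<close> of the first one is kept as a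
  parameter, so that every result about it can also be applied to the second one.
\<close>
locale mathieu_pair = shifted_mathieu +
  fixes n :: nat and rho K q :: real and dA dB sg :: complex and A B :: "int \<Rightarrow> complex"
  assumes n2: "n \<ge> 2" and rho: "\<bar>Im t\<bar> < rho" and K: "cmod a \<le> K" "cmod b \<le> K" "cmod c \<le> K"
    and small: "16 * (2 * K / n) * exp (2 * rho) \<le> 1 / 2" and n16: "16 * (cmod a + cmod b) < n"
    and q: "q = 2 * cmod c / n" and sg: "sg * sg = 1" "cmod sg = 1"
    and A: "mathieu_seq c n dA A" "A (int n) = 1" "A 0 = sg" "\<And>i. cmod (A i) \<le> q ^ res_dist n i" "cmod dA < real n / 4"
    and B: "mathieu_seq c n dB B" "B (int n) = 1" "B 0 = - sg" "\<And>i. cmod (B i) \<le> q ^ res_dist n i"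
    and ne: "dA \<noteq> dB"
begin

lemma swapped: "cmod dB < real n / 4 \<Longrightarrow> mathieu_pair a b c t n rho K q dB dA (- sg) B A"
  by unfold_locales (use n2 rho K small n16 q sg A(1-4) B ne in simp_all)

lemma rho_pos: "0 \<le> rho" using rho by linarith

lemma K_small: "(2 * K / n) * exp (2 * rho) \<le> 1 / 2"
proof -
  have "0 \<le> K" using K(1) norm_ge_zero order_trans by blast
  hence "0 \<le> (2 * K / n) * exp (2 * rho)" by simp
  thus ?thesis using small by simp
qed

lemma q_small: "0 \<le> q" "16 * q * exp (2 * rho) \<le> 1 / 2" "q \<le> 1 / 4"
proof -
  show q0: "0 \<le> q" using q by simp
  have "q \<le> 2 * K / n" using q K(3) by (simp add: divide_right_mono)
  hence "16 * q * exp (2 * rho) \<le> 16 * (2 * K / n) * exp (2 * rho)" by (intro mult_right_mono) auto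
  thus qr: "16 * q * exp (2 * rho) \<le> 1 / 2" using small by simp
  have "16 * q * 1 \<le> 16 * q * exp (2 * rho)" using q0 rho_pos by (intro mult_left_mono) auto
  thus "q \<le> 1 / 4" using qr by simp
qed

lemma eigenfunction_A: "hill_sol v (of_nat n ^ 2 + dA) (mathieu_fun n t A) (mathieu_fun_deriv n t A)" "floquet n (mathieu_fun n t A) (mathieu_fun_deriv n t A)"
  using mathieu_fun_solution[OF A(1) _ q_small(1,2) A(4) rho] n2 by auto

lemma zero_initial_values_imp_zero_in_disc:
  assumes y: "hill_sol v (of_nat n ^ 2 + del) y y1" "y 0 = 0" "y1 0 = 0" and d: "cmod del \<le> real n / 4" and x: "x \<in> {0..pi}"
  shows "y x = 0"
proof (rule zero_initial_values_imp_zero[OF y _ _ x, of n])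
  have "pi * (cmod a + cmod b + cmod del) < 16 / 5 * (n / 16 + n / 4)"
  proof -
    have "pi * (cmod a + cmod b + cmod del) \<le> 16 / 5 * (cmod a + cmod b + cmod del)"
      using pi_approx by (intro mult_right_mono) auto
    also have "\<dots> < 16 / 5 * (n / 16 + n / 4)" using n16 d by simp
    finally show ?thesis .
  qed
  thus "pi * (cmod a + cmod b + cmod (of_nat n ^ 2 + del - of_nat n ^ 2)) / n < 1"
    using n2 by (simp add: pos_divide_less_eq)
qed (use n2 in auto)

lemma zero_shifted_coeff_imp_zero:
  assumes y: "hill_sol v (of_nat n ^ 2 + del) y y1" "floquet n y y1" and d: "cmod del \<le> real n / 4"
    and z: "\<And>i. shifted_coeff n t y i = 0" and x: "x \<in> {0..pi}"
  shows "y x = 0"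
proof -
  have "fourier_coeff n y i = 0" for i using z[of i] by (simp add: shifted_coeff_def)
  from zero_coefficients_imp_zero_initial[OF y(1)[unfolded hill_sol_def] y(2) this]
  show ?thesis using zero_initial_values_imp_zero_in_disc[OF y(1) _ _ d x] by blast
qed

lemma shifted_coeff_classification:
  assumes y: "hill_sol v (of_nat n ^ 2 + del) y y1" "floquet n y y1" and d: "cmod del \<le> real n / 4"
  shows "(\<forall>i. shifted_coeff n t y i = 0) \<or> del = dA \<or> del = dB"
    and "del = dA \<Longrightarrow> \<exists>k. \<forall>i. shifted_coeff n t y i = k * A i"
proof -
  obtain M where M: "\<And>i. cmod (shifted_coeff n t y i) \<le> M"
    using shifted_coeff_solution(2)[OF y n2 d less_imp_le[OF rho] rho_pos K(1,2) K_small] by blast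
  note c = bounded_solution_classification[OF A(1-4) B shifted_coeff_solution(1)[OF y n2 d less_imp_le[OF rho] rho_pos K(1,2) K_small] M sg n2 d q q_small(3)]
  show "(\<forall>i. shifted_coeff n t y i = 0) \<or> del = dA \<or> del = dB" by (rule c(1))
  show "del = dA \<Longrightarrow> \<exists>k. \<forall>i. shifted_coeff n t y i = k * A i" using c(2) ne by blast
qed

lemma eigenvalue_cases:
  assumes y: "hill_sol v (of_nat n ^ 2 + del) y y1" "floquet n y y1" and d: "cmod del \<le> real n / 4"
    and x: "x \<in> {0..pi}" "y x \<noteq> 0"
  shows "del = dA \<or> del = dB"
  using shifted_coeff_classification(1)[OF y d] zero_shifted_coeff_imp_zero[OF y d _ x(1)] x(2) by blast

lemma shifted_coeff_eigenfunction_A: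
  assumes nz: "mathieu_fun n t A 0 \<noteq> 0"
  obtains k where "k \<noteq> 0" "\<And>i. shifted_coeff n t (mathieu_fun n t A) i = k * A i"
proof -
  obtain k where k: "\<And>i. shifted_coeff n t (mathieu_fun n t A) i = k * A i"
    using shifted_coeff_classification(2)[OF eigenfunction_A less_imp_le[OF A(5)] refl] by blast
  have "k \<noteq> 0"
  proof
    assume "k = 0"
    hence "mathieu_fun n t A 0 = 0" using zero_shifted_coeff_imp_zero[OF eigenfunction_A less_imp_le[OF A(5)], of 0] k by simp
    thus False using nz by simp
  qed
  thus thesis using that k by blast
qed

text \<open>
  The coefficients determine a solution, and they are a multiple of \<open>A\<close> for every solution.
\<close>
lemma eigenspace_one_dimensional:
  assumes nz: "mathieu_fun n t A 0 \<noteq> 0" and y: "hill_sol v (of_nat n ^ 2 + dA) y y1" "floquet n y y1"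
  shows "\<exists>k. \<forall>x\<in>{0..pi}. y x = k * mathieu_fun n t A x"
proof -
  obtain k where k: "k \<noteq> 0" "\<And>i. shifted_coeff n t (mathieu_fun n t A) i = k * A i" using shifted_coeff_eigenfunction_A[OF nz] by blast
  obtain l where l: "\<And>i. shifted_coeff n t y i = l * A i"
    using shifted_coeff_classification(2)[OF y less_imp_le[OF A(5)] refl] by blast
  define w where "w = (\<lambda>x. y x + (- (l / k)) * mathieu_fun n t A x)"
  define w1 where "w1 = (\<lambda>x. y1 x + (- (l / k)) * mathieu_fun_deriv n t A x)"
  have w: "hill_sol v (of_nat n ^ 2 + dA) w w1" unfolding w_def w1_def by (intro hill_sol_add hill_sol_scale y eigenfunction_A)
  have wb: "floquet n w w1" using y(2) eigenfunction_A(2) by (simp add: floquet_def w_def w1_def algebra_simps)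
  have "shifted_coeff n t w i = 0" for i
  proof -
    have "fourier_coeff n w i = fourier_coeff n y i + (- (l / k)) * fourier_coeff n (mathieu_fun n t A) i"
    proof (rule has_integral_unique[OF fourier_coeff_has_integral[OF hill_sol_continuous(1)[OF w]]])
      have "((\<lambda>x. y x * exp (- (\<i> * freq n i * of_real x)) + (- (l / k)) * (mathieu_fun n t A x * exp (- (\<i> * freq n i * of_real x))))
        has_integral (fourier_coeff n y i + (- (l / k)) * fourier_coeff n (mathieu_fun n t A) i)) {0..pi}"
        by (intro has_integral_add has_integral_mult_right fourier_coeff_has_integral hill_sol_continuous(1)[OF y(1)] hill_sol_continuous(1)[OF eigenfunction_A(1)])
      thus "((\<lambda>x. w x * exp (- (\<i> * freq n i * of_real x))) has_integral (fourier_coeff n y i + (- (l / k)) * fourier_coeff n (mathieu_fun n t A) i)) {0..pi}"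
        by (simp add: w_def algebra_simps)
    qed
    moreover have "e * (p + r * s) = e * p + r * (e * s)" for e p r s :: complex by (simp add: algebra_simps)
    ultimately have "shifted_coeff n t w i = shifted_coeff n t y i + (- (l / k)) * shifted_coeff n t (mathieu_fun n t A) i"
      unfolding shifted_coeff_def by (simp only:)
    thus ?thesis using k l by simp
  qed
  hence "w x = 0" if "x \<in> {0..pi}" for x using zero_shifted_coeff_imp_zero[OF w wb less_imp_le[OF A(5)] _ that] by blast
  hence "\<forall>x\<in>{0..pi}. y x = (l / k) * mathieu_fun n t A x" by (simp add: w_def)
  thus ?thesis by blast
qed

text \<open>A generalized eigenfunction would make the coefficient sequence orthogonal to itself.\<close>
lemma no_generalized_eigenfunction:
  assumes nz: "mathieu_fun n t A 0 \<noteq> 0" and u: "twice_deriv u u1 u2" "floquet n u u1"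
    and eq: "\<And>x. x \<in> {0..pi} \<Longrightarrow> u2 x = (v x - (of_nat n ^ 2 + dA)) * u x - l * mathieu_fun n t A x"
  shows "l = 0"
proof -
  obtain k where k: "k \<noteq> 0" "\<And>i. shifted_coeff n t (mathieu_fun n t A) i = k * A i" using shifted_coeff_eigenfunction_A[OF nz] by blast
  have uc: "continuous_on {0..pi} u" by (rule twice_deriv_continuous(1)[OF u(1)])
  have gc: "continuous_on {0..pi} (\<lambda>x. l * mathieu_fun n t A x)"
    by (intro continuous_intros hill_sol_continuous(1)[OF eigenfunction_A(1)])
  have "shifted_coeff n t (\<lambda>x. l * mathieu_fun n t A x) i = l * (k * A i)" for i
  proof -
    have "fourier_coeff n (\<lambda>x. l * mathieu_fun n t A x) i = l * fourier_coeff n (mathieu_fun n t A) i"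
      unfolding fourier_coeff_def by (simp add: mult.assoc)
    thus ?thesis using k(2)[of i] by (simp add: shifted_coeff_def)
  qed
  hence rec: "diag_coeff n dA i * shifted_coeff n t u i = c * (shifted_coeff n t u (i - 1) + shifted_coeff n t u (i + 1)) + (- (l * k) * A i)" for i
    using shifted_coeff_recurrence[OF u(1) gc eq u(2), of i] by simp
  obtain x0 where x0: "\<And>x. x \<in> {0..pi} \<Longrightarrow> cmod (u x) \<le> cmod (u x0)" using sup_attained[OF uc] by metis
  have A': "cmod (A i) \<le> 1 * q ^ res_dist n i" for i using A(4) by simp
  have qr: "q * exp (2 * rho) < 1"
  proof -
    have "q * exp (2 * rho) \<le> 16 * q * exp (2 * rho)" using q_small(1) by (intro mult_right_mono) auto
    thus ?thesis using q_small(2) by linarith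
  qed
  have n1: "n \<ge> 1" using n2 by simp
  have r1: "1 \<le> exp (2 * rho)" using rho_pos by simp
  have "((\<lambda>i. A i * (- (l * k) * A i)) has_sum (dA - dA) * infsum (\<lambda>i. A i * shifted_coeff n t u i) UNIV) UNIV"
    by (rule pairing[OF A(1) rec res_dist_summable_product[OF n1 q_small(1) qr r1 A' shifted_coeff_growth[OF uc x0 less_imp_le[OF rho]]]])
  hence 1: "((\<lambda>i. - (l * k) * (A i * A i)) has_sum 0) UNIV" by (simp add: mult_ac)
  have "(\<lambda>i. A i * A i) summable_on UNIV"
  proof (rule res_dist_summable_product(1)[OF n1 q_small(1) _ order_refl A', of _ 1])
    show "cmod (A i) \<le> 1 * 1 ^ res_dist n i" for i
      using A(4)[of i] power_le_one[of q "res_dist n i"] q_small by simp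
  qed (use q_small in auto)
  hence "((\<lambda>i. - (l * k) * (A i * A i)) has_sum - (l * k) * infsum (\<lambda>i. A i * A i) UNIV) UNIV"
    by (intro has_sum_cmult_right has_sum_infsum)
  with 1 have "- (l * k) * infsum (\<lambda>i. A i * A i) UNIV = 0" using has_sum_unique by blast
  moreover have "infsum (\<lambda>i. A i * A i) UNIV \<noteq> 0"
    by (rule mathieu_parameter_unique(2)[OF A(1-4) A(1-4) sg(1) n1 q_small(1,3)])
  ultimately show "l = 0" using k by simp
qed

end

section \<open>From classical solutions to the operator\<close>

lemma C2_interval_twice_deriv:
  assumes "y \<in> C2_interval"
  shows "twice_deriv y (D y) (D (D y))"
proof -
  have "(f has_vector_derivative D f x) (at x within {0..pi})"
    if "f differentiable_on {0..pi}" "x \<in> {0..pi}" for f x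
    using that unfolding differentiable_on_def D_def by (simp add: vector_derivative_works[symmetric])
  thus ?thesis using assms by (auto simp: C2_interval_def twice_deriv_def)
qed

text \<open>
  Elements of \<open>C2_interval\<close> have to vanish outside the interval, unlike the solutions constructed above.
\<close>
definition cutoff :: "(real \<Rightarrow> complex) \<Rightarrow> real \<Rightarrow> complex" where
  "cutoff y x = (if x \<in> {0..pi} then y x else 0)"

lemma D_cutoff:
  assumes "\<And>x. x \<in> {0..pi} \<Longrightarrow> (y has_vector_derivative y1 x) (at x within {0..pi})"
  shows "D (cutoff y) = cutoff y1"
    and "\<And>x. x \<in> {0..pi} \<Longrightarrow> (cutoff y has_vector_derivative y1 x) (at x within {0..pi})"
proof -
  show d: "(cutoff y has_vector_derivative y1 x) (at x within {0..pi})" if "x \<in> {0..pi}" for x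
    by (rule has_vector_derivative_transform[OF that _ assms[OF that]]) (simp add: cutoff_def)
  show "D (cutoff y) = cutoff y1"
  proof
    fix x
    show "D (cutoff y) x = cutoff y1 x"
      using vector_derivative_within_cbox[of 0 pi x "cutoff y" "y1 x"] d[of x] by (auto simp: D_def cutoff_def[of y1])
  qed
qed

lemma cutoff_in_C2:
  assumes y: "twice_deriv y y1 y2" and c: "continuous_on {0..pi} y2"
  shows "cutoff y \<in> C2_interval" "D (cutoff y) = cutoff y1" "D (D (cutoff y)) = cutoff y2"
proof -
  have d: "(y has_vector_derivative y1 x) (at x within {0..pi})"
    "(y1 has_vector_derivative y2 x) (at x within {0..pi})" if "x \<in> {0..pi}" for x
    using y that by (auto simp: twice_deriv_def)
  show 1: "D (cutoff y) = cutoff y1" by (rule D_cutoff(1)[OF d(1)])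
  show 2: "D (D (cutoff y)) = cutoff y2" unfolding 1 by (rule D_cutoff(1)[OF d(2)])
  have "cutoff y differentiable_on {0..pi}" "cutoff y1 differentiable_on {0..pi}"
    unfolding differentiable_on_def
    using D_cutoff(2)[OF d(1)] D_cutoff(2)[OF d(2)] differentiableI_vector by blast+
  moreover have "continuous_on {0..pi} (cutoff y2)"
    using c by (rule continuous_on_eq) (simp add: cutoff_def)
  moreover have "D (cutoff y1) = cutoff y2" using 2 unfolding 1 .
  ultimately show "cutoff y \<in> C2_interval" unfolding C2_interval_def by (simp add: 1) (simp add: cutoff_def)
qed

lemma hill_eigen_imp_hill_sol:
  assumes "y \<in> hill_domain bc" "hill_op w y = (\<lambda>x. l * y x)"
  shows "hill_sol w l y (D y)"
  unfolding hill_sol_def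
proof (rule twice_deriv_cong[OF C2_interval_twice_deriv])
  show "y \<in> C2_interval" using assms by (simp add: hill_domain_def)
  fix x assume "x \<in> {0..pi}"
  thus "D (D y) x = (w x - l) * y x"
    using fun_cong[OF assms(2), of x] by (simp add: hill_op_def algebra_simps)
qed

lemma satisfies_bc_floquet: "satisfies_bc (bc_of n) y \<longleftrightarrow> floquet n y (D y)"
  by (cases "even n") (auto simp: bc_of_def floquet_def)

lemma hill_sol_cutoff:
  assumes y: "hill_sol w l y y1" and w: "continuous_on {0..pi} w"
  shows "cutoff y \<in> C2_interval" "D (cutoff y) = cutoff y1" "hill_op w (cutoff y) = (\<lambda>x. l * cutoff y x)"
proof -
  have c: "continuous_on {0..pi} (\<lambda>x. (w x - l) * y x)"
    by (intro continuous_intros w hill_sol_continuous(1)[OF y])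
  note C = cutoff_in_C2[OF y[unfolded hill_sol_def] c]
  show "cutoff y \<in> C2_interval" "D (cutoff y) = cutoff y1" by fact+
  show "hill_op w (cutoff y) = (\<lambda>x. l * cutoff y x)"
    unfolding hill_op_def[abs_def] C(3) by (auto simp: cutoff_def algebra_simps fun_eq_iff)
qed

lemma outside_zero: "y \<in> hill_domain bc \<Longrightarrow> x \<notin> {0..pi} \<Longrightarrow> y x = 0"
  by (simp add: hill_domain_def C2_interval_def)

text \<open>
  If \<open>L - l\<close> has a one-dimensional kernel whose generator is not in the range, then the kernels of its powers
  do not grow.
\<close>
lemma simple_eigenvalue:
  assumes f: "f \<in> hill_domain bc" "f \<noteq> (\<lambda>x. 0)" "hill_op w f = (\<lambda>x. l * f x)"
    and span: "\<And>k. (\<lambda>x. k * f x) \<in> hill_domain bc"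
      "\<And>k. hill_op w (\<lambda>x. k * f x) = (\<lambda>x. l * (k * f x))"
    and uniq: "\<And>y. y \<in> hill_domain bc \<Longrightarrow> hill_op w y = (\<lambda>x. l * y x) \<Longrightarrow> \<exists>k. y = (\<lambda>x. k * f x)"
    and nogen: "\<And>u k. u \<in> hill_domain bc \<Longrightarrow> (\<lambda>x. hill_op w u x - l * u x) = (\<lambda>x. k * f x) \<Longrightarrow> k = 0"
  shows "hill_eigenvalue w bc l" "alg_mult w bc l = 1"
proof -
  show "hill_eigenvalue w bc l" using f by (auto simp: hill_eigenvalue_def)
  interpret V: vector_space "\<lambda>(c::complex) (f::real \<Rightarrow> complex) x. c * f x" by (rule vector_space_complex_fun)
  define R where "R = range (\<lambda>k x. k * f x)"
  have zero: "(\<lambda>x. 0) \<in> R" unfolding R_def by (rule image_eqI[of _ _ 0]) auto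
  have K: "hill_kernel w bc l (Suc j) = R" for j
  proof (induction j)
    case 0
    show ?case
    proof
      show "hill_kernel w bc l (Suc 0) \<subseteq> R"
      proof
        fix y assume "y \<in> hill_kernel w bc l (Suc 0)"
        hence y: "y \<in> hill_domain bc" "(\<lambda>x. hill_op w y x - l * y x) = (\<lambda>x. 0)" by auto
        have "hill_op w y = (\<lambda>x. l * y x)" using fun_cong[OF y(2)] by auto
        thus "y \<in> R" using uniq[OF y(1)] by (auto simp: R_def)
      qed
      show "R \<subseteq> hill_kernel w bc l (Suc 0)" using span by (auto simp: R_def)
    qed
  next
    case (Suc j)
    show ?case
    proof
      show "hill_kernel w bc l (Suc (Suc j)) \<subseteq> R"
      proof
        fix y assume "y \<in> hill_kernel w bc l (Suc (Suc j))"
        hence y: "y \<in> hill_domain bc" "(\<lambda>x. hill_op w y x - l * y x) \<in> R"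
          using Suc by (auto simp del: hill_kernel.simps(2) simp add: hill_kernel.simps(2)[of w bc l "Suc j"])
        then obtain k where k: "(\<lambda>x. hill_op w y x - l * y x) = (\<lambda>x. k * f x)" by (auto simp: R_def)
        have "k = 0" by (rule nogen[OF y(1) k])
        hence "hill_op w y = (\<lambda>x. l * y x)" using fun_cong[OF k] by auto
        thus "y \<in> R" using uniq[OF y(1)] by (auto simp: R_def)
      qed
      have "(\<lambda>x. hill_op w (\<lambda>x. k * f x) x - l * (k * f x)) = (\<lambda>x. 0)" for k by (simp add: span(2))
      thus "R \<subseteq> hill_kernel w bc l (Suc (Suc j))"
        using span(1) zero Suc by (auto simp: R_def simp del: hill_kernel.simps(2) simp add: hill_kernel.simps(2)[of w bc l "Suc j"])
    qed
  qed
  have "root_space w bc l = R"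
  proof
    show "root_space w bc l \<subseteq> R"
      unfolding root_space_def
    proof (rule UN_least)
      show "hill_kernel w bc l j \<subseteq> R" for j using K zero by (cases j) auto
    qed
    show "R \<subseteq> root_space w bc l" unfolding root_space_def using K[of 0] by blast
  qed
  moreover have "V.dim R = 1"
  proof (rule V.dim_unique[of "{f}"])
    show "{f} \<subseteq> R" unfolding R_def by (auto intro: image_eqI[of _ _ 1])
    show "R \<subseteq> V.span {f}"
      unfolding R_def by (auto intro: V.span_scale V.span_base)
    have "f \<noteq> 0" using f(2) by (simp add: fun_eq_iff)
    thus "V.independent {f}" by simp
  qed simp
  ultimately show "alg_mult w bc l = 1" by (simp add: alg_mult_def)
qed

context mathieu_pair begin

lemma simple_periodic_eigenvalue:
  assumes nz: "mathieu_fun n t A 0 \<noteq> 0"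
  shows "hill_eigenvalue v (bc_of n) (of_nat n ^ 2 + dA)" "alg_mult v (bc_of n) (of_nat n ^ 2 + dA) = 1"
proof -
  let ?l = "of_nat n ^ 2 + dA :: complex"
  define f where "f = cutoff (mathieu_fun n t A)"
  have scaled: "cutoff (\<lambda>x. k * mathieu_fun n t A x) = (\<lambda>x. k * f x)" for k
    by (auto simp: f_def cutoff_def)
  have span: "(\<lambda>x. k * f x) \<in> hill_domain (bc_of n)" "hill_op v (\<lambda>x. k * f x) = (\<lambda>x. ?l * (k * f x))" for k
  proof -
    note C = hill_sol_cutoff[OF hill_sol_scale[OF eigenfunction_A(1), of k] v_cont, unfolded scaled]
    show "hill_op v (\<lambda>x. k * f x) = (\<lambda>x. ?l * (k * f x))" by (rule C(3))
    have "floquet n (\<lambda>x. k * f x) (D (\<lambda>x. k * f x))"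
      unfolding C(2) using eigenfunction_A(2) by (simp add: floquet_def cutoff_def f_def)
    thus "(\<lambda>x. k * f x) \<in> hill_domain (bc_of n)" using C(1) by (simp add: hill_domain_def satisfies_bc_floquet)
  qed
  have f0: "f 0 \<noteq> 0" using nz by (simp add: f_def cutoff_def)
  have f: "f \<in> hill_domain (bc_of n)" "hill_op v f = (\<lambda>x. ?l * f x)" using span[of 1] by simp_all
  have fne: "f \<noteq> (\<lambda>x. 0)" using f0 by auto
  have uniq: "\<exists>k. y = (\<lambda>x. k * f x)" if y: "y \<in> hill_domain (bc_of n)" "hill_op v y = (\<lambda>x. ?l * y x)" for y
  proof -
    have b: "floquet n y (D y)" using y(1) by (simp add: hill_domain_def satisfies_bc_floquet)
    obtain k where k: "\<forall>x\<in>{0..pi}. y x = k * mathieu_fun n t A x"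
      using eigenspace_one_dimensional[OF nz hill_eigen_imp_hill_sol[OF y] b] by blast
    have "y x = k * f x" for x
      using k outside_zero[OF y(1), of x] by (cases "x \<in> {0..pi}") (auto simp: f_def cutoff_def)
    thus ?thesis by blast
  qed
  have nogen: "k = 0" if u: "u \<in> hill_domain (bc_of n)" "(\<lambda>x. hill_op v u x - ?l * u x) = (\<lambda>x. k * f x)" for u k
  proof (rule no_generalized_eigenfunction[OF nz C2_interval_twice_deriv])
    show "u \<in> C2_interval" "floquet n u (D u)" using u(1) by (simp_all add: hill_domain_def satisfies_bc_floquet)
    fix x assume "x \<in> {0..pi}"
    thus "D (D u) x = (v x - ?l) * u x - k * mathieu_fun n t A x"
      using fun_cong[OF u(2), of x] by (simp add: hill_op_def f_def cutoff_def algebra_simps)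
  qed
  show "hill_eigenvalue v (bc_of n) ?l" by (rule simple_eigenvalue(1)[OF f(1) fne f(2) span uniq nogen])
  show "alg_mult v (bc_of n) ?l = 1" by (rule simple_eigenvalue(2)[OF f(1) fne f(2) span uniq nogen])
qed

lemma periodic_eigenvalue_in_disc:
  assumes l: "l \<in> disc n" "hill_eigenvalue v (bc_of n) l"
  shows "l = of_nat n ^ 2 + dA \<or> l = of_nat n ^ 2 + dB"
proof -
  obtain y where y: "y \<in> hill_domain (bc_of n)" "y \<noteq> (\<lambda>x. 0)" "hill_op v y = (\<lambda>x. l * y x)"
    using l(2) by (auto simp: hill_eigenvalue_def)
  obtain x where x: "y x \<noteq> 0" using y(2) by auto
  hence x': "x \<in> {0..pi}" using outside_zero[OF y(1)] by blast
  have h: "hill_sol v (of_nat n ^ 2 + (l - of_nat n ^ 2)) y (D y)" using hill_eigen_imp_hill_sol[OF y(1,3)] by simp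
  have b: "floquet n y (D y)" using y(1) by (simp add: hill_domain_def satisfies_bc_floquet)
  have "cmod (l - of_nat n ^ 2) \<le> real n / 4" using l(1) by (simp add: disc_def)
  from eigenvalue_cases[OF h b this x' x] show ?thesis by (auto simp: algebra_simps)
qed

lemma in_disc: "of_nat n ^ 2 + dA \<in> disc n"
  using A(5) by (simp add: disc_def)

end

lemma eigenvalue_pair_values:
  assumes "is_eigenvalue_pair v n p q"
  shows "lambda_minus v n = p" "lambda_plus v n = q"
proof -
  have u: "p' = p \<and> q' = q" if "is_eigenvalue_pair v n p' q'" for p' q'
  proof -
    have "{p', q'} = {p, q}" using assms that by (simp add: is_eigenvalue_pair_def)
    moreover have "Re p < Re q \<or> Re p = Re q \<and> Im p \<le> Im q" "Re p' < Re q' \<or> Re p' = Re q' \<and> Im p' \<le> Im q'"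
      using assms that by (simp_all add: is_eigenvalue_pair_def)
    ultimately show ?thesis by (auto simp: doubleton_eq_iff complex_eq_iff)
  qed
  show "lambda_minus v n = p" "lambda_plus v n = q"
    unfolding lambda_minus_def lambda_plus_def using assms u by (blast intro: the_equality)+
qed

lemma (in mathieu_pair) lambda_values:
  assumes nz: "mathieu_fun n t A 0 \<noteq> 0" "mathieu_fun n t B 0 \<noteq> 0" and dB: "cmod dB < real n / 4"
  defines "l1 \<equiv> of_nat n ^ 2 + dA" and "l2 \<equiv> of_nat n ^ 2 + dB"
  shows "lambda_minus v n = l2 \<and> lambda_plus v n = l1 \<or> lambda_minus v n = l1 \<and> lambda_plus v n = l2"
proof -
  interpret S: mathieu_pair a b c t n rho K q dB dA "- sg" B A by (rule swapped[OF dB])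
  have s: "{l \<in> disc n. hill_eigenvalue v (bc_of n) l} = {l1, l2}"
    using periodic_eigenvalue_in_disc simple_periodic_eigenvalue(1)[OF nz(1)] S.simple_periodic_eigenvalue(1)[OF nz(2)]
      in_disc S.in_disc unfolding l1_def l2_def by blast
  have m: "alg_mult v (bc_of n) l1 = 1" "alg_mult v (bc_of n) l2 = 1"
    unfolding l1_def l2_def by (rule simple_periodic_eigenvalue(2)[OF nz(1)], rule S.simple_periodic_eigenvalue(2)[OF nz(2)])
  have d: "l1 \<noteq> l2" using ne by (simp add: l1_def l2_def)
  have "is_eigenvalue_pair v n l2 l1 \<or> is_eigenvalue_pair v n l1 l2"
    using s m d unfolding is_eigenvalue_pair_def by (auto simp: insert_commute)
  thus ?thesis using eigenvalue_pair_values by blast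
qed

section \<open>The Dirichlet eigenvalue near \<open>n\<^sup>2\<close>\<close>

context bounded_potential begin

text \<open>
  Existence comes from the fixed point argument. Uniqueness: any other eigenvalue in the disc would lie
  within bounded distance of \<open>n\<^sup>2\<close>, and its eigenfunction would be orthogonal to the first one.
\<close>
lemma dirichlet_eigenvalue:
  fixes n :: nat
  assumes n: "n \<ge> 1" and big: "16 * (pi * (217 * V)) \<le> n" "1000 * V < n"
  obtains del s s1 where "cmod del \<le> 216 * V" "hill_sol v (of_nat n ^ 2 + del) s s1"
    "s 0 = 0" "s1 0 = of_nat n" "s pi = 0" "mu v n = of_nat n ^ 2 + del"
proof -
  have n0: "n > 0" "real n > 0" using n by auto
  have k: "pi * (V + 216 * V) / n \<le> 1 / 16" using big(1) n0 by (simp add: field_simps)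
  obtain del s s1 where s: "cmod del \<le> 216 * V" "hill_sol v (of_nat n ^ 2 + del) s s1" "s 0 = 0" "s1 0 = of_nat n" "s pi = 0"
    by (rule dirichlet_solution_exists[OF n0(1) _ _ k]) (use V_nonneg in auto)
  let ?l = "of_nat n ^ 2 + del :: complex"
  have kd: "pi * (V + cmod e) / n \<le> 1 / 16" if "cmod e \<le> 216 * V" for e :: complex
    by (rule order_trans[OF divide_right_mono[OF mult_left_mono] k]) (use that in auto)
  have uniq0: "y x = 0" if y: "hill_sol v l y y1" "y 0 = 0" "y1 0 = 0" and l: "cmod (l - of_nat n ^ 2) \<le> real n / 4" and x: "x \<in> {0..pi}"
    for y y1 l x
  proof (rule zero_initial_values_imp_zero[OF y n0(1) _ x])
    have "pi * (V + cmod (l - of_nat n ^ 2)) \<le> 16 / 5 * (V + cmod (l - of_nat n ^ 2))"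
      using pi_approx V_nonneg by (intro mult_right_mono) auto
    also have "\<dots> < n"
    proof -
      have "16 / 5 * (x + e) < m" if "1000 * x < m" "e \<le> m / 4" "0 < m" for x e m :: real
        using that by (simp add: field_simps)
      thus ?thesis using big(2) l n0(2) by blast
    qed
    finally show "pi * (V + cmod (l - of_nat n ^ 2)) / n < 1" using n0 by (simp add: pos_divide_less_eq)
  qed
  have ld: "cmod (?l - of_nat n ^ 2) \<le> real n / 4" using s(1) big(2) V_nonneg by simp
  have prod: "integral {0..pi} (\<lambda>x. s x * u x) \<noteq> 0"
    if u: "hill_sol v (of_nat n ^ 2 + e) u u1" "u 0 = 0" "u1 0 = of_nat n" and e: "cmod e \<le> 216 * V" for u u1 e
  proof
    assume z: "integral {0..pi} (\<lambda>x. s x * u x) = 0"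
    have "cmod (integral {0..pi} (\<lambda>x. s x * u x) - pi / 2) \<le> pi * (6 * (1 / 16))"
      by (rule dirichlet_products_nonzero[OF s(2-4) u n0(1) kd[OF s(1)] kd[OF e]]) simp
    thus False unfolding z using pi_gt_zero by (simp add: norm_divide)
  qed
  define f where "f = cutoff s"
  have scaled: "cutoff (\<lambda>x. k * s x) = (\<lambda>x. k * f x)" for k by (auto simp: f_def cutoff_def)
  have span: "(\<lambda>x. k * f x) \<in> hill_domain Dirichlet" "hill_op v (\<lambda>x. k * f x) = (\<lambda>x. ?l * (k * f x))" for k
  proof -
    note C = hill_sol_cutoff[OF hill_sol_scale[OF s(2), of k] v_cont, unfolded scaled]
    show "hill_op v (\<lambda>x. k * f x) = (\<lambda>x. ?l * (k * f x))" by (rule C(3))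
    show "(\<lambda>x. k * f x) \<in> hill_domain Dirichlet" using C(1) s(3,5) by (simp add: hill_domain_def f_def cutoff_def)
  qed
  have f: "f \<in> hill_domain Dirichlet" "hill_op v f = (\<lambda>x. ?l * f x)" using span[of 1] by simp_all
  have fne: "f \<noteq> (\<lambda>x. 0)"
  proof
    assume "f = (\<lambda>x. 0)"
    moreover have "s x = f x" if "x \<in> {0..pi}" for x using that by (simp add: f_def cutoff_def)
    ultimately have "s x = 0" if "x \<in> {0..pi}" for x using that by simp
    hence "integral {0..pi} (\<lambda>x. s x * s x) = integral {0..pi} (\<lambda>x. 0)" by (intro integral_cong) simp
    thus False using prod[OF s(2-4) s(1)] by simp
  qed
  have uniq: "\<exists>k. y = (\<lambda>x. k * f x)" if y: "y \<in> hill_domain Dirichlet" "hill_op v y = (\<lambda>x. ?l * y x)" for y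
  proof -
    define k where "k = D y 0 / of_nat n"
    have "y x + (- k) * s x = 0" if "x \<in> {0..pi}" for x
      by (rule uniq0[OF hill_sol_add[OF hill_eigen_imp_hill_sol[OF y] hill_sol_scale[OF s(2), of "- k"]] _ _ ld that])
        (use y(1) s n0 in \<open>auto simp: hill_domain_def k_def\<close>)
    hence "y x = k * f x" for x
      using outside_zero[OF y(1), of x] by (cases "x \<in> {0..pi}") (auto simp: f_def cutoff_def)
    thus ?thesis by blast
  qed
  have nogen: "k = 0" if u: "u \<in> hill_domain Dirichlet" "(\<lambda>x. hill_op v u x - ?l * u x) = (\<lambda>x. k * f x)" for u k
  proof -
    have ut: "twice_deriv u (D u) (D (D u))" using u(1) by (simp add: hill_domain_def C2_interval_twice_deriv)
    have g: "((\<lambda>x. u x * ((v x - ?l) * s x) - D (D u) x * s x) has_integral 0) {0..pi}"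
      using green_identity[OF ut s(2)[unfolded hill_sol_def], of pi] u(1) s(3,5) by (simp add: hill_domain_def)
    have "u x * ((v x - ?l) * s x) - D (D u) x * s x = k * (s x * s x)" if x: "x \<in> {0..pi}" for x
    proof -
      have d: "D (D u) x = (v x - ?l) * u x - k * s x"
        using fun_cong[OF u(2), of x] x by (simp add: hill_op_def f_def cutoff_def algebra_simps)
      show ?thesis unfolding d by (simp add: algebra_simps)
    qed
    from integral_unique[OF has_integral_eq[OF this g]]
    have "k * integral {0..pi} (\<lambda>x. s x * s x) = 0" by simp
    thus ?thesis using prod[OF s(2-4) s(1)] by simp
  qed
  have simple1: "hill_eigenvalue v Dirichlet ?l" by (rule simple_eigenvalue(1)[OF f(1) fne f(2) span uniq nogen])
  have simple2: "alg_mult v Dirichlet ?l = 1" by (rule simple_eigenvalue(2)[OF f(1) fne f(2) span uniq nogen])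
  have only: "l = ?l" if l: "l \<in> disc n" "hill_eigenvalue v Dirichlet l" for l
  proof -
    obtain y where y: "y \<in> hill_domain Dirichlet" "y \<noteq> (\<lambda>x. 0)" "hill_op v y = (\<lambda>x. l * y x)"
      using l(2) by (auto simp: hill_eigenvalue_def)
    note h = hill_eigen_imp_hill_sol[OF y(1,3)]
    have bc: "y 0 = 0" "y pi = 0" using y(1) by (simp_all add: hill_domain_def)
    have l4: "cmod (l - of_nat n ^ 2) \<le> real n / 4" using l(1) by (simp add: disc_def)
    have d0: "D y 0 \<noteq> 0"
    proof
      assume "D y 0 = 0"
      hence "y x = 0" for x using uniq0[OF h bc(1) _ l4, of x] outside_zero[OF y(1), of x] by blast
      thus False using y(2) by auto
    qed
    have "36 * pi * V \<le> 16 * (pi * (217 * V))" using V_nonneg by simp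
    hence loc: "cmod (l - of_nat n ^ 2) \<le> 216 * V"
      using dirichlet_localization[OF h bc d0 n _ l4] big(1) by linarith
    define k where "k = of_nat n / D y 0"
    define e where "e = l - of_nat n ^ 2"
    have u: "hill_sol v (of_nat n ^ 2 + e) (\<lambda>x. k * y x) (\<lambda>x. k * D y x)"
      using hill_sol_scale[OF h, of k] by (simp add: e_def)
    have "(?l - (of_nat n ^ 2 + e)) * integral {0..pi} (\<lambda>x. s x * (k * y x)) = 0"
      using lagrange_identity_integral[OF s(2) u] s bc by simp
    moreover have "integral {0..pi} (\<lambda>x. s x * (k * y x)) \<noteq> 0"
      by (rule prod[OF u]) (use bc d0 loc in \<open>auto simp: k_def e_def\<close>)
    ultimately show ?thesis by (simp add: e_def)
  qed
  have lin: "?l \<in> disc n" using s(1) big(2) V_nonneg by (simp add: disc_def)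
  have "mu v n = ?l"
    unfolding mu_def
  proof (rule the_equality)
    show "{l \<in> disc n. hill_eigenvalue v Dirichlet l} = {?l} \<and> alg_mult v Dirichlet ?l = 1"
      using only simple1 simple2 lin by blast
    fix m assume "{l \<in> disc n. hill_eigenvalue v Dirichlet l} = {m} \<and> alg_mult v Dirichlet m = 1"
    moreover have "?l \<in> {l \<in> disc n. hill_eigenvalue v Dirichlet l}" using simple1 lin by simp
    ultimately show "m = ?l" by auto
  qed
  with that s show thesis by blast
qed

end

section \<open>Comparison of the two problems\<close>

text \<open>
  Wronskians of the solution \<open>s\<close> with \<open>s 0 = 0\<close> against the Dirichlet eigenfunction \<open>y\<close>
  and against two Floquet solutions \<open>p\<close> and \<open>r\<close> eliminate the values of \<open>s\<close> at \<open>pi\<close>.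
\<close>
lemma comparison_identity:
  assumes p: "hill_sol v l1 p p1" "floquet n p p1" and r: "hill_sol v l2 r r1" "floquet n r r1"
    and s: "hill_sol v l1 s s1" "s 0 = 0" "s1 0 = of_nat n" and y: "hill_sol v m y y1" "y 0 = 0" "y pi = 0"
  shows "(l1 - m) * integral {0..pi} (\<lambda>x. s x * y x) * (p 0 * r1 0 - p1 0 * r 0)
       = (l1 - l2) * p 0 * integral {0..pi} (\<lambda>x. s x * r x) * ((-1) ^ n * y1 pi)"
proof -
  define e :: complex where "e = (-1) ^ n"
  have e: "e * e = 1" by (simp add: e_def flip: power_add)
  have pb: "p pi = e * p 0" "p1 pi = e * p1 0" and rb: "r pi = e * r 0" "r1 pi = e * r1 0"
    using p r by (simp_all add: floquet_def e_def)
  have 1: "(l1 - m) * integral {0..pi} (\<lambda>x. s x * y x) = s pi * y1 pi"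
    using lagrange_identity_integral[OF s(1) y(1)] s y by simp
  have 2: "(l1 - l2) * integral {0..pi} (\<lambda>x. s x * r x) = e * (s pi * r1 0 - s1 pi * r 0) + of_nat n * r 0"
    using lagrange_identity_integral[OF s(1) r(1)] s unfolding rb by (simp add: algebra_simps)
  have 3: "e * s1 pi * p 0 = e * s pi * p1 0 + of_nat n * p 0"
    using lagrange_identity_integral[OF s(1) p(1)] s unfolding pb by (simp add: algebra_simps)
  have 4: "(l1 - l2) * integral {0..pi} (\<lambda>x. s x * r x) * p 0 = e * s pi * (p 0 * r1 0 - p1 0 * r 0)"
  proof -
    have "(l1 - l2) * integral {0..pi} (\<lambda>x. s x * r x) * p 0
        = e * s pi * r1 0 * p 0 - (e * s1 pi * p 0) * r 0 + of_nat n * r 0 * p 0"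
      unfolding 2 by (simp add: algebra_simps)
    thus ?thesis unfolding 3 by (simp add: algebra_simps)
  qed
  have "(l1 - l2) * p 0 * integral {0..pi} (\<lambda>x. s x * r x) * (e * y1 pi)
      = ((l1 - l2) * integral {0..pi} (\<lambda>x. s x * r x) * p 0) * (e * y1 pi)" by (simp add: mult_ac)
  also have "\<dots> = (e * e) * (s pi * y1 pi) * (p 0 * r1 0 - p1 0 * r 0)" unfolding 4 by (simp add: mult_ac)
  also have "\<dots> = (l1 - m) * integral {0..pi} (\<lambda>x. s x * y x) * (p 0 * r1 0 - p1 0 * r 0)"
    unfolding e 1 by simp
  finally show ?thesis by (simp add: e_def)
qed

text \<open>
  The resonant part of a Mathieu function: \<open>2 cos (n z)\<close> for \<open>sg = 1\<close> and \<open>2 i sin (n z)\<close> for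
  \<open>sg = -1\<close>.
\<close>
definition wave :: "complex \<Rightarrow> nat \<Rightarrow> complex \<Rightarrow> complex" where
  "wave sg n z = exp (\<i> * of_nat n * z) + sg * exp (- (\<i> * of_nat n * z))"

lemma norm_exp_nat_le: "cmod (exp (\<i> * of_nat n * z)) \<le> exp (n * \<bar>Im z\<bar>)" "cmod (exp (- (\<i> * of_nat n * z))) \<le> exp (n * \<bar>Im z\<bar>)"
  using mult_left_mono[of "- Im z" "\<bar>Im z\<bar>" "real n"] mult_left_mono[of "Im z" "\<bar>Im z\<bar>" "real n"]
  by (simp_all add: norm_exp_eq_Re)

lemma norm_wave_le:
  assumes "cmod sg = 1"
  shows "cmod (wave sg n z) \<le> 2 * exp (n * \<bar>Im z\<bar>)"
proof -
  have "cmod (wave sg n z) \<le> cmod (exp (\<i> * of_nat n * z)) + cmod (sg * exp (- (\<i> * of_nat n * z)))"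
    unfolding wave_def by (rule norm_triangle_ineq)
  moreover have "cmod (sg * exp (- (\<i> * of_nat n * z))) = cmod (exp (- (\<i> * of_nat n * z)))"
    unfolding norm_mult assms by (rule mult_1_left)
  ultimately show ?thesis using norm_exp_nat_le[of n z] by linarith
qed

text \<open>Off the real axis one of the two exponentials dominates.\<close>
lemma norm_wave_ge:
  assumes sg: "cmod sg = 1" and n: "1 \<le> n * \<bar>Im z\<bar>"
  shows "exp (n * \<bar>Im z\<bar>) / 2 \<le> cmod (wave sg n z)"
proof -
  let ?u = "n * \<bar>Im z\<bar>"
  have "exp ?u - exp (- ?u) \<le> cmod (wave sg n z)"
  proof (cases "Im z \<ge> 0")
    case True
    have "cmod (sg * exp (- (\<i> * of_nat n * z))) - cmod (exp (\<i> * of_nat n * z)) \<le> cmod (wave sg n z)"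
      unfolding wave_def by (metis add.commute norm_diff_ineq)
    thus ?thesis using True sg by (simp add: norm_mult norm_exp_eq_Re)
  next
    case False
    have "cmod (exp (\<i> * of_nat n * z)) - cmod (sg * exp (- (\<i> * of_nat n * z))) \<le> cmod (wave sg n z)"
      unfolding wave_def by (rule norm_diff_ineq)
    thus ?thesis using False sg by (simp add: norm_mult norm_exp_eq_Re)
  qed
  moreover have "exp (- ?u) \<le> exp ?u / 2"
  proof -
    have "2 \<le> 1 + (?u + ?u)" using n by simp
    also have "\<dots> \<le> exp (?u + ?u)" by (rule exp_ge_add_one_self)
    finally have "2 * exp (- ?u) \<le> exp (?u + ?u) * exp (- ?u)" by (intro mult_right_mono) auto
    thus ?thesis by (simp flip: exp_add)
  qed
  ultimately show ?thesis by linarith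
qed

text \<open>
  Multiplied by \<open>c\<^sup>n\<close> this becomes \<open>a\<^sup>n + b\<^sup>n + 2 sg c\<^sup>n\<close> at \<open>z = t\<close>.
\<close>
lemma wave_square:
  assumes "sg * sg = 1"
  shows "(wave sg n z)\<^sup>2 = exp (2 * \<i> * z) ^ n + exp (- (2 * \<i> * z)) ^ n + 2 * sg"
proof -
  have e: "exp (2 * \<i> * z) ^ n = exp (\<i> * of_nat n * z) * exp (\<i> * of_nat n * z)"
    "exp (- (2 * \<i> * z)) ^ n = exp (- (\<i> * of_nat n * z)) * exp (- (\<i> * of_nat n * z))"
    by (simp_all flip: exp_add exp_of_nat_mult add: algebra_simps)
  have inv: "exp (\<i> * of_nat n * z) * exp (- (\<i> * of_nat n * z)) = 1" by (simp flip: exp_add)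
  have "(wave sg n z)\<^sup>2 = exp (\<i> * of_nat n * z) * exp (\<i> * of_nat n * z)
     + 2 * sg * (exp (\<i> * of_nat n * z) * exp (- (\<i> * of_nat n * z)))
     + (sg * sg) * (exp (- (\<i> * of_nat n * z)) * exp (- (\<i> * of_nat n * z)))"
    by (simp add: wave_def power2_eq_square algebra_simps)
  thus ?thesis unfolding inv assms e by simp
qed

lemma wave_sine_integral:
  assumes "n > 0"
  shows "((\<lambda>x. sin (of_nat n * of_real x) * wave (- sg) n (of_real x + z)) has_integral (\<i> * pi / 2 * wave sg n z)) {0..pi}"
proof -
  let ?s = "\<lambda>x. sin (of_nat n * complex_of_real x)" and ?c = "\<lambda>x. cos (of_nat n * complex_of_real x)"
  let ?p = "exp (\<i> * of_nat n * z)" and ?m = "exp (- (\<i> * of_nat n * z))"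
  have "((\<lambda>x. (?p - sg * ?m) * (?s x * ?c x) + (\<i> * (?p + sg * ?m)) * (?s x * ?s x)) has_integral
      ((?p - sg * ?m) * 0 + (\<i> * (?p + sg * ?m)) * of_real (pi / 2))) {0..pi}"
    by (intro has_integral_add has_integral_mult_right sin_sin_integral assms)
  moreover have "(?p - sg * ?m) * (?s x * ?c x) + (\<i> * (?p + sg * ?m)) * (?s x * ?s x)
      = ?s x * wave (- sg) n (of_real x + z)" for x
  proof -
    have 1: "exp (\<i> * of_nat n * (of_real x + z)) = (?c x + \<i> * ?s x) * ?p"
      by (simp add: exp_Euler[symmetric] algebra_simps flip: exp_add)
    have 2: "exp (- (\<i> * of_nat n * (of_real x + z))) = (?c x - \<i> * ?s x) * ?m"
      by (simp add: exp_minus_Euler[symmetric] algebra_simps flip: exp_add)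
    show ?thesis unfolding wave_def 1 2 by (simp add: algebra_simps)
  qed
  ultimately show ?thesis by (simp add: wave_def mult_ac)
qed

lemma mathieu_fun_approx:
  assumes m: "m (int n) = 1" "m 0 = sg" "\<And>i. cmod (m i) \<le> q ^ res_dist n i" and n: "n \<ge> 1"
    and q: "0 \<le> q" "q * exp (2 * rho) \<le> 1 / 2" and z: "\<bar>Im z\<bar> \<le> rho"
  shows "cmod (trig_series n m z - wave sg n z) \<le> exp (n * rho) * (8 * (q * exp (2 * rho)))"
  using trig_series_approx(2)[OF n q, of 1 z m] z m by (simp add: wave_def add.commute)

lemma mathieu_fun_deriv_approx:
  assumes m: "m (int n) = 1" "m 0 = sg" "\<And>i. cmod (m i) \<le> q ^ res_dist n i" and n: "n \<ge> 1"
    and q: "0 \<le> q" "4 * q \<le> 1 / 2"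
  shows "cmod (trig_series n (\<lambda>i. \<i> * freq n i * m i) 0 - \<i> * of_nat n * (1 - sg)) \<le> n * (32 * q)"
proof -
  have b: "cmod (\<i> * freq n i * m i) \<le> n * (4 * q) ^ res_dist n i" for i
  proof -
    have "cmod (\<i> * freq n i * m i) \<le> (real n * 4 ^ res_dist n i) * q ^ res_dist n i"
      unfolding norm_mult using norm_freq_le[OF n, of i] m(3)[of i] by (auto intro!: mult_mono)
    thus ?thesis by (simp add: power_mult_distrib mult_ac)
  qed
  have "cmod (trig_series n (\<lambda>i. \<i> * freq n i * m i) 0 - (\<i> * freq n 0 * m 0 * exp (- (\<i> * of_nat n * 0)) +
     \<i> * freq n (int n) * m (int n) * exp (\<i> * of_nat n * 0))) \<le> n * exp (real n * 0) * (8 * (4 * q * exp (2 * 0)))"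
    by (rule trig_series_approx(2)[OF n, of "4 * q" 0 n 0 "\<lambda>i. \<i> * freq n i * m i"]) (use q b in auto)
  thus ?thesis by (simp add: freq_def m algebra_simps)
qed

context mathieu_pair begin

definition wronskian :: "complex \<Rightarrow> complex" where
  "wronskian z = trig_series n A z * trig_series n (\<lambda>i. \<i> * freq n i * B i) z
     - trig_series n (\<lambda>i. \<i> * freq n i * A i) z * trig_series n B z"

lemma q_bounds: "4 * q \<le> 1 / 2" "\<bar>Im t\<bar> \<le> r \<Longrightarrow> r \<le> rho \<Longrightarrow> 8 * (q * exp (2 * r)) \<le> 1"
proof -
  have "32 * q * 1 \<le> 32 * q * exp (2 * rho)" using q_small(1) rho_pos by (intro mult_left_mono) auto
  thus "4 * q \<le> 1 / 2" using q_small(1,2) by linarith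
  assume r: "r \<le> rho"
  have "q * exp (2 * r) \<le> q * exp (2 * rho)" using r q_small(1) by (intro mult_left_mono) auto
  thus "8 * (q * exp (2 * r)) \<le> 1" using q_small(2) q_small(1) by linarith
qed

text \<open>
  At the origin the two Mathieu functions and their derivatives are close to those of \<open>wave sg n\<close> and
  \<open>wave (- sg) n\<close>, and no exponentially large terms occur.
\<close>
lemma wronskian_center: "cmod (wronskian 0 - 4 * \<i> * of_nat n * sg) \<le> real n * (224 * q)"
proof -
  have n1: "n \<ge> 1" using n2 by simp
  have q1: "q * exp (2 * 0) \<le> 1 / 2" using q_bounds(1) q_small(1) by simp
  define e1 where "e1 = trig_series n A 0 - (1 + sg)"
  define e2 where "e2 = trig_series n (\<lambda>i. \<i> * freq n i * A i) 0 - \<i> * of_nat n * (1 - sg)"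
  define e3 where "e3 = trig_series n B 0 - (1 - sg)"
  define e4 where "e4 = trig_series n (\<lambda>i. \<i> * freq n i * B i) 0 - \<i> * of_nat n * (1 + sg)"
  have 1: "cmod e1 \<le> 8 * q" unfolding e1_def
    using mathieu_fun_approx[OF A(2-4) n1 q_small(1) q1, of 0] by (simp add: wave_def)
  have 3: "cmod e3 \<le> 8 * q" unfolding e3_def
    using mathieu_fun_approx[OF B(2-4) n1 q_small(1) q1, of 0] by (simp add: wave_def)
  have 2: "cmod e2 \<le> n * (32 * q)" unfolding e2_def by (rule mathieu_fun_deriv_approx[OF A(2-4) n1 q_small(1) q_bounds(1)])
  have 4: "cmod e4 \<le> n * (32 * q)" unfolding e4_def
    using mathieu_fun_deriv_approx[OF B(2-4) n1 q_small(1) q_bounds(1)] by simp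
  have s2: "cmod (1 + sg) \<le> 2" "cmod (1 - sg) \<le> 2"
    using norm_triangle_ineq[of 1 sg] norm_triangle_ineq4[of 1 sg] sg by simp_all
  have gen: "cmod (e * (\<i> * of_nat n * w) + (w * e' + e * e')) \<le> n * (112 * q)"
    if "cmod e \<le> 8 * q" "cmod e' \<le> n * (32 * q)" "cmod w \<le> 2" for e e' w
  proof -
    have w: "real n * cmod w \<le> real n * 2" using that(3) by (intro mult_left_mono) auto
    have "cmod (e * (\<i> * of_nat n * w)) = cmod e * (real n * cmod w)" by (simp add: norm_mult)
    also have "\<dots> \<le> (8 * q) * (real n * 2)" by (rule mult_mono[OF that(1) w]) (use q_small(1) in auto)
    finally have "cmod (e * (\<i> * of_nat n * w)) \<le> (8 * q) * (real n * 2)" .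
    moreover have "cmod (w * e') \<le> 2 * (n * (32 * q))"
      unfolding norm_mult using that by (intro mult_mono) auto
    moreover have "cmod (e * e') \<le> 1 * (n * (32 * q))"
      unfolding norm_mult using that q_bounds(1) by (intro mult_mono) auto
    ultimately show ?thesis
      using norm_triangle_ineq[of "e * (\<i> * of_nat n * w)" "w * e' + e * e'"] norm_triangle_ineq[of "w * e'" "e * e'"]
      by (simp add: algebra_simps)
  qed
  have "wronskian 0 = ((1 + sg) + e1) * (\<i> * of_nat n * (1 + sg) + e4) - (\<i> * of_nat n * (1 - sg) + e2) * ((1 - sg) + e3)"
    by (simp add: wronskian_def e1_def e2_def e3_def e4_def)
  also have "\<dots> = 4 * \<i> * of_nat n * sg + (e1 * (\<i> * of_nat n * (1 + sg)) + ((1 + sg) * e4 + e1 * e4))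
      - (e3 * (\<i> * of_nat n * (1 - sg)) + ((1 - sg) * e2 + e3 * e2))"
    by (simp add: algebra_simps)
  finally have "wronskian 0 - 4 * \<i> * of_nat n * sg = (e1 * (\<i> * of_nat n * (1 + sg)) + ((1 + sg) * e4 + e1 * e4))
      - (e3 * (\<i> * of_nat n * (1 - sg)) + ((1 - sg) * e2 + e3 * e2))" by simp
  also have "cmod \<dots> \<le> n * (112 * q) + n * (112 * q)"
    by (rule order_trans[OF norm_triangle_ineq4 add_mono[OF gen[OF 1 4 s2(1)] gen[OF 3 2 s2(2)]]])
  finally show ?thesis by (simp add: algebra_simps)
qed

lemma norm_series_le:
  assumes z: "\<bar>Im z\<bar> \<le> \<bar>Im t\<bar>"
  shows "cmod (trig_series n A z) \<le> 3 * exp (n * \<bar>Im t\<bar>)" "cmod (trig_series n B z) \<le> 3 * exp (n * \<bar>Im t\<bar>)"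
proof -
  have n1: "n \<ge> 1" using n2 by simp
  have q8: "8 * (q * exp (2 * \<bar>Im t\<bar>)) \<le> 1" using q_bounds(2) rho by simp
  hence q1: "q * exp (2 * \<bar>Im t\<bar>) \<le> 1 / 2" using q_small(1) by simp
  have mn: "exp (n * \<bar>Im z\<bar>) \<le> exp (n * \<bar>Im t\<bar>)" using z by (simp add: mult_left_mono)
  have e: "exp (n * \<bar>Im t\<bar>) * (8 * (q * exp (2 * \<bar>Im t\<bar>))) \<le> exp (n * \<bar>Im t\<bar>) * 1"
    using q8 by (intro mult_left_mono) auto
  have gen: "cmod w \<le> 3 * E" if "cmod (w - w') \<le> X" "X \<le> E * 1" "cmod w' \<le> 2 * E'" "E' \<le> E" for w w' and X E E' :: real
    using norm_triangle_sub[of w w'] that by linarith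
  have sg': "cmod (- sg) = 1" using sg by simp
  show "cmod (trig_series n A z) \<le> 3 * exp (n * \<bar>Im t\<bar>)"
    by (rule gen[OF mathieu_fun_approx[OF A(2-4) n1 q_small(1) q1 z] e norm_wave_le[OF sg(2)] mn])
  show "cmod (trig_series n B z) \<le> 3 * exp (n * \<bar>Im t\<bar>)"
    by (rule gen[OF mathieu_fun_approx[OF B(2-4) n1 q_small(1) q1 z] e norm_wave_le[OF sg'] mn])
qed

text \<open>
  The derivative of the Wronskian is \<open>dA - dB\<close> times the product of the two functions.
\<close>
lemma wronskian_at_shift:
  "cmod (wronskian t - wronskian 0) \<le> cmod (dA - dB) * (9 * exp (n * \<bar>Im t\<bar>) * exp (n * \<bar>Im t\<bar>)) * cmod t"
proof -
  let ?S = "closed_segment 0 t"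
  have n1: "n \<ge> 1" using n2 by simp
  have strip: "\<bar>Im z\<bar> \<le> \<bar>Im t\<bar>" if z: "z \<in> ?S" for z
  proof -
    obtain u where u: "0 \<le> u" "u \<le> 1" "z = u *\<^sub>R t" using z by (auto simp: in_segment)
    thus ?thesis using mult_right_mono[of u 1 "\<bar>Im t\<bar>"] by (simp add: abs_mult)
  qed
  have d: "(wronskian has_field_derivative (dA - dB) * (trig_series n A z * trig_series n B z)) (at z within ?S)"
    if z: "z \<in> ?S" for z
  proof -
    have zr: "\<bar>Im z\<bar> < rho" using strip[OF z] rho by linarith
    note EA = trig_series_mathieu_equation[OF A(1) n1 q_small(1,2) A(4) zr]
    note EB = trig_series_mathieu_equation[OF B(1) n1 q_small(1,2) B(4) zr]
    have "(wronskian has_field_derivative (dA - dB) * (trig_series n A z * trig_series n B z)) (at z)"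
      unfolding wronskian_def[abs_def]
      by (rule DERIV_cong[OF DERIV_diff[OF DERIV_mult[OF EA(1) EB(2)] DERIV_mult[OF EA(2) EB(1)]]])
        (simp add: algebra_simps)
    thus ?thesis by (rule has_field_derivative_at_within)
  qed
  have "cmod (wronskian t - wronskian 0) \<le> (cmod (dA - dB) * (9 * exp (n * \<bar>Im t\<bar>) * exp (n * \<bar>Im t\<bar>))) * cmod (t - 0)"
  proof (rule field_differentiable_bound[OF convex_closed_segment d])
    fix z assume z: "z \<in> ?S"
    have "cmod (trig_series n A z) * cmod (trig_series n B z) \<le> (3 * exp (n * \<bar>Im t\<bar>)) * (3 * exp (n * \<bar>Im t\<bar>))"
      using norm_series_le[OF strip[OF z]] by (intro mult_mono) auto
    thus "cmod ((dA - dB) * (trig_series n A z * trig_series n B z)) \<le> cmod (dA - dB) * (9 * exp (n * \<bar>Im t\<bar>) * exp (n * \<bar>Im t\<bar>))"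
      unfolding norm_mult by (intro mult_left_mono) auto
  qed auto
  thus ?thesis by simp
qed

lemma mathieu_fun_0_approx:
  assumes "1 \<le> n * \<bar>Im t\<bar>"
  shows "cmod (mathieu_fun n t A 0 - wave sg n t) \<le> (16 * (q * exp (2 * \<bar>Im t\<bar>))) * cmod (wave sg n t)"
proof -
  have n1: "n \<ge> 1" using n2 by simp
  have q8: "8 * (q * exp (2 * \<bar>Im t\<bar>)) \<le> 1" using q_bounds(2) rho by simp
  hence q1: "q * exp (2 * \<bar>Im t\<bar>) \<le> 1 / 2" using q_small(1) by simp
  have "cmod (mathieu_fun n t A 0 - wave sg n t) \<le> exp (n * \<bar>Im t\<bar>) * (8 * (q * exp (2 * \<bar>Im t\<bar>)))"
    using mathieu_fun_approx[OF A(2-4) n1 q_small(1) q1 order_refl] by (simp add: mathieu_fun_def)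
  also have "\<dots> \<le> (2 * cmod (wave sg n t)) * (8 * (q * exp (2 * \<bar>Im t\<bar>)))"
    using norm_wave_ge[OF sg(2) assms] q_small(1) by (intro mult_right_mono) auto
  finally show ?thesis by (simp add: mult_ac)
qed

text \<open>
  The relative error is small because \<open>norm_wave_ge\<close> bounds the main term from below by the same
  exponential that bounds the error.
\<close>
lemma sine_overlap_approx:
  assumes s: "hill_sol v (of_nat n ^ 2 + dA) s s1" "s 0 = 0" "s1 0 = of_nat n"
    and k: "pi * (cmod a + cmod b + cmod dA) / n \<le> k" "k \<le> 1 / 2" and t1: "1 \<le> n * \<bar>Im t\<bar>"
  shows "cmod (integral {0..pi} (\<lambda>x. s x * mathieu_fun n t B x) - \<i> * pi / 2 * wave sg n t)
     \<le> (4 * (6 * k + 8 * (q * exp (2 * \<bar>Im t\<bar>)))) * cmod (\<i> * pi / 2 * wave sg n t)"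
proof -
  have n1: "n \<ge> 1" "n > 0" using n2 by simp_all
  have q8: "8 * (q * exp (2 * \<bar>Im t\<bar>)) \<le> 1" using q_bounds(2) rho by simp
  hence q1: "q * exp (2 * \<bar>Im t\<bar>) \<le> 1 / 2" using q_small(1) by simp
  let ?e = "exp (n * \<bar>Im t\<bar>)"
  have Bc: "continuous_on {0..pi} (mathieu_fun n t B)"
    by (rule hill_sol_continuous(1)[OF mathieu_fun_solution(1)[OF B(1) n1(1) q_small(1,2) B(4) rho]])
  have "cmod (integral {0..pi} (\<lambda>x. s x * mathieu_fun n t B x) - \<i> * pi / 2 * wave sg n t)
     \<le> pi * (?e * (6 * k + 8 * (q * exp (2 * \<bar>Im t\<bar>))))"
  proof (rule has_integral_perturb[OF integrable_integral wave_sine_integral[OF n1(2)]])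
    show "(\<lambda>x. s x * mathieu_fun n t B x) integrable_on {0..pi}"
      by (intro integrable_continuous_interval continuous_intros Bc hill_sol_continuous(1)[OF s(1)])
    fix x assume x: "x \<in> {0..pi}"
    have im: "\<bar>Im (of_real x + t)\<bar> \<le> \<bar>Im t\<bar>" by simp
    note S = sine_solution_bounds[OF s n1(2) k x]
    have k0: "0 \<le> k" using order_trans[OF norm_ge_zero S(2)] by simp
    have M: "cmod (mathieu_fun n t B x) \<le> 3 * ?e" unfolding mathieu_fun_def by (rule norm_series_le(2)[OF im])
    have W: "cmod (mathieu_fun n t B x - wave (- sg) n (of_real x + t)) \<le> ?e * (8 * (q * exp (2 * \<bar>Im t\<bar>)))"
      unfolding mathieu_fun_def by (rule mathieu_fun_approx[OF B(2-4) n1(1) q_small(1) q1 im])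
    let ?s = "sin (of_nat n * complex_of_real x)"
    have "s x * mathieu_fun n t B x - ?s * wave (- sg) n (of_real x + t)
       = (s x - ?s) * mathieu_fun n t B x + ?s * (mathieu_fun n t B x - wave (- sg) n (of_real x + t))" by (simp add: algebra_simps)
    also have "cmod \<dots> \<le> cmod (s x - ?s) * cmod (mathieu_fun n t B x) + cmod ?s * cmod (mathieu_fun n t B x - wave (- sg) n (of_real x + t))"
      by (simp add: norm_triangle_le norm_mult)
    also have "\<dots> \<le> (2 * k) * (3 * ?e) + 1 * (?e * (8 * (q * exp (2 * \<bar>Im t\<bar>))))"
      by (intro add_mono mult_mono) (use S M W norm_sin_nat_le[of n x] k0 in auto)
    also have "\<dots> = ?e * (6 * k + 8 * (q * exp (2 * \<bar>Im t\<bar>)))" by (simp add: algebra_simps)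
    finally show "cmod (s x * mathieu_fun n t B x - ?s * wave (- sg) n (of_real x + t)) \<le> ?e * (6 * k + 8 * (q * exp (2 * \<bar>Im t\<bar>)))" .
  qed
  also have "\<dots> \<le> pi * ((2 * cmod (wave sg n t)) * (6 * k + 8 * (q * exp (2 * \<bar>Im t\<bar>))))"
  proof -
    have "0 \<le> pi * (cmod a + cmod b + cmod dA) / n" by simp
    hence "0 \<le> k" using k(1) by linarith
    hence "0 \<le> 6 * k + 8 * (q * exp (2 * \<bar>Im t\<bar>))" using q_small(1) by simp
    thus ?thesis using norm_wave_ge[OF sg(2) t1] by (intro mult_left_mono mult_right_mono) auto
  qed
  also have "\<dots> = (4 * (6 * k + 8 * (q * exp (2 * \<bar>Im t\<bar>)))) * cmod (\<i> * pi / 2 * wave sg n t)"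
    by (simp add: norm_mult norm_divide)
  finally show ?thesis .
qed

end

section \<open>Limits\<close>

lemma ratio_limitI:
  fixes f g :: "nat \<Rightarrow> complex"
  assumes "\<forall>\<^sub>F n in sequentially. cmod (f n - g n) \<le> e n * cmod (g n)" "\<forall>\<^sub>F n in sequentially. g n \<noteq> 0" "e \<longlonglongrightarrow> 0"
  shows "(\<lambda>n. f n / g n) \<longlonglongrightarrow> 1"
proof -
  have "\<forall>\<^sub>F n in sequentially. norm (f n / g n - 1) \<le> e n"
    using assms(1,2)
  proof eventually_elim
    case (elim n)
    have "f n / g n - 1 = (f n - g n) / g n" using elim by (simp add: diff_divide_distrib)
    thus ?case using elim by (simp add: norm_divide pos_divide_le_eq)
  qed
  from Lim_null_comparison[OF this assms(3)] show ?thesis by (rule LIM_zero_cancel)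
qed

lemma eventually_choice:
  assumes "\<forall>\<^sub>F n in sequentially. \<exists>x. P n x"
  obtains f where "\<forall>\<^sub>F n in sequentially. P n (f n)"
proof
  show "\<forall>\<^sub>F n in sequentially. P n (SOME x. P n x)"
    using assms by (rule eventually_mono) (rule someI_ex)
qed

lemma eventually_const_over_n: "0 < e \<Longrightarrow> \<forall>\<^sub>F n in sequentially. C / real n < e"
  by (rule order_tendstoD(2)[OF lim_const_over_n])

lemma eventually_real_gt: "\<forall>\<^sub>F n in sequentially. C < real n"
  using filterlim_real_sequentially unfolding filterlim_at_top_dense by blast

lemma limit_if:
  fixes f g :: "nat \<Rightarrow> complex"
  assumes "f \<longlonglongrightarrow> l" "g \<longlonglongrightarrow> l"
  shows "(\<lambda>n. if Q n then f n else g n) \<longlonglongrightarrow> l"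
proof (rule tendstoI)
  fix e :: real assume "e > 0"
  with assms have "\<forall>\<^sub>F n in sequentially. dist (f n) l < e" "\<forall>\<^sub>F n in sequentially. dist (g n) l < e"
    by (auto intro: tendstoD)
  thus "\<forall>\<^sub>F n in sequentially. dist (if Q n then f n else g n) l < e" by eventually_elim auto
qed

context shifted_mathieu begin

lemma eventually_wave_nonzero:
  assumes "Im t \<noteq> 0"
  shows "\<forall>\<^sub>F n in sequentially. 1 \<le> n * \<bar>Im t\<bar>"
  using eventually_real_gt[of "1 / \<bar>Im t\<bar>"]
proof eventually_elim
  case (elim n)
  thus ?case using assms by (simp add: field_simps)
qed

text \<open>
  The five factors of \<open>comparison_identity\<close> are compared with their leading terms \<open>wave sg n t\<close>,
  \<open>(i pi / 2) wave sg n t\<close>, \<open>n\<close>, \<open>4 i n sg\<close> and \<open>pi / 2\<close>. Hypothesis \<open>w\<close> makes the difference of the two parameters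
  negligible even against the square of the exponential growth of \<open>wave\<close>.
\<close>
lemma eigenvalue_ratio_limit:
  fixes d1 d2 del :: "nat \<Rightarrow> complex" and A1 A2 :: "nat \<Rightarrow> int \<Rightarrow> complex" and y y1 :: "nat \<Rightarrow> real \<Rightarrow> complex"
  assumes t: "Im t \<noteq> 0"
    and mp: "\<forall>\<^sub>F n in sequentially. mathieu_pair a b c t n rho K (2 * cmod c / n) (d1 n) (d2 n) sg (A1 n) (A2 n)"
    and d1: "\<forall>\<^sub>F n in sequentially. cmod (d1 n) \<le> 1"
    and w: "(\<lambda>n. cmod (d1 n - d2 n) * (exp (n * \<bar>Im t\<bar>) * exp (n * \<bar>Im t\<bar>))) \<longlonglongrightarrow> 0"
    and y: "\<forall>\<^sub>F n in sequentially. hill_sol v (of_nat n ^ 2 + del n) (y n) (y1 n) \<and> y n 0 = 0 \<and> y n pi = 0 \<and>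
        y1 n 0 = of_nat n \<and> cmod (del n) \<le> R"
    and sg: "sg * sg = 1" "cmod sg = 1"
  shows "(\<lambda>n. (d1 n - del n) / ((d1 n - d2 n) * (sg * (wave sg n t)\<^sup>2 / 4))) \<longlonglongrightarrow> 1"
proof -
  define V where "V = cmod a + cmod b"
  define R' where "R' = max 1 R"
  define k where "k = (\<lambda>n::nat. pi * (V + R') / n)"
  have k0: "k \<longlonglongrightarrow> 0" unfolding k_def by (rule lim_const_over_n)
  have kev: "\<forall>\<^sub>F n in sequentially. k n \<le> 1 / 4"
    using order_tendstoD(2)[OF k0, of "1/4"] by (auto elim: eventually_mono)
  have kd: "pi * (V + cmod d) / n \<le> k n" if "cmod d \<le> 1 \<or> cmod d \<le> R" for d n
    unfolding k_def using that by (intro divide_right_mono mult_left_mono) (auto simp: R'_def)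
  have n0: "\<forall>\<^sub>F n in sequentially. n > 0" by (rule eventually_gt_at_top)
  note wn = eventually_wave_nonzero[OF t]
  have wz: "wave s n t \<noteq> 0" if "1 \<le> n * \<bar>Im t\<bar>" "cmod s = 1" for s n
  proof -
    have "0 < exp (n * \<bar>Im t\<bar>) / 2" by simp
    also have "\<dots> \<le> cmod (wave s n t)" by (rule norm_wave_ge[OF that(2,1)])
    finally show ?thesis by auto
  qed
  have "\<forall>\<^sub>F n in sequentially. \<exists>ss. hill_sol v (of_nat n ^ 2 + d1 n) (fst ss) (snd ss) \<and> fst ss 0 = 0 \<and> snd ss 0 = of_nat n"
    using d1 kev n0
  proof eventually_elim
    case (elim n)
    have "2 * pi * (V + cmod (d1 n)) / n = 2 * (pi * (V + cmod (d1 n)) / n)" by simp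
    also have "\<dots> \<le> 1 / 2" using kd[of "d1 n" n] elim by linarith
    finally have b: "2 * pi * (V + cmod (d1 n)) / n \<le> 1 / 2" .
    obtain s s1 where "hill_sol v (of_nat n ^ 2 + d1 n) s s1" "s 0 = 0" "s1 0 = of_nat n"
      by (rule sine_solution_exists[OF v_cont v_bound elim(3), of "d1 n" "1 / 2"]) (use b in \<open>auto simp: V_def\<close>)
    thus ?case by (intro exI[of _ "(s, s1)"]) simp
  qed
  then obtain ss where ss: "\<forall>\<^sub>F n in sequentially. hill_sol v (of_nat n ^ 2 + d1 n) (fst (ss n)) (snd (ss n)) \<and> fst (ss n) 0 = 0 \<and> snd (ss n) 0 = of_nat n"
    by (rule eventually_choice)
  define s where "s = (\<lambda>n. fst (ss n))"
  define s1 where "s1 = (\<lambda>n. snd (ss n))"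
  have s: "\<forall>\<^sub>F n in sequentially. hill_sol v (of_nat n ^ 2 + d1 n) (s n) (s1 n) \<and> s n 0 = 0 \<and> s1 n 0 = of_nat n"
    using ss by (simp add: s_def s1_def)
  define Q where "Q = (\<lambda>n::nat. 2 * cmod c / n)"
  have Q0: "Q \<longlonglongrightarrow> 0" unfolding Q_def by (rule lim_const_over_n)
  define p0 where "p0 = (\<lambda>n. mathieu_fun n t (A1 n) 0)"
  define I1 where "I1 = (\<lambda>n. integral {0..pi} (\<lambda>x. s n x * y n x))"
  define I2 where "I2 = (\<lambda>n. integral {0..pi} (\<lambda>x. s n x * mathieu_fun n t (A2 n) x))"
  define Y where "Y = (\<lambda>n. (-1) ^ n * y1 n pi)"
  define W where "W = (\<lambda>n. mathieu_fun n t (A1 n) 0 * mathieu_fun_deriv n t (A2 n) 0 - mathieu_fun_deriv n t (A1 n) 0 * mathieu_fun n t (A2 n) 0)"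
  have L1: "(\<lambda>n. p0 n / wave sg n t) \<longlonglongrightarrow> 1"
  proof (rule ratio_limitI)
    show "\<forall>\<^sub>F n in sequentially. cmod (p0 n - wave sg n t) \<le> 16 * (Q n * exp (2 * \<bar>Im t\<bar>)) * cmod (wave sg n t)"
      using mp wn
    proof eventually_elim
      case (elim n)
      thus ?case using mathieu_pair.mathieu_fun_0_approx[OF elim] by (simp add: p0_def Q_def)
    qed
    show "\<forall>\<^sub>F n in sequentially. wave sg n t \<noteq> 0" using wn by eventually_elim (rule wz[OF _ sg(2)])
    show "(\<lambda>n. 16 * (Q n * exp (2 * \<bar>Im t\<bar>))) \<longlonglongrightarrow> 0"
      by (rule tendsto_eq_intros refl Q0 | simp)+
  qed
  have L2: "(\<lambda>n. I2 n / (\<i> * pi / 2 * wave sg n t)) \<longlonglongrightarrow> 1"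
  proof (rule ratio_limitI)
    show "\<forall>\<^sub>F n in sequentially. cmod (I2 n - \<i> * pi / 2 * wave sg n t) \<le>
       (4 * (6 * k n + 8 * (Q n * exp (2 * \<bar>Im t\<bar>)))) * cmod (\<i> * pi / 2 * wave sg n t)"
      using mp wn s d1 kev
    proof eventually_elim
      case (elim n)
      have S: "hill_sol v (of_nat n ^ 2 + d1 n) (s n) (s1 n)" "s n 0 = 0" "s1 n 0 = of_nat n" using elim by auto
      have kk: "pi * (cmod a + cmod b + cmod (d1 n)) / n \<le> k n" "k n \<le> 1/2"
        using kd[of "d1 n" n] elim by (simp_all add: V_def)
      show ?case using mathieu_pair.sine_overlap_approx[OF elim(1) S kk elim(2)] by (simp add: I2_def Q_def)
    qed
    show "\<forall>\<^sub>F n in sequentially. \<i> * pi / 2 * wave sg n t \<noteq> 0" using wn 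
    proof eventually_elim
      case (elim n)
      show ?case using wz[OF elim sg(2)] by simp
    qed
    show "(\<lambda>n. 4 * (6 * k n + 8 * (Q n * exp (2 * \<bar>Im t\<bar>)))) \<longlonglongrightarrow> 0"
      by (rule tendsto_eq_intros refl Q0 k0 | simp)+
  qed
  have L3: "(\<lambda>n. Y n / of_nat n) \<longlonglongrightarrow> 1"
  proof (rule ratio_limitI)
    show "\<forall>\<^sub>F n in sequentially. cmod (Y n - of_nat n) \<le> (2 * k n) * cmod (of_nat n)"
      using y kev n0
    proof eventually_elim
      case (elim n)
      have kk: "pi * (V + cmod (del n)) / n \<le> k n" using kd[of "del n" n] elim by blast
      hence kk2: "pi * (cmod a + cmod b + cmod (del n)) / n \<le> 1 / 2" using elim(2) unfolding V_def by linarith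
      have E: "hill_sol v (of_nat n ^ 2 + del n) (y n) (y1 n)" "y n 0 = 0" "y1 n 0 = of_nat n" using elim(1) by auto
      have "cmod (y1 n pi * (-1) ^ n - of_nat n) \<le> pi * (2 * (V + cmod (del n)))"
        unfolding V_def by (rule sine_solution_endpoint_slope[OF E elim(3) kk2])
      also have "\<dots> = 2 * (pi * (V + cmod (del n)) / n) * n" using elim(3) by simp
      also have "\<dots> \<le> 2 * k n * n" using kk by (intro mult_right_mono) auto
      finally show ?case by (simp add: Y_def mult.commute)
    qed
    show "\<forall>\<^sub>F n in sequentially. complex_of_nat n \<noteq> 0" using n0 by eventually_elim simp
    show "(\<lambda>n. 2 * k n) \<longlonglongrightarrow> 0" by (rule tendsto_eq_intros refl k0 | simp)+
  qed
  have L4: "(\<lambda>n. W n / (4 * \<i> * of_nat n * sg)) \<longlonglongrightarrow> 1"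
  proof (rule ratio_limitI)
    let ?w = "\<lambda>n. cmod (d1 n - d2 n) * (exp (n * \<bar>Im t\<bar>) * exp (n * \<bar>Im t\<bar>))"
    show "\<forall>\<^sub>F n in sequentially. cmod (W n - 4 * \<i> * of_nat n * sg) \<le> (56 * Q n + 9 * cmod t * ?w n) * cmod (4 * \<i> * of_nat n * sg)"
      using mp n0
    proof eventually_elim
      case (elim n)
      interpret M: mathieu_pair a b c t n rho K "2 * cmod c / n" "d1 n" "d2 n" sg "A1 n" "A2 n" by (rule elim)
      have Wt: "W n = M.wronskian t" by (simp add: W_def M.wronskian_def mathieu_fun_def mathieu_fun_deriv_def)
      have "cmod (W n - 4 * \<i> * of_nat n * sg) \<le> cmod (M.wronskian t - M.wronskian 0) + cmod (M.wronskian 0 - 4 * \<i> * of_nat n * sg)"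
        unfolding Wt using norm_triangle_ineq[of "M.wronskian t - M.wronskian 0" "M.wronskian 0 - 4 * \<i> * of_nat n * sg"] by simp
      also have "\<dots> \<le> cmod (d1 n - d2 n) * (9 * exp (n * \<bar>Im t\<bar>) * exp (n * \<bar>Im t\<bar>)) * cmod t + real n * (224 * (2 * cmod c / n))"
        by (intro add_mono M.wronskian_at_shift M.wronskian_center)
      also have "\<dots> = (9 * cmod t * ?w n) * 1 + (56 * Q n) * (4 * real n)" by (simp add: Q_def mult_ac)
      also have "\<dots> \<le> (9 * cmod t * ?w n) * (4 * real n) + (56 * Q n) * (4 * real n)"
        using elim(2) by (intro add_mono mult_left_mono) (auto simp: Q_def)
      also have "\<dots> = (56 * Q n + 9 * cmod t * ?w n) * cmod (4 * \<i> * of_nat n * sg)"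
        using sg(2) by (simp add: norm_mult algebra_simps)
      finally show ?case .
    qed
    show "\<forall>\<^sub>F n in sequentially. 4 * \<i> * complex_of_nat n * sg \<noteq> 0"
      using n0
    proof eventually_elim
      case (elim n)
      thus ?case using sg(2) by auto
    qed
    show "(\<lambda>n. 56 * Q n + 9 * cmod t * ?w n) \<longlonglongrightarrow> 0"
      by (rule tendsto_eq_intros refl Q0 w | simp)+
  qed
  have L5: "(\<lambda>n. I1 n / of_real (pi / 2)) \<longlonglongrightarrow> 1"
  proof (rule ratio_limitI)
    show "\<forall>\<^sub>F n in sequentially. cmod (I1 n - of_real (pi / 2)) \<le> (12 * k n) * cmod (of_real (pi / 2))"
      using y s d1 kev n0
    proof eventually_elim
      case (elim n)
      have kk: "pi * (V + cmod (del n)) / n \<le> k n" "pi * (V + cmod (d1 n)) / n \<le> k n"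
        using kd[of "del n" n] kd[of "d1 n" n] elim by blast+
      have "cmod (I1 n - of_real (pi / 2)) \<le> pi * (6 * k n)"
        unfolding I1_def
        by (rule dirichlet_products_nonzero[of n "d1 n" "s n" "s1 n" "del n" "y n" "y1 n"])
          (use elim kk in \<open>auto simp: V_def\<close>)
      thus ?case by simp
    qed
    show "\<forall>\<^sub>F n in sequentially. complex_of_real (pi / 2) \<noteq> 0" by simp
    show "(\<lambda>n. 12 * k n) \<longlonglongrightarrow> 0" by (rule tendsto_eq_intros refl k0 | simp)+
  qed
  have "(\<lambda>n. (p0 n / wave sg n t) * (I2 n / (\<i> * pi / 2 * wave sg n t)) * (Y n / of_nat n) /
     ((W n / (4 * \<i> * of_nat n * sg)) * (I1 n / of_real (pi / 2)))) \<longlonglongrightarrow> 1 * 1 * 1 / (1 * 1)"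
    by (intro tendsto_divide tendsto_mult L1 L2 L3 L4 L5) simp
  moreover have "\<forall>\<^sub>F n in sequentially. (p0 n / wave sg n t) * (I2 n / (\<i> * pi / 2 * wave sg n t)) * (Y n / of_nat n) /
     ((W n / (4 * \<i> * of_nat n * sg)) * (I1 n / of_real (pi / 2))) =
     (d1 n - del n) / ((d1 n - d2 n) * (sg * (wave sg n t)\<^sup>2 / 4))"
  proof -
    have "\<forall>\<^sub>F n in sequentially. W n / (4 * \<i> * of_nat n * sg) \<noteq> 0" by (rule tendsto_imp_eventually_ne[OF L4]) simp
    moreover have "\<forall>\<^sub>F n in sequentially. I1 n / of_real (pi / 2) \<noteq> 0" by (rule tendsto_imp_eventually_ne[OF L5]) simp
    ultimately show ?thesis using mp wn n0 s y
    proof eventually_elim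
      case (elim n)
      interpret M: mathieu_pair a b c t n rho K "2 * cmod c / n" "d1 n" "d2 n" sg "A1 n" "A2 n" by (rule elim)
      have n1: "n \<ge> 1" using M.n2 by simp
      have W0: "W n \<noteq> 0" "I1 n \<noteq> 0" using elim(1,2) by auto
      have E0: "wave sg n t \<noteq> 0" by (rule wz[OF elim(4) sg(2)])
      have sg0: "sg \<noteq> 0" using sg by auto
      have S: "hill_sol v (of_nat n ^ 2 + d1 n) (s n) (s1 n)" "s n 0 = 0" "s1 n 0 = of_nat n" using elim by auto
      have Y': "hill_sol v (of_nat n ^ 2 + del n) (y n) (y1 n)" "y n 0 = 0" "y n pi = 0" using elim by auto
      have "(of_nat n ^ 2 + d1 n - (of_nat n ^ 2 + del n)) * I1 n * W n
         = (of_nat n ^ 2 + d1 n - (of_nat n ^ 2 + d2 n)) * p0 n * I2 n * Y n"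
        unfolding I1_def W_def p0_def I2_def Y_def
        by (rule comparison_identity[OF M.eigenfunction_A mathieu_fun_solution[OF M.B(1) n1 M.q_small(1,2) M.B(4) M.rho] S Y'])
      hence id: "(d1 n - del n) * I1 n * W n = (d1 n - d2 n) * p0 n * I2 n * Y n" by simp
      have d: "d1 n - d2 n \<noteq> 0" using M.ne by simp
      have "(p0 n / wave sg n t) * (I2 n / (\<i> * pi / 2 * wave sg n t)) * (Y n / of_nat n) /
         ((W n / (4 * \<i> * of_nat n * sg)) * (I1 n / of_real (pi / 2)))
         = (p0 n * I2 n * Y n) * (4 * sg) / ((wave sg n t)\<^sup>2 * (I1 n * W n))"
        using W0 E0 elim(5) sg0 by (simp add: field_simps power2_eq_square)
      also have "\<dots> = ((d1 n - d2 n) * p0 n * I2 n * Y n) * (4 * sg) / ((d1 n - d2 n) * (wave sg n t)\<^sup>2 * (I1 n * W n))"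
        using d by (simp add: mult.assoc)
      also have "\<dots> = ((d1 n - del n) * (I1 n * W n)) * (4 * sg) / ((d1 n - d2 n) * (wave sg n t)\<^sup>2 * (I1 n * W n))"
        unfolding id[symmetric] by (simp add: mult.assoc)
      also have "\<dots> = (d1 n - del n) * (4 * sg) / ((d1 n - d2 n) * (wave sg n t)\<^sup>2)"
      proof -
        have "(x * w) * k / (e * w) = x * k / e" if "w \<noteq> 0" for x w k e :: complex using that by simp
        thus ?thesis using W0 by simp
      qed
      also have "\<dots> = (d1 n - del n) / ((d1 n - d2 n) * (sg * (wave sg n t)\<^sup>2 / 4))"
      proof -
        have "4 * sg = 4 / sg" using sg(1) sg0 by (simp add: eq_divide_eq mult.assoc)
        moreover have "x * (4 / sg) / (d * e) = x / (d * (sg * e / 4))" for x d e :: complex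
          by (simp add: mult_ac)
        ultimately show ?thesis by simp
      qed
      finally show ?case .
    qed
  qed
  ultimately show ?thesis using Lim_transform_eventually by fastforce
qed

end

lemma power_over_fact_pred_tendsto_0: "(\<lambda>n. X ^ n / fact (n - 1) :: real) \<longlonglongrightarrow> 0"
proof (rule LIMSEQ_imp_Suc)
  have "(\<lambda>n. inverse (fact n) * X ^ n) \<longlonglongrightarrow> 0"
    by (rule summable_LIMSEQ_zero[OF summable_exp])
  from tendsto_mult_left[OF this, of X]
  show "(\<lambda>n. X ^ Suc n / fact (Suc n - 1)) \<longlonglongrightarrow> 0" by (simp add: divide_inverse mult_ac)
qed

context shifted_mathieu begin

definition gap_scale :: "nat \<Rightarrow> complex" where
  "gap_scale n = 8 * c ^ n / (4 ^ n * (fact (n - 1))\<^sup>2)"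

lemma gap_scale_nonzero: "gap_scale n \<noteq> 0"
  using c0 by (simp add: gap_scale_def)

text \<open>
  The factorials beat every geometric growth.
\<close>
lemma gap_scale_small:
  fixes r :: real
  assumes "0 \<le> r"
  shows "(\<lambda>n. cmod (gap_scale n) * (exp (n * r) * exp (n * r))) \<longlonglongrightarrow> 0"
proof (rule Lim_null_comparison[OF always_eventually])
  define X where "X = cmod c * (exp r * exp r)"
  show "\<forall>n. norm (cmod (gap_scale n) * (exp (n * r) * exp (n * r))) \<le> 8 * (X ^ n / fact (n - 1))"
  proof
    fix n
    have f: "1 \<le> (fact (n - 1) :: real)" by (rule fact_ge_1)
    have e: "exp (n * r) = exp r ^ n" by (rule exp_of_nat_mult)
    have "cmod (gap_scale n) * (exp (n * r) * exp (n * r)) = 8 * X ^ n / (4 ^ n * (fact (n - 1) * fact (n - 1)))"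
      unfolding e by (simp add: gap_scale_def X_def norm_mult norm_divide norm_power power_mult_distrib power2_eq_square mult_ac)
    also have "\<dots> \<le> 8 * X ^ n / (1 * (fact (n - 1) * 1))"
      using f by (intro divide_left_mono mult_mono) (auto simp: X_def intro!: mult_pos_pos)
    finally show "norm (cmod (gap_scale n) * (exp (n * r) * exp (n * r))) \<le> 8 * (X ^ n / fact (n - 1))" by simp
  qed
  show "(\<lambda>n. 8 * (X ^ n / fact (n - 1))) \<longlonglongrightarrow> 0"
    using tendsto_mult_left[OF power_over_fact_pred_tendsto_0[of X], of 8] by simp
qed

lemma c_times_exp: "c * exp (2 * \<i> * t) = b" "c * exp (- (2 * \<i> * t)) = a"
  by (simp_all add: a b)

lemma gap_scale_wave:
  assumes "sg * sg = 1"
  shows "gap_scale n * ((wave sg n t)\<^sup>2 / 4) = 2 / (4 ^ n * (fact (n - 1))\<^sup>2) * (a ^ n + b ^ n + 2 * sg * c ^ n)"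
proof -
  have "c ^ n * (wave sg n t)\<^sup>2 = (c * exp (2 * \<i> * t)) ^ n + (c * exp (- (2 * \<i> * t))) ^ n + 2 * sg * c ^ n"
    unfolding wave_square[OF assms] power_mult_distrib by (simp add: algebra_simps)
  hence w: "c ^ n * (wave sg n t)\<^sup>2 = a ^ n + b ^ n + 2 * sg * c ^ n" unfolding c_times_exp by (simp add: add_ac)
  have "gap_scale n * ((wave sg n t)\<^sup>2 / 4) = 2 / (4 ^ n * (fact (n - 1))\<^sup>2) * (c ^ n * (wave sg n t)\<^sup>2)"
    by (simp add: gap_scale_def field_simps)
  thus ?thesis unfolding w .
qed

text \<open>
  Here \<open>|a| \<noteq> |b|\<close> enters through \<open>Im t \<noteq> 0\<close>: \<open>(a\<^sup>n + b\<^sup>n) / c\<^sup>n\<close> is \<open>2 cos (2 n t)\<close>, which is exponentially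
  large.
\<close>
lemma ratio_c_powers:
  assumes t: "Im t \<noteq> 0"
  shows "(\<lambda>n. c ^ n / (a ^ n + b ^ n)) \<longlonglongrightarrow> 0" "\<forall>\<^sub>F n in sequentially. a ^ n + b ^ n \<noteq> 0"
proof -
  have ev: "\<forall>\<^sub>F n in sequentially. a ^ n + b ^ n \<noteq> 0 \<and> norm (c ^ n / (a ^ n + b ^ n)) \<le> (4 / \<bar>Im t\<bar>) / real n"
    using eventually_real_gt[of "7 / \<bar>Im t\<bar>"] eventually_wave_nonzero[OF t]
  proof eventually_elim
    case (elim n)
    define u where "u = n * \<bar>Im t\<bar>"
    have u: "7 < u" using elim t by (simp add: u_def field_simps)
    define E where "E = (wave 1 n t)\<^sup>2"
    have "(exp u / 2)\<^sup>2 \<le> (cmod (wave 1 n t))\<^sup>2"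
      unfolding u_def by (rule power_mono[OF norm_wave_ge[OF _ elim(2)]]) auto
    hence "exp u * exp u / 4 \<le> cmod E" by (simp add: E_def norm_mult power2_eq_square)
    hence "exp (u + u) / 4 \<le> cmod E" unfolding exp_add .
    moreover have "1 + (u + u) \<le> exp (u + u)" by (rule exp_ge_add_one_self)
    moreover have "cmod E \<le> cmod (E - 2) + 2" using norm_triangle_ineq2[of E 2] by simp
    ultimately have E2: "u / 4 \<le> cmod (E - 2)" using u by linarith
    hence E0: "E - 2 \<noteq> 0" using u by auto
    have "a ^ n + b ^ n = c ^ n * (E - 2)"
    proof -
      have "c ^ n * (E - 2) = (c * exp (2 * \<i> * t)) ^ n + (c * exp (- (2 * \<i> * t))) ^ n"
        unfolding E_def wave_square[of 1, simplified] power_mult_distrib by (simp add: algebra_simps)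
      thus ?thesis unfolding c_times_exp by simp
    qed
    moreover have "norm (1 / (E - 2)) \<le> 1 / (u / 4)"
      unfolding norm_divide norm_one using E2 u E0 by (intro divide_left_mono) auto
    moreover have "1 / (u / 4) = (4 / \<bar>Im t\<bar>) / real n" by (simp add: u_def mult.commute)
    ultimately show ?case using E0 c0 by simp
  qed
  show "\<forall>\<^sub>F n in sequentially. a ^ n + b ^ n \<noteq> 0" using ev by eventually_elim blast
  show "(\<lambda>n. c ^ n / (a ^ n + b ^ n)) \<longlonglongrightarrow> 0"
    by (rule Lim_null_comparison[OF _ lim_const_over_n]) (use ev in \<open>eventually_elim; blast\<close>)
qed

text \<open>
  The Mathieu functions and the Dirichlet eigenfunction exist for all large \<open>n\<close>; choosing one for each such
  \<open>n\<close> turns the estimates for a single \<open>n\<close> into limits.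
\<close>
lemma eigenvalue_asymptotics:
  assumes t: "Im t \<noteq> 0"
  obtains lc ls :: "nat \<Rightarrow> complex" where
    "\<forall>\<^sub>F n in sequentially. lambda_minus v n = ls n \<and> lambda_plus v n = lc n \<or> lambda_minus v n = lc n \<and> lambda_plus v n = ls n"
    "(\<lambda>n. (lc n - ls n) / gap_scale n) \<longlonglongrightarrow> 1"
    "(\<lambda>n. (lc n - mu v n) / (2 / (4 ^ n * (fact (n - 1))\<^sup>2) * (a ^ n + b ^ n + 2 * c ^ n))) \<longlonglongrightarrow> 1"
    "(\<lambda>n. (ls n - mu v n) / (2 / (4 ^ n * (fact (n - 1))\<^sup>2) * (a ^ n + b ^ n - 2 * c ^ n))) \<longlonglongrightarrow> 1"
proof -
  define V where "V = cmod a + cmod b"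
  define rho where "rho = \<bar>Im t\<bar> + 1"
  define K where "K = cmod a + cmod b + cmod c"
  define Q where "Q = (\<lambda>n::nat. 2 * cmod c / n)"
  define sol where "sol = (\<lambda>n sg d m. mathieu_seq c n d m \<and> m (int n) = 1 \<and> m 0 = sg \<and>
     (\<forall>i. m (int n - i) = sg * m i) \<and> (\<forall>i. cmod (m i) \<le> Q n ^ res_dist n i) \<and> cmod d \<le> 2 * cmod c * Q n)"
  have ev0: "\<forall>\<^sub>F n in sequentially. n \<ge> 2 \<and> Q n \<le> 1 / 8"
  proof -
    have "\<forall>\<^sub>F n in sequentially. 2 * cmod c / real n < 1 / 8" by (rule eventually_const_over_n) simp
    with eventually_ge_at_top[of 2] show ?thesis by eventually_elim (simp add: Q_def)
  qed
  have ex: "\<forall>\<^sub>F n in sequentially. \<exists>dm. sol n sg (fst dm) (snd dm)" if sg: "sg * sg = 1" "cmod sg = 1" for sg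
    using ev0
  proof eventually_elim
    case (elim n)
    obtain d m where "mathieu_seq c n d m" "m (int n) = 1" "m 0 = sg"
      "\<And>i. m (int n - i) = sg * m i" "\<And>i. cmod (m i) \<le> Q n ^ res_dist n i" "cmod d \<le> 2 * cmod c * Q n"
      by (rule mathieu_seq_exists[of n c "Q n" sg]) (use elim sg in \<open>auto simp: Q_def\<close>)
    thus ?case by (intro exI[of _ "(d, m)"]) (simp add: sol_def)
  qed
  have s1: "(1::complex) * 1 = 1" "cmod 1 = 1" and sm: "(-1::complex) * -1 = 1" "cmod (-1) = 1" by simp_all
  obtain dm where dm: "\<forall>\<^sub>F n in sequentially. sol n 1 (fst (dm n)) (snd (dm n))"
    by (rule eventually_choice[OF ex[OF s1]])
  obtain em where em: "\<forall>\<^sub>F n in sequentially. sol n (-1) (fst (em n)) (snd (em n))"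
    by (rule eventually_choice[OF ex[OF sm]])
  define dA A where "dA = (\<lambda>n. fst (dm n))" and "A = (\<lambda>n. snd (dm n))"
  define dB B where "dB = (\<lambda>n. fst (em n))" and "B = (\<lambda>n. snd (em n))"
  have A: "\<forall>\<^sub>F n in sequentially. sol n 1 (dA n) (A n)" and B: "\<forall>\<^sub>F n in sequentially. sol n (-1) (dB n) (B n)"
    using dm em by (simp_all add: dA_def A_def dB_def B_def)
  have gap: "\<forall>\<^sub>F n in sequentially. \<exists>SP. (dA n - dB n) * (fst SP * snd SP) = 2 * gap_scale n \<and> dA n \<noteq> dB n \<and>
      cmod (fst SP - 2) \<le> 24 * Q n \<and> cmod (snd SP - 1) \<le> exp (8 * (cmod c)\<^sup>2 / n) - 1"
    using ev0 A B
  proof eventually_elim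
    case (elim n)
    have n2: "n \<ge> 2" and q8: "Q n \<le> 1 / 8" using elim by auto
    obtain S where S: "(dA n - dB n) * S * shoot c n (dB n) n = 4 * c" "cmod (S - 2) \<le> 24 * Q n"
      by (rule mathieu_gap[of c n "dA n" "A n" "Q n" "dB n" "B n"]) (use elim c0 in \<open>auto simp: sol_def Q_def\<close>)
    obtain P where P: "shoot c n (dB n) n * c ^ (n - 1) = 4 ^ (n - 1) * (fact (n - 1))\<^sup>2 * P"
      "cmod (P - 1) \<le> exp (8 * (cmod c)\<^sup>2 / n) - 1"
      by (rule shoot_asymptotics[of n c "Q n" "dB n"]) (use elim c0 in \<open>auto simp: sol_def Q_def\<close>)
    let ?F = "4 ^ (n - 1) * (fact (n - 1))\<^sup>2 :: complex"
    have F0: "?F \<noteq> 0" by simp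
    have pw: "(4::complex) ^ n = 4 * 4 ^ (n - 1)" "c ^ n = c * c ^ (n - 1)" using n2 by (cases n; simp)+
    have "(dA n - dB n) * (S * P) * ?F = (dA n - dB n) * S * (shoot c n (dB n) n * c ^ (n - 1))"
      unfolding P(1) by (simp add: mult_ac)
    also have "\<dots> = ((dA n - dB n) * S * shoot c n (dB n) n) * c ^ (n - 1)" by (simp add: mult_ac)
    also have "\<dots> = 4 * c ^ n" unfolding S(1) pw by simp
    finally have "(dA n - dB n) * (S * P) = 4 * c ^ n / ?F" using F0 by (simp add: eq_divide_eq)
    also have "\<dots> = 2 * gap_scale n" unfolding gap_scale_def pw by simp
    finally have "(dA n - dB n) * (S * P) = 2 * gap_scale n" .
    moreover from this have "dA n \<noteq> dB n" using gap_scale_nonzero[of n] by auto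
    ultimately show ?case using S(2) P(2) by (intro exI[of _ "(S, P)"]) simp
  qed
  then obtain SP where SP: "\<forall>\<^sub>F n in sequentially. (dA n - dB n) * (fst (SP n) * snd (SP n)) = 2 * gap_scale n \<and> dA n \<noteq> dB n \<and>
      cmod (fst (SP n) - 2) \<le> 24 * Q n \<and> cmod (snd (SP n) - 1) \<le> exp (8 * (cmod c)\<^sup>2 / n) - 1"
    by (rule eventually_choice)
  have Q0: "Q \<longlonglongrightarrow> 0" unfolding Q_def by (rule lim_const_over_n)
  have LS: "(\<lambda>n. fst (SP n)) \<longlonglongrightarrow> 2"
  proof (rule LIM_zero_cancel, rule Lim_null_comparison)
    show "\<forall>\<^sub>F n in sequentially. norm (fst (SP n) - 2) \<le> 24 * Q n" using SP by eventually_elim blast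
    show "(\<lambda>n. 24 * Q n) \<longlonglongrightarrow> 0" by (rule tendsto_eq_intros refl Q0 | simp)+
  qed
  have LP: "(\<lambda>n. snd (SP n)) \<longlonglongrightarrow> 1"
  proof (rule LIM_zero_cancel, rule Lim_null_comparison)
    show "\<forall>\<^sub>F n in sequentially. norm (snd (SP n) - 1) \<le> exp (8 * (cmod c)\<^sup>2 / n) - 1" using SP by eventually_elim blast
    have "(\<lambda>n. exp (8 * (cmod c)\<^sup>2 / real n) - 1) \<longlonglongrightarrow> exp 0 - 1" by (intro tendsto_intros lim_const_over_n)
    thus "(\<lambda>n. exp (8 * (cmod c)\<^sup>2 / real n) - 1) \<longlonglongrightarrow> 0" by simp
  qed
  have Lgap: "(\<lambda>n. (dA n - dB n) / gap_scale n) \<longlonglongrightarrow> 1"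
  proof -
    have "(\<lambda>n. 2 / (fst (SP n) * snd (SP n))) \<longlonglongrightarrow> 2 / (2 * 1)" by (intro tendsto_intros LS LP) simp
    moreover have "\<forall>\<^sub>F n in sequentially. 2 / (fst (SP n) * snd (SP n)) = (dA n - dB n) / gap_scale n"
      using SP
    proof eventually_elim
      case (elim n)
      have "fst (SP n) * snd (SP n) \<noteq> 0" using elim gap_scale_nonzero[of n] by auto
      moreover have "(dA n - dB n) * (fst (SP n) * snd (SP n)) = 2 * gap_scale n" using elim by blast
      ultimately show ?case using gap_scale_nonzero[of n] by (simp add: divide_eq_eq eq_divide_eq)
    qed
    ultimately show ?thesis using Lim_transform_eventually by fastforce
  qed
  have Lw: "(\<lambda>n. cmod (dA n - dB n) * (exp (n * \<bar>Im t\<bar>) * exp (n * \<bar>Im t\<bar>))) \<longlonglongrightarrow> 0"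
  proof -
    have "(\<lambda>n. cmod ((dA n - dB n) / gap_scale n) * (cmod (gap_scale n) * (exp (n * \<bar>Im t\<bar>) * exp (n * \<bar>Im t\<bar>)))) \<longlonglongrightarrow> cmod 1 * 0"
      by (rule tendsto_mult[OF tendsto_norm[OF Lgap] gap_scale_small[OF abs_ge_zero]])
    moreover have "cmod ((dA n - dB n) / gap_scale n) * (cmod (gap_scale n) * r) = cmod (dA n - dB n) * r" for n r
      using gap_scale_nonzero[of n] by (simp add: norm_divide)
    ultimately show ?thesis by simp
  qed
  have small: "\<forall>\<^sub>F n in sequentially. cmod (dA n) \<le> 1 \<and> cmod (dB n) \<le> 1 \<and> 4 < n"
  proof -
    have "\<forall>\<^sub>F n in sequentially. (2 * cmod c * (2 * cmod c)) / real n < 1" by (rule eventually_const_over_n) simp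
    thus ?thesis using A B eventually_gt_at_top[of 4]
    proof eventually_elim
      case (elim n)
      have "cmod (dA n) \<le> (2 * cmod c * (2 * cmod c)) / real n" "cmod (dB n) \<le> (2 * cmod c * (2 * cmod c)) / real n"
        using elim by (auto simp: sol_def Q_def)
      with elim(1,4) show ?case by linarith
    qed
  qed
  have mp: "\<forall>\<^sub>F n in sequentially. mathieu_pair a b c t n rho K (2 * cmod c / n) (dA n) (dB n) 1 (A n) (B n) \<and> cmod (dB n) < n / 4"
  proof -
    have "\<forall>\<^sub>F n in sequentially. (16 * (2 * K) * exp (2 * rho)) / real n < 1 / 2" by (rule eventually_const_over_n) simp
    thus ?thesis using A B small ev0 SP eventually_real_gt[of "16 * (cmod a + cmod b)"]
    proof eventually_elim
      case (elim n)
      have f1: "16 * (2 * K / n) * exp (2 * rho) \<le> 1 / 2" using elim(1) by simp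
      have f2: "\<bar>Im t\<bar> < rho" "cmod a \<le> K" "cmod b \<le> K" "cmod c \<le> K" by (simp_all add: rho_def K_def)
      have f3: "cmod (dA n) < n / 4" "cmod (dB n) < n / 4" using elim(4) by auto
      have "mathieu_pair a b c t n rho K (2 * cmod c / n) (dA n) (dB n) 1 (A n) (B n)"
        by unfold_locales (use f1 f2 f3 elim in \<open>auto simp: sol_def Q_def\<close>)
      with f3 show ?case by blast
    qed
  qed
  have mpA: "\<forall>\<^sub>F n in sequentially. mathieu_pair a b c t n rho K (2 * cmod c / n) (dA n) (dB n) 1 (A n) (B n)"
    using mp by eventually_elim blast
  have mpB: "\<forall>\<^sub>F n in sequentially. mathieu_pair a b c t n rho K (2 * cmod c / n) (dB n) (dA n) (-1) (B n) (A n)"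
    using mp by eventually_elim (blast intro: mathieu_pair.swapped)
  have "\<forall>\<^sub>F n in sequentially. \<exists>z. hill_sol v (of_nat n ^ 2 + fst z) (fst (snd z)) (snd (snd z)) \<and> fst (snd z) 0 = 0 \<and> fst (snd z) pi = 0 \<and>
        snd (snd z) 0 = of_nat n \<and> cmod (fst z) \<le> 216 * V \<and> mu v n = of_nat n ^ 2 + fst z"
    using eventually_real_gt[of "16 * (pi * (217 * V))"] eventually_real_gt[of "1000 * V"] eventually_ge_at_top[of 1]
  proof eventually_elim
    case (elim n)
    obtain del s s1 where "cmod del \<le> 216 * V" "hill_sol v (of_nat n ^ 2 + del) s s1"
      "s 0 = 0" "s1 0 = of_nat n" "s pi = 0" "mu v n = of_nat n ^ 2 + del"
      by (rule dirichlet_eigenvalue[of n]) (use elim in \<open>auto simp: V_def\<close>)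
    thus ?case by (intro exI[of _ "(del, s, s1)"]) simp
  qed
  then obtain z where z: "\<forall>\<^sub>F n in sequentially. hill_sol v (of_nat n ^ 2 + fst (z n)) (fst (snd (z n))) (snd (snd (z n))) \<and> fst (snd (z n)) 0 = 0 \<and> fst (snd (z n)) pi = 0 \<and>
        snd (snd (z n)) 0 = of_nat n \<and> cmod (fst (z n)) \<le> 216 * V \<and> mu v n = of_nat n ^ 2 + fst (z n)"
    by (rule eventually_choice)
  define del where "del = (\<lambda>n. fst (z n))"
  have y: "\<forall>\<^sub>F n in sequentially. hill_sol v (of_nat n ^ 2 + del n) (fst (snd (z n))) (snd (snd (z n))) \<and> fst (snd (z n)) 0 = 0 \<and> fst (snd (z n)) pi = 0 \<and>
        snd (snd (z n)) 0 = of_nat n \<and> cmod (del n) \<le> 216 * V"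
    using z by eventually_elim (simp add: del_def)
  have mu: "\<forall>\<^sub>F n in sequentially. mu v n = of_nat n ^ 2 + del n" using z by eventually_elim (simp add: del_def)
  have bA: "\<forall>\<^sub>F n in sequentially. cmod (dA n) \<le> 1" and bB: "\<forall>\<^sub>F n in sequentially. cmod (dB n) \<le> 1"
    using small by (eventually_elim, blast)+
  note LA = eigenvalue_ratio_limit[OF t mpA bA Lw y s1]
  have Lw': "(\<lambda>n. cmod (dB n - dA n) * (exp (n * \<bar>Im t\<bar>) * exp (n * \<bar>Im t\<bar>))) \<longlonglongrightarrow> 0"
    using Lw by (simp add: norm_minus_commute)
  note LB = eigenvalue_ratio_limit[OF t mpB bB Lw' y sm]
  define lc ls where "lc = (\<lambda>n. of_nat n ^ 2 + dA n)" and "ls = (\<lambda>n. of_nat n ^ 2 + dB n)"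
  show thesis
  proof (rule that[of ls lc])
    have wz: "\<forall>\<^sub>F n in sequentially. 1 \<le> n * \<bar>Im t\<bar>" by (rule eventually_wave_nonzero[OF t])
    have q16: "\<forall>\<^sub>F n in sequentially. (16 * (2 * cmod c) * exp (2 * \<bar>Im t\<bar>)) / real n < 1" by (rule eventually_const_over_n) simp
    show "\<forall>\<^sub>F n in sequentially. lambda_minus v n = ls n \<and> lambda_plus v n = lc n \<or> lambda_minus v n = lc n \<and> lambda_plus v n = ls n"
      using mp mpB wz q16
    proof eventually_elim
      case (elim n)
      have nz: "m \<noteq> 0" if m: "cmod (m - wave sg n t) \<le> (16 * (2 * cmod c / n * exp (2 * \<bar>Im t\<bar>))) * cmod (wave sg n t)" and sg: "cmod sg = 1" for m sg
      proof
        assume "m = 0"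
        hence "1 * cmod (wave sg n t) \<le> (16 * (2 * cmod c / n * exp (2 * \<bar>Im t\<bar>))) * cmod (wave sg n t)" using m by simp
        moreover have "0 < cmod (wave sg n t)"
          using norm_wave_ge[OF sg elim(3)] exp_gt_zero[of "n * \<bar>Im t\<bar>"] by linarith
        ultimately have "1 \<le> 16 * (2 * cmod c / n * exp (2 * \<bar>Im t\<bar>))" using mult_le_cancel_right_pos by blast
        thus False using elim(4) by simp
      qed
      have "mathieu_fun n t (A n) 0 \<noteq> 0" by (rule nz[OF mathieu_pair.mathieu_fun_0_approx[OF _ elim(3)]]) (use elim in auto)
      moreover have "mathieu_fun n t (B n) 0 \<noteq> 0" by (rule nz[OF mathieu_pair.mathieu_fun_0_approx[OF elim(2,3)]]) simp
      ultimately show ?case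
        using mathieu_pair.lambda_values[of a b c t n rho K _ "dA n" "dB n" 1 "A n" "B n"] elim by (auto simp: lc_def ls_def)
    qed
    show "(\<lambda>n. (lc n - ls n) / gap_scale n) \<longlonglongrightarrow> 1" using Lgap by (simp add: lc_def ls_def)
    have wn: "wave s n t \<noteq> 0" if "1 \<le> n * \<bar>Im t\<bar>" "cmod s = 1" for s n
      using norm_wave_ge[OF that(2,1)] exp_gt_zero[of "n * \<bar>Im t\<bar>"] by auto
    show "(\<lambda>n. (lc n - mu v n) / (2 / (4 ^ n * (fact (n - 1))\<^sup>2) * (a ^ n + b ^ n + 2 * c ^ n))) \<longlonglongrightarrow> 1"
    proof (rule Lim_transform_eventually)
      show "(\<lambda>n. (dA n - del n) / ((dA n - dB n) * (1 * (wave 1 n t)\<^sup>2 / 4)) * ((dA n - dB n) / gap_scale n)) \<longlonglongrightarrow> 1"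
        using tendsto_mult[OF LA Lgap] by simp
      show "\<forall>\<^sub>F n in sequentially. (dA n - del n) / ((dA n - dB n) * (1 * (wave 1 n t)\<^sup>2 / 4)) * ((dA n - dB n) / gap_scale n) =
         (lc n - mu v n) / (2 / (4 ^ n * (fact (n - 1))\<^sup>2) * (a ^ n + b ^ n + 2 * c ^ n))"
        using SP mu wz
      proof eventually_elim
        case (elim n)
        have "(dA n - del n) / ((dA n - dB n) * (1 * (wave 1 n t)\<^sup>2 / 4)) * ((dA n - dB n) / gap_scale n)
          = (dA n - del n) / (gap_scale n * ((wave 1 n t)\<^sup>2 / 4))"
          using elim wn[OF elim(3), of 1] gap_scale_nonzero[of n] by (simp add: field_simps)
        thus ?case unfolding gap_scale_wave[OF s1(1)] using elim by (simp add: lc_def)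
      qed
    qed
    show "(\<lambda>n. (ls n - mu v n) / (2 / (4 ^ n * (fact (n - 1))\<^sup>2) * (a ^ n + b ^ n - 2 * c ^ n))) \<longlonglongrightarrow> 1"
    proof (rule Lim_transform_eventually)
      show "(\<lambda>n. (dB n - del n) / ((dB n - dA n) * (-1 * (wave (-1) n t)\<^sup>2 / 4)) * ((dA n - dB n) / gap_scale n)) \<longlonglongrightarrow> 1"
        using tendsto_mult[OF LB Lgap] by simp
      show "\<forall>\<^sub>F n in sequentially. (dB n - del n) / ((dB n - dA n) * (-1 * (wave (-1) n t)\<^sup>2 / 4)) * ((dA n - dB n) / gap_scale n) =
         (ls n - mu v n) / (2 / (4 ^ n * (fact (n - 1))\<^sup>2) * (a ^ n + b ^ n - 2 * c ^ n))"
        using SP mu wz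
      proof eventually_elim
        case (elim n)
        have "(dB n - dA n) * (-1 * (wave (-1) n t)\<^sup>2 / 4) = (dA n - dB n) * ((wave (-1) n t)\<^sup>2 / 4)"
          by (simp add: field_simps)
        moreover have "x / (d * e) * (d / g) = x / (g * e)" if "d \<noteq> 0" for x d e g :: complex
          using that by (simp add: mult.commute)
        moreover have "dA n - dB n \<noteq> 0" using elim by simp
        ultimately have "(dB n - del n) / ((dB n - dA n) * (-1 * (wave (-1) n t)\<^sup>2 / 4)) * ((dA n - dB n) / gap_scale n)
          = (dB n - del n) / (gap_scale n * ((wave (-1) n t)\<^sup>2 / 4))"
          by (simp only: not_False_eq_True)
        thus ?case unfolding gap_scale_wave[OF sm(1)] using elim by (simp add: ls_def)
      qed
    qed
  qed
qed

end

section \<open>The asymptotics\<close>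

theorem theorem16:
  fixes a b :: complex and v :: "real \<Rightarrow> complex"
  assumes "a \<noteq> 0" and "b \<noteq> 0" and "cmod a \<noteq> cmod b"
  defines "v \<equiv> two_exp_potential a b"
  shows "(\<exists>ra rb :: nat \<Rightarrow> complex.
      (\<forall>n. (ra n)\<^sup>2 = a ^ n \<and> (rb n)\<^sup>2 = b ^ n) \<and>
      (\<lambda>n. gap v n) \<simeq> (\<lambda>n. 8 * ra n * rb n / (4 ^ n * (fact (n - 1))\<^sup>2)) \<and>
      (\<lambda>n. mu v n - lambda_plus v n) \<simeq>
        (\<lambda>n. - (2 / (4 ^ n * (fact (n - 1))\<^sup>2)) * (a ^ n + b ^ n + 2 * ra n * rb n)) \<and>
      (\<lambda>n. mu v n - lambda_minus v n) \<simeq>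
        (\<lambda>n. - (2 / (4 ^ n * (fact (n - 1))\<^sup>2)) * (a ^ n + b ^ n - 2 * ra n * rb n))) \<and>
    (\<lambda>n. mu v n - (lambda_minus v n + lambda_plus v n) / 2) \<simeq>
      (\<lambda>n. - (2 / (4 ^ n * (fact (n - 1))\<^sup>2)) * (a ^ n + b ^ n))"
proof -
  \<comment> \<open>Any logarithm works: only \<open>exp (4 i t) = b / a\<close> matters.\<close>
  define t where "t = Ln (b / a) / (4 * \<i>)"
  define c where "c = a * exp (2 * \<i> * t)"
  have ba: "b / a \<noteq> 0" using assms(1,2) by simp
  have e4: "exp (2 * \<i> * t) * exp (2 * \<i> * t) = b / a"
  proof -
    have "exp (2 * \<i> * t) * exp (2 * \<i> * t) = exp (Ln (b / a))"
      unfolding exp_add[symmetric] by (simp add: t_def)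
    thus ?thesis using exp_Ln[OF ba] by simp
  qed
  have c0: "c \<noteq> 0" using assms(1) by (simp add: c_def)
  have ca: "a = c * exp (- (2 * \<i> * t))" by (simp add: c_def mult.assoc flip: exp_add)
  have cb: "b = c * exp (2 * \<i> * t)"
  proof -
    have "(a * w) * w = b" if "w * w = b / a" for w using that assms(1) by (simp add: mult.assoc)
    from this[OF e4] show ?thesis by (simp add: c_def)
  qed
  have tim: "Im t \<noteq> 0"
  proof
    assume "Im t = 0"
    hence "cmod (exp (2 * \<i> * t)) = 1" "cmod (exp (- (2 * \<i> * t))) = 1" by (simp_all add: norm_exp_eq_Re)
    hence "cmod a = cmod c" "cmod b = cmod c" using ca cb by (metis norm_mult mult.right_neutral)+
    thus False using assms(3) by simp
  qed
  have cc: "c * c = a * b"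
    by (subst cb) (simp add: c_def mult_ac)
  interpret shifted_mathieu a b c t by unfold_locales (rule c0 ca cb)+
  obtain lc ls where l: "\<forall>\<^sub>F n in sequentially. lambda_minus v n = ls n \<and> lambda_plus v n = lc n \<or> lambda_minus v n = lc n \<and> lambda_plus v n = ls n"
    and gap: "(\<lambda>n. (lc n - ls n) / gap_scale n) \<longlonglongrightarrow> 1"
    and lcmu: "(\<lambda>n. (lc n - mu v n) / (2 / (4 ^ n * (fact (n - 1))\<^sup>2) * (a ^ n + b ^ n + 2 * c ^ n))) \<longlonglongrightarrow> 1"
    and lsmu: "(\<lambda>n. (ls n - mu v n) / (2 / (4 ^ n * (fact (n - 1))\<^sup>2) * (a ^ n + b ^ n - 2 * c ^ n))) \<longlonglongrightarrow> 1"
    unfolding v_def by (rule eigenvalue_asymptotics[OF tim])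
  define X where "X = (\<lambda>n. (lc n - mu v n) / (2 / (4 ^ n * (fact (n - 1))\<^sup>2) * (a ^ n + b ^ n + 2 * c ^ n)))"
  define Y where "Y = (\<lambda>n. (ls n - mu v n) / (2 / (4 ^ n * (fact (n - 1))\<^sup>2) * (a ^ n + b ^ n - 2 * c ^ n)))"
  have XY: "X \<longlonglongrightarrow> 1" "Y \<longlonglongrightarrow> 1" using lcmu lsmu by (simp_all add: X_def Y_def)
  \<comment> \<open>Which of the two eigenvalues is the larger one may depend on \<open>n\<close>; the sign of \<open>rb\<close> records it.\<close>
  define pos where "pos = (\<lambda>n. lambda_plus v n = lc n \<and> lambda_minus v n = ls n)"
  define ra where "ra = (\<lambda>n. csqrt (a ^ n))"
  define rb where "rb = (\<lambda>n. (if pos n then 1 else -1) * c ^ n / ra n)"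
  have ra2: "(ra n)\<^sup>2 = a ^ n" and ra0: "ra n \<noteq> 0" for n using assms(1) by (simp_all add: ra_def)
  have rb2: "(rb n)\<^sup>2 = b ^ n" for n
  proof -
    have "(rb n)\<^sup>2 = (c ^ n)\<^sup>2 / a ^ n" unfolding rb_def power_divide ra2 by (simp add: power_mult_distrib)
    also have "(c ^ n)\<^sup>2 = a ^ n * b ^ n"
      by (metis cc power2_eq_square power_mult_distrib)
    finally show ?thesis using assms(1) by simp
  qed
  have rr: "ra n * rb n = (if pos n then 1 else -1) * c ^ n" for n using ra0[of n] by (simp add: rb_def)
  have rr2: "2 * ra n * rb n = 2 * ((if pos n then 1 else -1) * c ^ n)"
    "8 * ra n * rb n = 8 * ((if pos n then 1 else -1) * c ^ n)" for n
    using rr[of n] by (simp_all add: mult.assoc)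
  have cases: "\<forall>\<^sub>F n in sequentially. (pos n \<and> lambda_minus v n = ls n \<and> lambda_plus v n = lc n) \<or>
      (\<not> pos n \<and> lambda_minus v n = lc n \<and> lambda_plus v n = ls n)"
    using l by eventually_elim (auto simp: pos_def)
  have neg: "(x - y) / (- s * w) = (y - x) / (s * w)" for x y s w :: complex
    by (metis minus_diff_eq minus_divide_divide minus_mult_left)
  have g: "(\<lambda>n. gap v n) \<simeq> (\<lambda>n. 8 * ra n * rb n / (4 ^ n * (fact (n - 1))\<^sup>2))"
    unfolding ratio_equiv_def
  proof (rule Lim_transform_eventually[OF gap])
    show "\<forall>\<^sub>F n in sequentially. (lc n - ls n) / gap_scale n = gap v n / (8 * ra n * rb n / (4 ^ n * (fact (n - 1))\<^sup>2))"
      using cases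
    proof eventually_elim
      case (elim n)
      have "8 * ra n * rb n / (4 ^ n * (fact (n - 1))\<^sup>2) = (if pos n then 1 else -1) * gap_scale n"
        unfolding rr2 gap_scale_def by simp
      moreover have "gap v n = (if pos n then 1 else -1) * (lc n - ls n)" using elim by (auto simp: gap_def)
      ultimately show ?case by simp
    qed
  qed
  have p: "(\<lambda>n. mu v n - lambda_plus v n) \<simeq> (\<lambda>n. - (2 / (4 ^ n * (fact (n - 1))\<^sup>2)) * (a ^ n + b ^ n + 2 * ra n * rb n))"
    unfolding ratio_equiv_def
  proof (rule Lim_transform_eventually[OF limit_if[OF XY, of pos]])
    show "\<forall>\<^sub>F n in sequentially. (if pos n then X n else Y n) =
       (mu v n - lambda_plus v n) / (- (2 / (4 ^ n * (fact (n - 1))\<^sup>2)) * (a ^ n + b ^ n + 2 * ra n * rb n))"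
      using cases
    proof eventually_elim
      case (elim n)
      show ?case
      proof (cases "pos n")
        case True
        have "a ^ n + b ^ n + 2 * ra n * rb n = a ^ n + b ^ n + 2 * c ^ n" using True rr2(1)[of n] by simp
        moreover have "lambda_plus v n = lc n" using elim True by blast
        ultimately show ?thesis using True by (simp only: if_True neg X_def)
      next
        case False
        have "a ^ n + b ^ n + 2 * ra n * rb n = a ^ n + b ^ n - 2 * c ^ n" using False rr2(1)[of n] by simp
        moreover have "lambda_plus v n = ls n" using elim False by blast
        ultimately show ?thesis using False by (simp only: if_False neg Y_def)
      qed
    qed
  qed
  have m: "(\<lambda>n. mu v n - lambda_minus v n) \<simeq> (\<lambda>n. - (2 / (4 ^ n * (fact (n - 1))\<^sup>2)) * (a ^ n + b ^ n - 2 * ra n * rb n))"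
    unfolding ratio_equiv_def
  proof (rule Lim_transform_eventually[OF limit_if[OF XY(2,1), of pos]])
    show "\<forall>\<^sub>F n in sequentially. (if pos n then Y n else X n) =
       (mu v n - lambda_minus v n) / (- (2 / (4 ^ n * (fact (n - 1))\<^sup>2)) * (a ^ n + b ^ n - 2 * ra n * rb n))"
      using cases
    proof eventually_elim
      case (elim n)
      show ?case
      proof (cases "pos n")
        case True
        have "a ^ n + b ^ n - 2 * ra n * rb n = a ^ n + b ^ n - 2 * c ^ n" using True rr2(1)[of n] by simp
        moreover have "lambda_minus v n = ls n" using elim True by blast
        ultimately show ?thesis using True by (simp only: if_True neg Y_def)
      next
        case False
        have "a ^ n + b ^ n - 2 * ra n * rb n = a ^ n + b ^ n + 2 * c ^ n" using False rr2(1)[of n] by simp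
        moreover have "lambda_minus v n = lc n" using elim False by blast
        ultimately show ?thesis using False by (simp only: if_False neg X_def)
      qed
    qed
  qed
  have mean: "(\<lambda>n. mu v n - (lambda_minus v n + lambda_plus v n) / 2) \<simeq>
      (\<lambda>n. - (2 / (4 ^ n * (fact (n - 1))\<^sup>2)) * (a ^ n + b ^ n))"
    unfolding ratio_equiv_def
  proof (rule Lim_transform_eventually)
    define r where "r = (\<lambda>n. c ^ n / (a ^ n + b ^ n))"
    have r0: "r \<longlonglongrightarrow> 0" unfolding r_def by (rule ratio_c_powers(1)[OF tim])
    have "(\<lambda>n. (X n * (1 + 2 * r n) + Y n * (1 - 2 * r n)) / 2) \<longlonglongrightarrow> (1 * (1 + 2 * 0) + 1 * (1 - 2 * 0)) / 2"
      by (intro tendsto_intros XY r0) simp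
    thus "(\<lambda>n. (X n * (1 + 2 * r n) + Y n * (1 - 2 * r n)) / 2) \<longlonglongrightarrow> 1" by simp
    have X0: "\<forall>\<^sub>F n in sequentially. X n \<noteq> 0" "\<forall>\<^sub>F n in sequentially. Y n \<noteq> 0"
      by (rule tendsto_imp_eventually_ne[OF XY(1)], simp, rule tendsto_imp_eventually_ne[OF XY(2)], simp)
    show "\<forall>\<^sub>F n in sequentially. (X n * (1 + 2 * r n) + Y n * (1 - 2 * r n)) / 2 =
       (mu v n - (lambda_minus v n + lambda_plus v n) / 2) / (- (2 / (4 ^ n * (fact (n - 1))\<^sup>2)) * (a ^ n + b ^ n))"
      using X0 ratio_c_powers(2)[OF tim] cases
    proof eventually_elim
      case (elim n)
      let ?s = "2 / (4 ^ n * (fact (n - 1))\<^sup>2) :: complex"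
      define w where "w = a ^ n + b ^ n"
      have w0: "w \<noteq> 0" using elim(3) by (simp add: w_def)
      have s0: "?s \<noteq> 0" by simp
      have f: "x / (s * p) * (p / w) = x / (s * w)" if "p \<noteq> 0" for x s p :: complex using that by simp
      have rw: "1 + 2 * r n = (w + 2 * c ^ n) / w" "1 - 2 * r n = (w - 2 * c ^ n) / w"
        using w0 by (simp_all add: r_def w_def[symmetric] add_divide_distrib diff_divide_distrib)
      have wp: "w + 2 * c ^ n \<noteq> 0"
      proof
        assume "w + 2 * c ^ n = 0"
        hence "X n = 0" unfolding X_def w_def[symmetric] by (simp only: mult_zero_right div_by_0)
        with elim(1) show False by blast
      qed
      have wm: "w - 2 * c ^ n \<noteq> 0"
      proof
        assume "w - 2 * c ^ n = 0"
        hence "Y n = 0" unfolding Y_def w_def[symmetric] by (simp only: mult_zero_right div_by_0)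
        with elim(2) show False by blast
      qed
      have "X n * (1 + 2 * r n) = (lc n - mu v n) / (?s * w)"
        unfolding rw X_def w_def[symmetric] by (rule f[OF wp])
      moreover have "Y n * (1 - 2 * r n) = (ls n - mu v n) / (?s * w)"
        unfolding rw Y_def w_def[symmetric] by (rule f[OF wm])
      ultimately have "(X n * (1 + 2 * r n) + Y n * (1 - 2 * r n)) / 2 = ((lc n - mu v n) + (ls n - mu v n)) / 2 / (?s * w)"
        by (simp only: add_divide_distrib[symmetric] divide_divide_eq_left mult.commute)
      also have "((lc n - mu v n) + (ls n - mu v n)) / 2 = (lambda_minus v n + lambda_plus v n) / 2 - mu v n"
        using elim(4) by (auto simp: field_simps)
      also have "((lambda_minus v n + lambda_plus v n) / 2 - mu v n) / (?s * w)
        = (mu v n - (lambda_minus v n + lambda_plus v n) / 2) / (- ?s * w)" by (rule neg[symmetric])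
      finally show ?case unfolding w_def .
    qed
  qed
  show ?thesis using ra2 rb2 g p m mean by blast
qed

end
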